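(* Let $\mathcal{E}$ be a Banach space of sequences on $\mathbb{Z}^k$ satisfying (i)–(iii) of the context and such that the translations $\mathcal{S}_1,\dots,\mathcal{S}_k$ and their inverses are bounded on $\mathcal{E}$. 1) For $M\in\mu(\mathcal{E})$, $\overline{\widetilde{M}(\overset{\circ}{\mathbb{Z}^k_{\mathcal{E}}})}\subset\sigma(M)$. 2) For $M\in\mathcal{A}$, $\widetilde{M}(\mathbb{Z}^k_{\mathcal{E}})=\sigma(M)$.
   Context: $F(\mathbb{Z}^k)$ is the space of complex sequences on $\mathbb{Z}^k$ with finitely many non-zero terms. $\mathcal{E}\subset\mathbb{C}^{\mathbb{Z}^k}$ is a Banach space with: (i) $F(\mathbb{Z}^k)$ is a dense subset of $\mathcal{E}$; (ii) for every $n\in\mathbb{Z}^k$, $x\mapsto x(n)$ is continuous from $\mathcal{E}$ to $\mathbb{C}$; (iii) for every $z\in\mathbb{T}^k$ (where $\mathbb{T}=\{z\in\mathbb{C}:|z|=1\}$), $\psi_z(\mathcal{E})\subset\mathcal{E}$, where $(\psi_z(x))(n_1,\dots,n_k)=x(n_1,\dots,n_k)z_1^{n_1}\cdots z_k^{n_k}$, and $\sup_{z\in\mathbb{T}^k}\|\psi_z\|<+\infty$. $\mathcal{S}_i$ is the translation by the $i$-th unit vector of $\mathbb{Z}^k$, i.e. convolution with the sequence equal to $1$ at that unit vector and $0$ elsewhere. $\mu(\mathcal{E})$ is the space of bounded operators on $\mathcal{E}$ commuting with the translations; $\sigma(M)$ is the spectrum of $M$ on $\mathcal{E}$. For $\phi\in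 F(\mathbb{Z}^k)$, $M_\phi f=\phi*f$ for $f\in\mathcal{E}$, a bounded operator on $\mathcal{E}$. $\mathcal{A}$ is the closure, in the operator norm topology, of the algebra generated by the operators $M_\phi$, $\phi\in F(\mathbb{Z}^k)$. Define $$\mathbb{Z}^k_{\mathcal{E}}=\Big\{z\in\mathbb{C}^k:\ \Big|\sum_{n\in\mathbb{Z}^k}\phi(n)z_1^{n_1}\cdots z_k^{n_k}\Big|\le\|M_\phi\|\ \ \forall\phi\in F(\mathbb{Z}^k)\Big\}$$ (all such $z$ have non-zero coordinates), and let $\overset{\circ}{\mathbb{Z}^k_{\mathcal{E}}}$ be its interior. For $M\in\mu(\mathcal{E})$ put $\widehat{M}=M(e_0)$, where $e_0$ is $1$ at $0\in\mathbb{Z}^k$ and $0$ elsewhere; the symbol is $\widetilde{M}(z)=\sum_{n\in\mathbb{Z}^k}\widehat{M}(n)z_1^{n_1}\cdots z_k^{n_k}$. It is known that $\widetilde{M}$ is a bounded holomorphic function on $\overset{\circ}{\mathbb{Z}^k_{\mathcal{E}}}$ when this set is non-empty. For $M\in\mathcal{A}$, with $M=\lim_m M_{\phi_m}$ in operator norm, $\phi_m\in F(\mathbb{Z}^k)$, the symbol $\widetilde{M}$ on all of $\mathbb{Z}^k_{\mathcal{E}}$ is understood as the uniform limit on $\mathbb{Z}^k_{\mathcal{E}}$ of the Laurent polynomials $\sum_n\phi_m(n)z_1^{n_1}\cdots z_k^{n_k}$ (it exists and is independent of the choice of $(\phi_m)$ by definition of $\mathbb{Z}^k_{\mathcal{E}}$).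 The bar denotes closure in $\mathbb{C}$. *)

theory Defs
  imports "HOL-Analysis.Analysis" "HOL-Library.Function_Algebras"
begin

text \<open>
  Sequences on $\mathbb{Z}^k$ are functions on \<open>int ^ 'k\<close>, with \<open>k = CARD('k)\<close>.  Sums and
  differences of sequences and of operators are the pointwise ones from
  \<^theory>\<open>HOL-Library.Function_Algebras\<close>; its pointwise product is not used.
\<close>

type_synonym 'k seq = "int ^ 'k \<Rightarrow> complex"

definition smul :: "complex \<Rightarrow> 'k seq \<Rightarrow> 'k::finite seq" where
  "smul c x = (\<lambda>n. c * x n)"

definition finseqs :: "'k::finite seq set" where
  "finseqs = {x. finite {n. x n \<noteq> 0}}"

definition delta :: "int ^ 'k \<Rightarrow> 'k::finite seq" where
  "delta m = (\<lambda>n. if n = m then 1 else 0)"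

definition translation :: "int ^ 'k \<Rightarrow> 'k seq \<Rightarrow> 'k::finite seq" where
  "translation a x = (\<lambda>n. x (n - a))"

definition conv :: "'k seq \<Rightarrow> 'k seq \<Rightarrow> 'k::finite seq" where
  "conv \<phi> f = (\<lambda>n. \<Sum>m | \<phi> m \<noteq> 0. \<phi> m * f (n - m))"

lemma conv_delta: "conv (delta a) = translation a"
  by (simp add: fun_eq_iff conv_def delta_def translation_def)

definition monomial :: "complex ^ 'k \<Rightarrow> int ^ 'k \<Rightarrow> complex" where
  "monomial z n = (\<Prod>i\<in>UNIV. (z $ i) powi (n $ i))"

definition laurent :: "'k seq \<Rightarrow> complex ^ 'k::finite \<Rightarrow> complex" where
  "laurent \<phi> z = (\<Sum>n | \<phi> n \<noteq> 0. \<phi> n * monomial z n)"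

definition torus :: "(complex ^ 'k) set" where
  "torus = {z. \<forall>i. cmod (z $ i) = 1}"

definition psi :: "complex ^ 'k \<Rightarrow> 'k seq \<Rightarrow> 'k::finite seq" where
  "psi z x = (\<lambda>n. x n * monomial z n)"

text \<open>
  A normed space of sequences is a carrier \<open>E\<close> with a norm \<open>N\<close>; the values of \<open>N\<close> outside \<open>E\<close>
  are irrelevant.  The distance is set to \<open>0\<close> outside \<open>E\<close> because \<^locale>\<open>Metric_space\<close> requires
  nonnegativity and symmetry on the whole type.
\<close>

definition seq_dist :: "'k seq set \<Rightarrow> ('k seq \<Rightarrow> real) \<Rightarrow> 'k seq \<Rightarrow> 'k::finite seq \<Rightarrow> real" where
  "seq_dist E N x y = (if x \<in> E \<and> y \<in> E then N (x - y) else 0)"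

locale normed_seq_space =
  fixes E :: "'k::finite seq set" and N :: "'k seq \<Rightarrow> real"
  assumes zero_mem: "0 \<in> E"
    and add_mem: "\<And>x y. x \<in> E \<Longrightarrow> y \<in> E \<Longrightarrow> x + y \<in> E"
    and smul_mem: "\<And>c x. x \<in> E \<Longrightarrow> smul c x \<in> E"
    and N_nonneg: "\<And>x. x \<in> E \<Longrightarrow> 0 \<le> N x"
    and N_eq_0: "\<And>x. x \<in> E \<Longrightarrow> N x = 0 \<longleftrightarrow> x = 0"
    and N_smul: "\<And>c x. x \<in> E \<Longrightarrow> N (smul c x) = cmod c * N x"
    and N_triangle: "\<And>x y. x \<in> E \<Longrightarrow> y \<in> E \<Longrightarrow> N (x + y) \<le> N x + N y"
begin

lemma diff_mem:
  assumes "x \<in> E" "y \<in> E"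
  shows "x - y \<in> E"
proof -
  have "x - y = x + smul (-1) y" by (simp add: fun_eq_iff smul_def)
  then show ?thesis using assms add_mem smul_mem by metis
qed

lemma N_diff_commute:
  assumes "x \<in> E" "y \<in> E"
  shows "N (x - y) = N (y - x)"
proof -
  have "x - y = smul (-1) (y - x)" by (simp add: fun_eq_iff smul_def)
  then have "N (x - y) = N (smul (-1) (y - x))" by (rule arg_cong)
  then show ?thesis using N_smul[of "y - x" "-1"] diff_mem assms by simp
qed

sublocale Metric_space E "seq_dist E N"
proof
  fix x y z
  show "0 \<le> seq_dist E N x y"
    by (simp add: seq_dist_def N_nonneg diff_mem)
  show "seq_dist E N x y = seq_dist E N y x"
    by (auto simp: seq_dist_def N_diff_commute)
  assume xy: "x \<in> E" "y \<in> E"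
  then show "seq_dist E N x y = 0 \<longleftrightarrow> x = y"
    by (simp add: seq_dist_def N_eq_0 diff_mem)
  assume z: "z \<in> E"
  have "x - z = (x - y) + (y - z)" by simp
  then show "seq_dist E N x z \<le> seq_dist E N x y + seq_dist E N y z"
    using N_triangle[of "x - y" "y - z"] xy z diff_mem by (simp add: seq_dist_def)
qed

end

locale banach_seq_space = normed_seq_space E N
  for E :: "'k::finite seq set" and N :: "'k seq \<Rightarrow> real" +
  assumes complete: mcomplete
    and finseqs_subset: "finseqs \<subseteq> E"
    and finseqs_dense: "mtopology closure_of finseqs = E"
    and continuous_eval: "\<And>n. continuous_map mtopology euclidean (\<lambda>x. x n)"
    and psi_mem: "\<And>z. z \<in> torus \<Longrightarrow> psi z ` E \<subseteq> E"
    and psi_bounded: "\<exists>C. \<forall>z\<in>torus. \<forall>x\<in>E. N (psi z x) \<le> C * N x"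

text \<open>
  Operators on \<open>E\<close> are total functions on sequences, of which only the restriction to \<open>E\<close>
  matters.
\<close>

definition bounded_op :: "'k seq set \<Rightarrow> ('k seq \<Rightarrow> real) \<Rightarrow> ('k seq \<Rightarrow> 'k::finite seq) \<Rightarrow> bool" where
  "bounded_op E N T \<longleftrightarrow>
     T ` E \<subseteq> E \<and>
     (\<forall>x\<in>E. \<forall>y\<in>E. T (x + y) = T x + T y) \<and>
     (\<forall>c. \<forall>x\<in>E. T (smul c x) = smul c (T x)) \<and>
     (\<exists>C. \<forall>x\<in>E. N (T x) \<le> C * N x)"

text \<open>Meaningful for bounded operators only.\<close>

definition op_norm :: "'k seq set \<Rightarrow> ('k seq \<Rightarrow> real) \<Rightarrow> ('k seq \<Rightarrow> 'k::finite seq) \<Rightarrow> real" where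
  "op_norm E N T = (SUP x\<in>{x\<in>E. N x \<le> 1}. N (T x))"

definition op_spectrum ::
    "'k seq set \<Rightarrow> ('k seq \<Rightarrow> real) \<Rightarrow> ('k seq \<Rightarrow> 'k::finite seq) \<Rightarrow> complex set" where
  "op_spectrum E N T =
     {c. \<not> (\<exists>R. bounded_op E N R \<and>
              (\<forall>x\<in>E. R (T x - smul c x) = x \<and> T (R x) - smul c (R x) = x))}"

definition multipliers ::
    "'k seq set \<Rightarrow> ('k seq \<Rightarrow> real) \<Rightarrow> ('k seq \<Rightarrow> 'k::finite seq) set" where
  "multipliers E N =
     {T. bounded_op E N T \<and>
         (\<forall>i. \<forall>x\<in>E. T (translation (axis i 1) x) = translation (axis i 1) (T x))}"

inductive_set conv_algebra :: "('k seq \<Rightarrow> 'k::finite seq) set" where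
  conv: "\<phi> \<in> finseqs \<Longrightarrow> conv \<phi> \<in> conv_algebra"
| add: "A \<in> conv_algebra \<Longrightarrow> B \<in> conv_algebra \<Longrightarrow> A + B \<in> conv_algebra"
| scale: "A \<in> conv_algebra \<Longrightarrow> (\<lambda>x. smul c (A x)) \<in> conv_algebra"
| compose: "A \<in> conv_algebra \<Longrightarrow> B \<in> conv_algebra \<Longrightarrow> A \<circ> B \<in> conv_algebra"

definition closed_conv_algebra ::
    "'k seq set \<Rightarrow> ('k seq \<Rightarrow> real) \<Rightarrow> ('k seq \<Rightarrow> 'k::finite seq) set" where
  "closed_conv_algebra E N =
     {T. bounded_op E N T \<and> (\<forall>e>0. \<exists>A\<in>conv_algebra. op_norm E N (T - A) < e)}"

text \<open>
  Nonvanishing of the coordinates has to be required here: in HOL, \<open>0 powi n = 0\<close> for all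
  \<open>n \<noteq> 0\<close>, so points with a zero coordinate, where Laurent polynomials are undefined, could
  otherwise satisfy the inequality.
\<close>

definition Z_set :: "'k seq set \<Rightarrow> ('k seq \<Rightarrow> real) \<Rightarrow> (complex ^ 'k::finite) set" where
  "Z_set E N =
     {z. (\<forall>i. z $ i \<noteq> 0) \<and>
         (\<forall>\<phi>\<in>finseqs. cmod (laurent \<phi> z) \<le> op_norm E N (conv \<phi>))}"

definition symbol :: "('k seq \<Rightarrow> 'k seq) \<Rightarrow> complex ^ 'k::finite \<Rightarrow> complex" where
  "symbol T z = (\<Sum>\<^sub>\<infinity>n. T (delta 0) n * monomial z n)"

text \<open>
  The symbol on the whole of \<^term>\<open>Z_set E N\<close> for operators in the closed algebra: the uniform
  limit of the Laurent polynomials of any approximating sequence.  The choice operator leaves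
  only the values outside \<^term>\<open>Z_set E N\<close> undetermined.
\<close>

definition ext_symbol ::
    "'k seq set \<Rightarrow> ('k seq \<Rightarrow> real) \<Rightarrow> ('k seq \<Rightarrow> 'k seq) \<Rightarrow> complex ^ 'k::finite \<Rightarrow> complex" where
  "ext_symbol E N T =
     (SOME f. \<exists>\<phi>. (\<forall>m. \<phi> m \<in> finseqs) \<and>
                 (\<lambda>m. op_norm E N (T - conv (\<phi> m))) \<longlonglongrightarrow> 0 \<and>
                 uniform_limit (Z_set E N) (\<lambda>m. laurent (\<phi> m)) f sequentially)"

end

theory Submission
  imports Defs "HOL-Library.Poly_Mapping"
begin

text \<open>
  The symbol at a point \<open>z\<close> of \<^const>\<open>Z_set\<close> is a character of the algebra of convolutions, and the
  theorem says that these characters see exactly the failure of invertibility on the whole space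
  \<open>E\<close>.  Write $S^n$ for the translations and $\widehat M$ for \<open>M (delta 0)\<close>.
  
  The tool for passing from operators to Laurent polynomials is averaging over rotations.
  Formally a multiplier is $M = \sum_n \widehat M(n) S^n$, and conjugation by \<open>psi w\<close> multiplies the
  coefficient of $S^n$ by $w^{-n}$.  Averaging the conjugates against a trigonometric polynomial
  \<open>p\<close> therefore gives the convolution with the finite sequence $p \widehat M$, and its norm is at
  most $C^2 \|M\|$ times the mean of $|p|$, where \<open>C\<close> bounds all \<open>psi w\<close>.  The averages run over the
  points whose coordinates are \<open>m\<close>-th roots of unity, with \<open>m\<close> tending to infinity, and so are finite
  sums of operators (\<open>mean_bound\<close>).  Two choices of \<open>p\<close> matter.  A monomial yields
  $|\widehat M(n) z^n| \le C^2 \|M\|$ on \<^const>\<open>Z_set\<close> (\<open>fourier_coefficient_bound\<close>), hence geometric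
  decay at interior points.  The Fejer kernels are positive of mean 1, so they yield convolutions
  $M_{g_d}$ of bounded norm that approximate the given multiplier (\<open>fejer_mean_bound\<close>).
  
  Interior points (\<open>symbol_interior_in_spectrum\<close>).  Let \<open>c\<close> be the symbol of \<open>M\<close> at \<open>z\<close>, and suppose that
  $Q = M - c$ has an inverse \<open>R\<close>.  With Fejer means $g_d$ of $\widehat R$, the series of
  $g_d * \widehat Q$ at \<open>z\<close> is the product of the two symbols, hence zero.  Its terms are dominated by
  one geometric series and tend to those of $R Q e_0 = e_0$, whose symbol is 1.
  
  Symbol values lie in the spectrum (\<open>ext_symbol_in_spectrum\<close>).  By perturbation it is enough that
  $M_P$ is not invertible when the Laurent polynomial \<open>P\<close> vanishes at \<open>z\<close>.  If \<open>R\<close> were its inverse, the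
  rotations of \<open>R\<close> would be the inverses of the rotations of $M_P$, which depend Lipschitz
  continuously on \<open>w\<close> in operator norm.  Then the Fejer means $M_g$ of \<open>R\<close> converge to \<open>R\<close> in operator
  norm (\<open>inverse_in_closure\<close>), so $I - M_P M_g$ has norm less than 1 for a suitable \<open>g\<close>, although
  its symbol at \<open>z\<close> is 1.
  
  Spectral values are symbol values (\<open>spectrum_in_ext_symbol_image\<close>).  If $Q = M - c$ is not
  invertible, then $q(\phi) = \inf_Y \|M_\phi + Q Y\|$, with \<open>Y\<close> running through the bounded operators
  commuting with \<open>Q\<close>, is a submultiplicative seminorm on Laurent polynomials with $q(1) \ge 1$.  In a
  commutative algebra with such a seminorm every element \<open>a\<close> has a $\lambda$ for which
  $a - \lambda$ is a topological divisor of zero (\<open>exists_topological_zero_divisor\<close>), and the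
  quotient seminorm modulo $a - \lambda$ still satisfies $q(1) \ge 1$ (\<open>scalar_seminorm_quotient\<close>).
  After one such quotient for each of the \<open>k\<close> coordinate translations, evaluation at the resulting
  point \<open>z\<close> satisfies $|\phi(z)| \le q(\phi)$; this puts \<open>z\<close> into \<^const>\<open>Z_set\<close> and makes \<open>c\<close> the symbol
  of \<open>M\<close> there.
\<close>

section \<open>Topological divisors of zero in seminormed commutative algebras\<close>

lemma le_add_INF:
  fixes f :: "'a \<Rightarrow> real" and g :: "'b \<Rightarrow> real"
  assumes "A \<noteq> {}" "B \<noteq> {}" "\<And>a b. a \<in> A \<Longrightarrow> b \<in> B \<Longrightarrow> c \<le> f a + g b"
  shows "c \<le> (INF a\<in>A. f a) + (INF b\<in>B. g b)"
proof -
  have "c - f a \<le> (INF b\<in>B. g b)" if "a \<in> A" for a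
    using assms that by (intro cINF_greatest) (auto simp: algebra_simps)
  then have "c - (INF b\<in>B. g b) \<le> (INF a\<in>A. f a)"
    using assms(1) by (intro cINF_greatest) (auto simp: algebra_simps)
  then show ?thesis by simp
qed

lemma le_cmult_INF:
  fixes f :: "'a \<Rightarrow> real"
  assumes "A \<noteq> {}" "r \<ge> 0" "\<And>a. a \<in> A \<Longrightarrow> c \<le> r * f a"
  shows "c \<le> r * (INF a\<in>A. f a)"
proof (cases "r = 0")
  case True
  then show ?thesis using assms by auto
next
  case False
  then have "c / r \<le> (INF a\<in>A. f a)"
    using assms by (intro cINF_greatest) (auto simp: field_simps)
  then show ?thesis using assms(2) False by (simp add: field_simps)
qed

lemma le_mult_INF:
  fixes f :: "'a \<Rightarrow> real" and g :: "'b \<Rightarrow> real"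
  assumes "A \<noteq> {}" "B \<noteq> {}" "\<And>a. a \<in> A \<Longrightarrow> 0 \<le> f a" "\<And>b. b \<in> B \<Longrightarrow> 0 \<le> g b"
    and "\<And>a b. a \<in> A \<Longrightarrow> b \<in> B \<Longrightarrow> c \<le> f a * g b"
  shows "c \<le> (INF a\<in>A. f a) * (INF b\<in>B. g b)"
proof -
  have "0 \<le> (INF b\<in>B. g b)" using assms by (intro cINF_greatest) auto
  moreover have "c \<le> (INF b\<in>B. g b) * f a" if "a \<in> A" for a
    using le_cmult_INF[of B "f a" c g] assms that by (simp add: mult.commute)
  ultimately show ?thesis
    using le_cmult_INF[of A "INF b\<in>B. g b" c f] assms(1) by (simp add: mult.commute)
qed

lemma root_of_unity_not_annihilated:
  assumes "m > 0" "\<not> int m dvd n"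
  obtains \<zeta> :: complex where "\<zeta> ^ m = 1" "\<zeta> powi n \<noteq> 1"
proof
  define r where "r = nat (n mod int m)"
  have r: "n = int m * (n div int m) + int r" "r < m" "r \<noteq> 0"
  proof -
    have "0 \<le> n mod int m" "n mod int m < int m" "n mod int m \<noteq> 0"
      using assms by (auto simp: dvd_eq_mod_eq_0)
    then show "n = int m * (n div int m) + int r" "r < m" "r \<noteq> 0"
      by (auto simp: r_def nat_less_iff)
  qed
  define \<zeta> where "\<zeta> = exp (2 * of_real pi * \<i> * of_nat 1 / of_nat m)"
  show 1: "\<zeta> ^ m = 1"
    unfolding \<zeta>_def by (rule complex_root_unity) (use assms in simp)
  have "\<zeta> \<noteq> 0" by (simp add: \<zeta>_def)
  then have "\<zeta> powi n = \<zeta> powi (int m * (n div int m)) * \<zeta> powi int r"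
    using r(1) by (metis power_int_add)
  also have "\<zeta> powi (int m * (n div int m)) = 1"
    by (simp add: power_int_mult 1)
  also have "\<zeta> powi int r = exp (2 * of_real pi * \<i> * of_nat r / of_nat m)"
    by (simp add: \<zeta>_def exp_of_nat_mult [symmetric] field_simps)
  finally show "\<zeta> powi n \<noteq> 1"
    using complex_root_unity_eq_1[of m r] r assms by (auto dest: dvd_imp_le)
qed

lemma sum_roots_of_unity_power:
  assumes "0 < j" "j < n"
  shows "(\<Sum>w | w ^ n = (1::complex). w ^ j) = 0"
proof -
  let ?W = "{w::complex. w ^ n = 1}"
  have "\<not> int n dvd int j" using assms by (auto dest: dvd_imp_le)
  then obtain \<zeta> :: complex where \<zeta>: "\<zeta> ^ n = 1" "\<zeta> powi int j \<noteq> 1"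
    using root_of_unity_not_annihilated[of n "int j"] assms by auto
  have nz: "\<zeta> \<noteq> 0" using \<zeta>(1) assms by (auto simp: power_0_left)
  have "(\<Sum>w\<in>?W. w ^ j) = (\<Sum>w\<in>?W. (\<zeta> * w) ^ j)"
    by (rule sum.reindex_bij_witness[of _ "\<lambda>w. \<zeta> * w" "\<lambda>w. w / \<zeta>"])
       (use nz \<zeta> in \<open>auto simp: power_mult_distrib power_divide\<close>)
  also have "\<dots> = \<zeta> ^ j * (\<Sum>w\<in>?W. w ^ j)"
    by (simp add: power_mult_distrib sum_distrib_left)
  finally show ?thesis using \<zeta>(2) by simp
qed

text \<open>
  The scalars enter through a ring homomorphism \<open>sc\<close>, so that the monoid algebra of the lattice,
  which is only a commutative ring, can be used directly.  The condition \<open>1 \<le> q 1\<close> says that \<open>q\<close> comes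
  from a proper ideal.  Homogeneity is assumed as an inequality, the form in which it is proved for
  seminorms defined by an infimum; it implies equality.
\<close>

locale scalar_seminorm =
  fixes sc :: "complex \<Rightarrow> 'a::comm_ring_1" and q :: "'a \<Rightarrow> real"
  assumes sc_add: "sc (a + b) = sc a + sc b"
    and sc_mult: "sc (a * b) = sc a * sc b"
    and sc_1: "sc 1 = 1"
    and q_add: "q (x + y) \<le> q x + q y"
    and q_mult: "q (x * y) \<le> q x * q y"
    and q_sc_le: "q (sc c * x) \<le> cmod c * q x"
    and q_1: "1 \<le> q 1"
begin

lemma sc_0: "sc 0 = 0" using sc_add[of 0 0] by simp
lemma sc_minus: "sc (- a) = - sc a"
  using sc_add[of a "- a"] by (simp add: sc_0 eq_neg_iff_add_eq_0 add.commute)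
lemma sc_diff: "sc (a - b) = sc a - sc b"
  using sc_add[of a "- b"] by (simp add: sc_minus)
lemma sc_power: "sc (a ^ n) = sc a ^ n"
  by (induction n) (simp_all add: sc_1 sc_mult)
lemma sc_sum: "sc (sum f A) = (\<Sum>a\<in>A. sc (f a))"
  by (induction A rule: infinite_finite_induct) (simp_all add: sc_0 sc_add)

lemma q_sc: "q (sc c * x) = cmod c * q x"
proof (cases "c = 0")
  case True
  then show ?thesis using q_sc_le[of 0 x] q_add[of 0 0] by (simp add: sc_0)
next
  case False
  have "sc (inverse c) * (sc c * x) = x"
    using False by (simp add: sc_1 flip: mult.assoc sc_mult)
  then have "q x \<le> cmod (inverse c) * q (sc c * x)"
    using q_sc_le[of "inverse c" "sc c * x"] by simp
  then have "cmod c * q x \<le> cmod c * (cmod (inverse c) * q (sc c * x))"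
    by (intro mult_left_mono) auto
  also have "\<dots> = q (sc c * x)"
    using False by (simp add: norm_inverse)
  finally show ?thesis using q_sc_le[of c x] by simp
qed

lemma q_0: "q 0 = 0" using q_sc[of 0 0] by (simp add: sc_0)
lemma q_minus: "q (- x) = q x"
  using q_sc[of "-1" x] by (simp add: sc_minus sc_1)
lemma q_nonneg: "0 \<le> q x"
  using q_add[of x "- x"] by (simp add: q_0 q_minus)
lemma q_diff: "q (x - y) \<le> q x + q y"
  using q_add[of x "- y"] by (simp add: q_minus)
lemma q_diff_ge: "q x - q y \<le> q (x - y)"
  using q_add[of "x - y" y] by simp
lemma q_sum: "q (sum f A) \<le> (\<Sum>a\<in>A. q (f a))"
proof (induction A rule: infinite_finite_induct)
  case (insert a A)
  then show ?case using q_add[of "f a" "sum f A"] by simp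
qed (simp_all add: q_0)

text \<open>
  An element that is not bounded below is a topological divisor of zero.
\<close>

definition bounded_below :: "'a \<Rightarrow> bool" where
  "bounded_below b \<longleftrightarrow> (\<exists>\<delta>>0. \<forall>x. \<delta> * q x \<le> q (b * x))"

lemma bounded_below_uniform:
  assumes K: "compact K" and bb: "\<And>z. z \<in> K \<Longrightarrow> bounded_below (1 - sc z * a)"
  obtains \<delta> where "\<delta> > 0" "\<And>z x. z \<in> K \<Longrightarrow> \<delta> * q x \<le> q ((1 - sc z * a) * x)"
proof -
  have "\<forall>z\<in>K. \<exists>\<delta>>0. \<forall>x. \<delta> * q x \<le> q ((1 - sc z * a) * x)"
    using bb by (simp add: bounded_below_def)
  then obtain d where d: "\<And>z. z \<in> K \<Longrightarrow> d z > 0"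
      "\<And>z x. z \<in> K \<Longrightarrow> d z * q x \<le> q ((1 - sc z * a) * x)"
    by metis
  define e where "e z = d z / (2 * (q a + 1))" for z
  have e: "e z > 0" if "z \<in> K" for z
    using d(1)[OF that] q_nonneg[of a] by (simp add: e_def)
  obtain C where C: "C \<subseteq> K" "finite C" "K \<subseteq> (\<Union>z\<in>C. ball z (e z))"
    by (rule compactE_image[OF K, of K "\<lambda>z. ball z (e z)"]) (use e in force)+
  define \<delta> where "\<delta> = Min (insert 1 (d ` C)) / 2"
  have "\<delta> > 0" using C d(1) by (auto simp: \<delta>_def)
  moreover have "\<delta> * q x \<le> q ((1 - sc z * a) * x)" if zK: "z \<in> K" for z x
  proof -
    obtain c where c: "c \<in> C" "dist c z < e c" using subsetD[OF C(3) zK] by auto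
    have cK: "c \<in> K" using c C by auto
    have "\<delta> \<le> d c / 2"
      using C(2) c(1) by (auto simp: \<delta>_def intro: Min_le)
    have "cmod (c - z) * q a \<le> e c * q a"
      using c(2) q_nonneg by (intro mult_right_mono) (auto simp: dist_norm)
    also have "\<dots> \<le> d c / 2"
      using d(1)[OF cK] q_nonneg[of a] by (simp add: e_def field_simps)
    finally have le: "cmod (c - z) * q a \<le> d c / 2" .
    have "d c * q x \<le> q ((1 - sc c * a) * x)" using d(2) cK by blast
    also have "(1 - sc c * a) * x = (1 - sc z * a) * x - sc (c - z) * (a * x)"
      by (simp add: algebra_simps sc_diff)
    also have "q \<dots> \<le> q ((1 - sc z * a) * x) + cmod (c - z) * q (a * x)"
      using q_diff q_sc by metis
    also have "cmod (c - z) * q (a * x) \<le> cmod (c - z) * (q a * q x)"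
      by (intro mult_left_mono q_mult) auto
    also have "\<dots> = (cmod (c - z) * q a) * q x" by simp
    also have "\<dots> \<le> d c / 2 * q x" using le q_nonneg by (intro mult_right_mono) auto
    finally have "d c / 2 * q x \<le> q ((1 - sc z * a) * x)" by (simp add: field_simps)
    moreover have "\<delta> * q x \<le> d c / 2 * q x"
      using \<open>\<delta> \<le> d c / 2\<close> q_nonneg by (intro mult_right_mono) auto
    ultimately show ?thesis by simp
  qed
  ultimately show thesis using that by blast
qed

text \<open>
  Partial fractions over the roots of unity without any division: for $w^n = 1$ the geometric sum
  \<open>c w x\<close> plays the role of $(1 - x^n) / (1 - w x)$, and the mean of \<open>c w x\<close> over all such \<open>w\<close> is 1.
  Hence \<open>U - V\<close> is the mean of the terms \<open>c w u * (1 - V) - c w v * (1 - U)\<close>, each of which is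
  \<open>w * (t - s) * a * (c w u * c w v)\<close>.  The lower bounds for $1 - w u$ and $1 - w v$ then
  estimate the product of the two cofactors by \<open>(1 - U) * (1 - V)\<close>.
\<close>

lemma power_difference_bound:
  assumes n: "n > 0" and \<delta>: "\<delta> > 0" and t: "0 \<le> t" "t \<le> T" and s: "0 \<le> s" "s \<le> T"
    and bb: "\<And>z x. cmod z \<le> T \<Longrightarrow> \<delta> * q x \<le> q ((1 - sc z * a) * x)"
  defines "U \<equiv> (sc (of_real t) * a) ^ n" and "V \<equiv> (sc (of_real s) * a) ^ n"
  shows "q (U - V) \<le> \<bar>t - s\<bar> * q a / \<delta>\<^sup>2 * q ((1 - U) * (1 - V))"
proof -
  define W where "W = {w::complex. w ^ n = 1}"
  have fin: "finite W" and card: "card W = n"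
    unfolding W_def using n finite_roots_unity[of n] card_complex_roots_unity[of n] by auto
  define u v where "u = sc (of_real t) * a" and "v = sc (of_real s) * a"
  define c where "c w x = (\<Sum>j<n. (sc w * x) ^ j)" for w x
  have c: "(1 - sc w * x) * c w x = 1 - x ^ n" if "w \<in> W" for w x
    using that unfolding c_def one_diff_power_eq[symmetric]
    by (simp add: power_mult_distrib W_def sc_power[symmetric] sc_1)
  have sum_c: "(\<Sum>w\<in>W. c w x) = sc (of_nat n)" for x
  proof -
    have "(\<Sum>w\<in>W. c w x) = (\<Sum>j<n. \<Sum>w\<in>W. (sc w * x) ^ j)"
      unfolding c_def by (rule sum.swap)
    also have "\<dots> = (\<Sum>j<n. sc (\<Sum>w\<in>W. w ^ j) * x ^ j)"
      by (simp add: power_mult_distrib sc_power sc_sum sum_distrib_right)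
    also have "\<dots> = (\<Sum>j<n. if j = 0 then sc (of_nat n) else 0)"
      by (intro sum.cong refl) (auto simp: W_def sum_roots_of_unity_power sc_0 card[unfolded W_def])
    finally show ?thesis using n by simp
  qed
  have norm_W: "cmod w = 1" if "w \<in> W" for w
    using that n power_eq_1_iff by (fastforce simp: W_def)
  have "sc (of_nat n) * (U - V) = (\<Sum>w\<in>W. c w u * (1 - V) - c w v * (1 - U))"
    by (simp only: sum_subtractf sum_distrib_right[symmetric] sum_c) (simp add: algebra_simps)
  also have "\<dots> = (\<Sum>w\<in>W. sc (w * of_real (t - s)) * (a * (c w u * c w v)))"
  proof (rule sum.cong[OF refl])
    fix w assume w: "w \<in> W"
    have "c w u * (1 - V) - c w v * (1 - U) =
        c w u * ((1 - sc w * v) * c w v) - c w v * ((1 - sc w * u) * c w u)"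
      using c[OF w, of u] c[OF w, of v] by (simp add: U_def V_def u_def v_def)
    also have "\<dots> = sc w * (u - v) * (c w u * c w v)" by (simp add: algebra_simps)
    also have "\<dots> = sc (w * of_real (t - s)) * (a * (c w u * c w v))"
      by (simp add: u_def v_def sc_diff sc_mult algebra_simps)
    finally show "c w u * (1 - V) - c w v * (1 - U) = \<dots>" .
  qed
  finally have eq: "sc (of_nat n) * (U - V) = \<dots>" .
  have "real n * q (U - V) = q (sc (of_nat n) * (U - V))" by (simp add: q_sc)
  also have "\<dots> \<le> (\<Sum>w\<in>W. q (sc (w * of_real (t - s)) * (a * (c w u * c w v))))"
    unfolding eq by (rule q_sum)
  also have "\<dots> \<le> (\<Sum>w\<in>W. \<bar>t - s\<bar> * q a / \<delta>\<^sup>2 * q ((1 - U) * (1 - V)))"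
  proof (rule sum_mono)
    fix w assume w: "w \<in> W"
    let ?C = "c w u * c w v"
    have bu: "\<delta> * q x \<le> q ((1 - sc w * u) * x)" for x
      using bb[of "w * of_real t" x] t norm_W[OF w]
      by (simp add: u_def sc_mult mult.assoc norm_mult)
    have bv: "\<delta> * q x \<le> q ((1 - sc w * v) * x)" for x
      using bb[of "w * of_real s" x] s norm_W[OF w]
      by (simp add: v_def sc_mult mult.assoc norm_mult)
    have "\<delta> * (\<delta> * q ?C) \<le> \<delta> * q ((1 - sc w * u) * ?C)"
      using bu \<delta> by (intro mult_left_mono) auto
    also have "\<dots> \<le> q ((1 - sc w * v) * ((1 - sc w * u) * ?C))" by (rule bv)
    also have "(1 - sc w * v) * ((1 - sc w * u) * ?C) =
        ((1 - sc w * u) * c w u) * ((1 - sc w * v) * c w v)" by (simp add: algebra_simps)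
    also have "\<dots> = (1 - U) * (1 - V)" by (simp only: c[OF w] U_def V_def u_def v_def)
    finally have C: "q ?C \<le> q ((1 - U) * (1 - V)) / \<delta>\<^sup>2"
      using \<delta> by (simp add: field_simps power2_eq_square)
    have "q (sc (w * of_real (t - s)) * (a * ?C)) = \<bar>t - s\<bar> * q (a * ?C)"
      by (simp add: q_sc norm_mult norm_W[OF w] del: of_real_diff)
    also have "\<dots> \<le> \<bar>t - s\<bar> * (q a * (q ((1 - U) * (1 - V)) / \<delta>\<^sup>2))"
      using q_mult[of a ?C] mult_left_mono[OF C q_nonneg[of a]]
      by (intro mult_left_mono) auto
    finally show "q (sc (w * of_real (t - s)) * (a * ?C)) \<le>
        \<bar>t - s\<bar> * q a / \<delta>\<^sup>2 * q ((1 - U) * (1 - V))" by (simp add: field_simps)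
  qed
  also have "\<dots> = real n * (\<bar>t - s\<bar> * q a / \<delta>\<^sup>2 * q ((1 - U) * (1 - V)))"
    by (simp add: card)
  finally have "real n * q (U - V) \<le> real n * (\<bar>t - s\<bar> * q a / \<delta>\<^sup>2 * q ((1 - U) * (1 - V)))" .
  then show ?thesis using n by (subst (asm) mult_le_cancel_left_pos) auto
qed

text \<open>
  The nonemptiness of the spectrum, in the style of Rickart's proof.  If every \<open>a - sc c\<close> were
  bounded below, the spectral radius \<open>\<rho>\<close> of \<open>a\<close> would be positive, and the lower bounds of
  \<open>1 - sc z * a\<close> would be uniform on the disc of radius \<open>T = 1 / \<rho>\<close>.  For \<open>s\<close> slightly below \<open>T\<close>
  and suitable \<open>n\<close> the \<open>n\<close>-th power \<open>V\<close> of \<open>s a\<close> is small, so the preceding estimate makes the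
  power \<open>U\<close> of \<open>T a\<close> smaller than 1 as well; but \<open>1 \<le> q U\<close> since \<open>\<rho>\<close> is the infimum of the \<open>n\<close>-th roots of \<open>q (a ^ n)\<close>.
\<close>

lemma exists_topological_zero_divisor: "\<exists>c. \<not> bounded_below (a - sc c)"
proof (rule ccontr)
  assume "\<not> ?thesis"
  then have bb: "bounded_below (a - sc c)" for c by blast
  have bb': "bounded_below (1 - sc z * a)" for z
  proof (cases "z = 0")
    case True
    then show ?thesis by (auto simp: bounded_below_def sc_0 intro!: exI[of _ 1])
  next
    case False
    obtain d where d: "d > 0" "\<And>x. d * q x \<le> q ((a - sc (1 / z)) * x)"
      using bb[of "1 / z"] by (auto simp: bounded_below_def)
    have "(1 - sc z * a) * x = sc (- z) * ((a - sc (1 / z)) * x)" for x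
    proof -
      have "sc z * sc (1 / z) = 1" using False by (simp add: sc_mult[symmetric] sc_1)
      then have "sc z * (sc (1 / z) * x) = x" by (simp add: mult.assoc[symmetric])
      then show ?thesis by (simp add: sc_minus algebra_simps)
    qed
    then have "q ((1 - sc z * a) * x) = cmod z * q ((a - sc (1 / z)) * x)" for x
      by (simp only: q_sc norm_minus_cancel)
    then have "(cmod z * d) * q x \<le> q ((1 - sc z * a) * x)" for x
      using d(2)[of x] by (simp add: mult.assoc mult_left_mono)
    then show ?thesis
      using False d(1) by (auto simp: bounded_below_def intro!: exI[of _ "cmod z * d"])
  qed
  obtain d where d: "d > 0" "\<And>x. d * q x \<le> q (a * x)"
    using bb[of 0] by (auto simp: bounded_below_def sc_0)
  have pow_ge: "d ^ n \<le> q (a ^ n)" for n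
  proof (induction n)
    case (Suc n)
    then have "d * d ^ n \<le> d * q (a ^ n)" using d(1) by (intro mult_left_mono) auto
    also have "\<dots> \<le> q (a * a ^ n)" by (rule d)
    finally show ?case by simp
  qed (simp add: q_1)
  define S where "S = (\<lambda>n. root n (q (a ^ n))) ` {0<..}"
  define \<rho> where "\<rho> = Inf S"
  have "d \<le> root n (q (a ^ n))" if "n > 0" for n
    using real_root_le_mono[OF that pow_ge[of n]] d(1) that by (simp add: real_root_power_cancel)
  then have Sd: "\<forall>x\<in>S. d \<le> x" by (auto simp: S_def)
  have S_ne: "S \<noteq> {}" by (auto simp: S_def)
  have bdd: "bdd_below S" using Sd by (auto simp: bdd_below_def)
  have \<rho>d: "d \<le> \<rho>" unfolding \<rho>_def using S_ne Sd by (intro cInf_greatest) auto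
  then have \<rho>: "\<rho> > 0" using d by simp
  have \<rho>_le: "\<rho> ^ n \<le> q (a ^ n)" if "n > 0" for n
  proof -
    have "\<rho> \<le> root n (q (a ^ n))"
      unfolding \<rho>_def using bdd that by (intro cInf_lower) (auto simp: S_def)
    then have "\<rho> ^ n \<le> root n (q (a ^ n)) ^ n" using \<rho> by (intro power_mono) auto
    then show ?thesis using that q_nonneg by simp
  qed
  define T where "T = 1 / \<rho>"
  have T: "T > 0" using \<rho> by (simp add: T_def)
  obtain \<delta> where \<delta>: "\<delta> > 0" "\<And>z x. z \<in> cball 0 T \<Longrightarrow> \<delta> * q x \<le> q ((1 - sc z * a) * x)"
    using bounded_below_uniform[of "cball 0 T" a] bb' by (metis compact_cball)
  define C where "C = q a / \<delta>\<^sup>2"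
  have C: "C \<ge> 0" using q_nonneg by (simp add: C_def)
  \<comment> \<open>\<open>h\<close> makes the factor \<open>C * h * (q 1 + 1) * q 1\<close> of the final estimate at most \<open>1 / 4\<close>.\<close>
  define h where "h = min (T / 2) (1 / (4 * (C + 1) * (q 1 + 1) * q 1))"
  have h: "h > 0" "h \<le> T / 2" using T C q_1 by (auto simp: h_def)
  define s where "s = T - h"
  have s: "0 < s" "s < T" using h T by (auto simp: s_def)
  have "\<rho> < 1 / s" using s T \<rho> by (simp add: T_def field_simps)
  then obtain x where x: "x \<in> S" "x < 1 / s"
    unfolding \<rho>_def using S_ne bdd by (auto simp: cInf_less_iff)
  then obtain m where m: "m > 0" "root m (q (a ^ m)) < 1 / s" by (auto simp: S_def)
  define \<theta> where "\<theta> = s ^ m * q (a ^ m)"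
  have "root m \<theta> < 1"
    using m s by (simp add: \<theta>_def real_root_mult real_root_power_cancel field_simps)
  then have \<theta>: "0 \<le> \<theta>" "\<theta> < 1" using m s q_nonneg by (auto simp: \<theta>_def)
  obtain j where j: "\<theta> ^ j < 1 / 4"
    using real_arch_pow_inv[of "1 / 4" \<theta>] \<theta>(2) by auto
  have q_pow: "q (y ^ Suc i) \<le> q y ^ Suc i" for y i
  proof (induction i)
    case (Suc i)
    have "q (y ^ Suc (Suc i)) \<le> q y * q (y ^ Suc i)" using q_mult[of y "y ^ Suc i"] by simp
    also have "\<dots> \<le> q y * q y ^ Suc i" using Suc q_nonneg by (intro mult_left_mono) auto
    finally show ?case by simp
  qed simp
  define n where "n = m * Suc j"
  have n: "n > 0" using m by (simp add: n_def)
  define U V where "U = (sc (of_real T) * a) ^ n" and "V = (sc (of_real s) * a) ^ n"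
  have q_scaled: "q ((sc (of_real t) * a) ^ n) = t ^ n * q (a ^ n)" if "t > 0" for t
    using that by (simp add: power_mult_distrib q_sc norm_power flip: sc_power)
  have "q V = s ^ n * q ((a ^ m) ^ Suc j)"
    unfolding V_def q_scaled[OF s(1)] by (simp only: n_def power_mult)
  also have "\<dots> \<le> s ^ n * q (a ^ m) ^ Suc j"
    using s q_pow by (intro mult_left_mono) auto
  also have "\<dots> = \<theta> ^ Suc j" by (simp only: \<theta>_def n_def power_mult power_mult_distrib)
  also have "\<dots> \<le> \<theta> ^ j" using \<theta> by (intro power_decreasing) auto
  finally have V: "q V \<le> 1 / 4" using j by simp
  have U: "1 \<le> q U"
    using \<rho>_le[OF n] \<rho> T by (simp add: U_def q_scaled) (simp add: T_def field_simps)
  have "q (U - V) \<le> h * q a / \<delta>\<^sup>2 * q ((1 - U) * (1 - V))"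
    unfolding U_def V_def
    using power_difference_bound[OF n \<delta>(1), of T T s a] \<delta>(2) s h T by (simp add: s_def)
  also have "\<dots> \<le> C * h * ((q 1 + q U) * (q 1 + 1))"
  proof -
    have "q ((1 - U) * (1 - V)) \<le> q (1 - U) * q (1 - V)" by (rule q_mult)
    also have "\<dots> \<le> (q 1 + q U) * (q 1 + 1)"
      using q_diff[of 1 U] q_diff[of 1 V] V q_nonneg by (intro mult_mono) (auto intro: add_nonneg_nonneg)
    finally have "C * h * q ((1 - U) * (1 - V)) \<le> C * h * ((q 1 + q U) * (q 1 + 1))"
      using C h by (intro mult_left_mono) auto
    then show ?thesis by (simp add: C_def mult.commute)
  qed
  finally have D: "q (U - V) \<le> (C * h * (q 1 + 1)) * (q 1 + q U)" by (simp add: algebra_simps)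
  have \<beta>: "C * h * (q 1 + 1) * q 1 \<le> 1 / 4"
  proof -
    have "h \<le> 1 / (4 * (C + 1) * (q 1 + 1) * q 1)" by (simp add: h_def)
    then have "h * (4 * (C + 1) * (q 1 + 1) * q 1) \<le> 1" using C q_1 by (subst (asm) pos_le_divide_eq) auto
    moreover have "0 \<le> h * (4 * (q 1 + 1) * q 1)" using h q_1 by simp
    ultimately show ?thesis by (simp add: algebra_simps)
  qed
  have "C * h * (q 1 + 1) * 1 \<le> C * h * (q 1 + 1) * q 1"
    using C h q_1 by (intro mult_left_mono) auto
  then have "C * h * (q 1 + 1) * q U \<le> 1 / 4 * q U"
    using \<beta> q_nonneg by (intro mult_right_mono) auto
  moreover have "q U \<le> q V + q (U - V)" using q_diff_ge[of U V] by simp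
  ultimately show False using D V U \<beta> by (simp add: algebra_simps)
qed

definition quotient_seminorm :: "'a \<Rightarrow> 'a \<Rightarrow> real" where
  "quotient_seminorm b x = (INF y. q (x + b * y))"

lemma quotient_le: "quotient_seminorm b x \<le> q (x + b * y)"
  unfolding quotient_seminorm_def by (rule cINF_lower) (auto intro!: bdd_belowI[of _ 0] q_nonneg)

text \<open>
  The hypothesis on \<open>b\<close> enters in \<open>1 \<le> quotient_seminorm b 1\<close>: if \<open>q (1 + b * y) < 1\<close>, then
  \<open>q x\<close> is at most a constant times \<open>q (b * x)\<close>, because \<open>x = (1 + b * y) * x - y * (b * x)\<close>.
\<close>

lemma scalar_seminorm_quotient:
  assumes "\<not> bounded_below b"
  shows "scalar_seminorm sc (quotient_seminorm b)"
proof
  show "sc (x + y) = sc x + sc y" "sc (x * y) = sc x * sc y" "sc 1 = 1" for x y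
    by (rule sc_add sc_mult sc_1)+
next
  fix x y
  have "quotient_seminorm b (x + y) \<le> q (x + b * u) + q (y + b * v)" for u v
    using quotient_le[of b "x + y" "u + v"] q_add[of "x + b * u" "y + b * v"]
    by (simp add: algebra_simps)
  then show "quotient_seminorm b (x + y) \<le> quotient_seminorm b x + quotient_seminorm b y"
    unfolding quotient_seminorm_def[of b x] quotient_seminorm_def[of b y]
    by (intro le_add_INF) auto
  have "quotient_seminorm b (x * y) \<le> q (x + b * u) * q (y + b * v)" for u v
    using quotient_le[of b "x * y" "u * y + x * v + u * b * v"] q_mult[of "x + b * u" "y + b * v"]
    by (simp add: algebra_simps)
  then show "quotient_seminorm b (x * y) \<le> quotient_seminorm b x * quotient_seminorm b y"
    unfolding quotient_seminorm_def[of b x] quotient_seminorm_def[of b y]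
    by (intro le_mult_INF) (auto intro: q_nonneg)
next
  fix c x
  have "quotient_seminorm b (sc c * x) \<le> cmod c * q (x + b * u)" for u
    using quotient_le[of b "sc c * x" "sc c * u"] q_sc[of c "x + b * u"] by (simp add: algebra_simps)
  then show "quotient_seminorm b (sc c * x) \<le> cmod c * quotient_seminorm b x"
    unfolding quotient_seminorm_def[of b x] by (intro le_cmult_INF) auto
next
  show "1 \<le> quotient_seminorm b 1"
    unfolding quotient_seminorm_def
  proof (rule cINF_greatest)
    fix y
    show "1 \<le> q (1 + b * y)"
    proof (rule ccontr)
      assume less: "\<not> 1 \<le> q (1 + b * y)"
      define d where "d = (1 - q (1 + b * y)) / (q y + 1)"
      have d: "d > 0" using less q_nonneg[of y] by (auto simp: d_def)
      have "d * q x \<le> q (b * x)" for x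
      proof -
        have "q x - q ((1 + b * y) * x) \<le> q (x - (1 + b * y) * x)" by (rule q_diff_ge)
        also have "x - (1 + b * y) * x = - (y * (b * x))" by (simp add: algebra_simps)
        also have "q \<dots> \<le> q y * q (b * x)" using q_mult by (simp add: q_minus)
        also have "\<dots> \<le> (q y + 1) * q (b * x)" using q_nonneg by (intro mult_right_mono) auto
        finally have "(1 - q (1 + b * y)) * q x \<le> (q y + 1) * q (b * x)"
          using q_mult[of "1 + b * y" x] by (simp add: algebra_simps)
        then show ?thesis using q_nonneg[of y] by (simp add: d_def field_simps)
      qed
      then show False using d assms by (auto simp: bounded_below_def)
    qed
  qed simp
qed

end

text \<open>
  Passing to successive quotients only decreases the seminorm, so an element that is already
  congruent to a scalar remains so.
\<close>

theorem simultaneous_eigenvalues: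
  assumes "finite A" "scalar_seminorm sc q"
  shows "\<exists>q' c. scalar_seminorm sc q' \<and> (\<forall>x. q' x \<le> q x) \<and> (\<forall>a\<in>A. q' (a - sc (c a)) = 0)"
  using assms
proof (induction A arbitrary: q rule: finite_induct)
  case empty
  then show ?case by auto
next
  case (insert a A)
  interpret scalar_seminorm sc q by fact
  obtain l where l: "\<not> bounded_below (a - sc l)" using exists_topological_zero_divisor by blast
  obtain q' c where q': "scalar_seminorm sc q'" "\<And>x. q' x \<le> quotient_seminorm (a - sc l) x"
      "\<And>x. x \<in> A \<Longrightarrow> q' (x - sc (c x)) = 0"
    using insert.IH[OF scalar_seminorm_quotient[OF l]] by blast
  interpret q': scalar_seminorm sc q' by fact
  have "q' (a - sc l) = 0"
    using q'(2)[of "a - sc l"] q'.q_nonneg[of "a - sc l"] quotient_le[of "a - sc l" "a - sc l" "-1"]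
    by (simp add: q_0)
  moreover have "q' x \<le> q x" for x
    using q'(2)[of x] quotient_le[of "a - sc l" x 0] by simp
  ultimately show ?case
    using q' insert.hyps by (intro exI[of _ q'] exI[of _ "c(a := l)"]) auto
qed

section \<open>Finitely supported sequences and Laurent polynomials\<close>

lemma int_vec_induct [case_names zero plus minus]:
  fixes n :: "int ^ 'k::finite"
  assumes 0: "P 0" and plus: "\<And>n i. P n \<Longrightarrow> P (n + axis i 1)"
    and minus: "\<And>n i. P n \<Longrightarrow> P (n - axis i 1)"
  shows "P n"
proof (induction "\<Sum>i\<in>UNIV. nat \<bar>n $ i\<bar>" arbitrary: n rule: less_induct)
  case less
  show ?case
  proof (cases "n = 0")
    case True
    then show ?thesis using 0 by simp
  next
    case False
    then obtain i where i: "n $ i \<noteq> 0" by (auto simp: vec_eq_iff)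
    have smaller: "(\<Sum>j\<in>UNIV. nat \<bar>m $ j\<bar>) < (\<Sum>j\<in>UNIV. nat \<bar>n $ j\<bar>)"
      if "nat \<bar>m $ i\<bar> < nat \<bar>n $ i\<bar>" "\<And>j. j \<noteq> i \<Longrightarrow> m $ j = n $ j" for m
    proof (rule sum_strict_mono_ex1)
      show "\<forall>j\<in>UNIV. nat \<bar>m $ j\<bar> \<le> nat \<bar>n $ j\<bar>"
      proof
        fix j show "nat \<bar>m $ j\<bar> \<le> nat \<bar>n $ j\<bar>" using that by (cases "j = i") auto
      qed
      show "\<exists>j\<in>UNIV. nat \<bar>m $ j\<bar> < nat \<bar>n $ j\<bar>" using that by blast
    qed simp
    show ?thesis
    proof (cases "n $ i > 0")
      case True
      have "P (n - axis i 1)" by (rule less, rule smaller) (use True in \<open>auto simp: axis_def\<close>)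
      then show ?thesis using plus[of "n - axis i 1" i] by simp
    next
      case False
      have "P (n + axis i 1)" by (rule less, rule smaller) (use i False in \<open>auto simp: axis_def\<close>)
      then show ?thesis using minus[of "n + axis i 1" i] by simp
    qed
  qed
qed

lemma bij_betw_vec_nth: "bij_betw vec_nth {v. \<forall>i. v $ i \<in> S i} (PiE UNIV S)"
  by (rule bij_betwI[where g = vec_lambda]) (auto simp: vec_lambda_inverse vec_nth_inverse)

lemma finite_vec_box:
  assumes "\<And>i. finite (S i)"
  shows "finite {v :: 'a ^ 'k::finite. \<forall>i. v $ i \<in> S i}"
  using bij_betw_finite[OF bij_betw_vec_nth, of S] assms by (simp add: finite_PiE)

lemma card_vec_box:
  "card {v :: 'a ^ 'k::finite. \<forall>i. v $ i \<in> S i} = (\<Prod>i\<in>UNIV. card (S i))"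
  using bij_betw_same_card[OF bij_betw_vec_nth, of S] by (simp add: card_PiE)

lemma monomial_0 [simp]: "monomial z 0 = 1"
  by (simp add: monomial_def)

lemma monomial_axis [simp]: "monomial z (axis i 1) = z $ i"
proof -
  have "monomial z (axis i 1) = (\<Prod>j\<in>UNIV. if j = i then z $ j else 1)"
    unfolding monomial_def by (intro prod.cong) (auto simp: axis_def)
  then show ?thesis by simp
qed

lemma monomial_add:
  assumes "\<forall>i. z $ i \<noteq> 0"
  shows "monomial z (n + m) = monomial z n * monomial z m"
  using assms by (simp add: monomial_def power_int_add prod.distrib)

lemma monomial_minus: "monomial z (- n) = inverse (monomial z n)"
  by (simp add: monomial_def power_int_minus prod_inversef[unfolded o_def])

lemma monomial_nonzero: "\<forall>i. z $ i \<noteq> 0 \<Longrightarrow> monomial z n \<noteq> 0"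
  by (simp add: monomial_def)

definition vinverse :: "complex ^ 'k \<Rightarrow> complex ^ 'k::finite" where
  "vinverse w = (\<chi> i. inverse (w $ i))"

lemma monomial_vinverse: "monomial (vinverse w) n = inverse (monomial w n)"
  by (simp add: monomial_def vinverse_def power_int_inverse prod_inversef[unfolded o_def])

lemma torus_nonzero: "w \<in> torus \<Longrightarrow> \<forall>i. w $ i \<noteq> 0"
  by (auto simp: torus_def) (metis norm_zero zero_neq_one)

lemma vinverse_torus: "w \<in> torus \<Longrightarrow> vinverse w \<in> torus"
  by (auto simp: torus_def vinverse_def norm_inverse)

lemma norm_monomial_torus: "w \<in> torus \<Longrightarrow> cmod (monomial w n) = 1"
  by (simp add: torus_def monomial_def prod_norm[symmetric] norm_power_int)

lemma psi_vinverse_psi: "w \<in> torus \<Longrightarrow> psi (vinverse w) (psi w x) = x"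
  using monomial_nonzero[OF torus_nonzero, of w] by (simp add: psi_def fun_eq_iff monomial_vinverse)

lemma psi_psi_vinverse: "w \<in> torus \<Longrightarrow> psi w (psi (vinverse w) x) = x"
  using monomial_nonzero[OF torus_nonzero, of w] by (simp add: psi_def fun_eq_iff monomial_vinverse)

lemma psi_add: "psi w (x + y) = psi w x + psi w y"
  by (simp add: psi_def fun_eq_iff algebra_simps)

lemma psi_smul: "psi w (smul c x) = smul c (psi w x)"
  by (simp add: psi_def smul_def fun_eq_iff)

abbreviation dist_to_1 :: "complex ^ 'k::finite \<Rightarrow> real" where
  "dist_to_1 w \<equiv> \<Sum>i\<in>UNIV. cmod (1 - w $ i)"

text \<open>
  Monomials are Lipschitz on the torus; only the existence of a constant matters, so it is allowed to
  grow by 1 in each induction step.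
\<close>

lemma one_minus_monomial_bound:
  fixes n :: "int ^ 'k::finite"
  obtains K where "K \<ge> 0" "\<And>w. w \<in> torus \<Longrightarrow> cmod (1 - monomial w n) \<le> K * dist_to_1 w"
proof -
  define D where "D w n = cmod (1 - monomial w n)" for w :: "complex ^ 'k" and n
  have D_add: "D w (n + m) \<le> D w n + D w m" if "w \<in> torus" for w n m
  proof -
    have "1 - monomial w (n + m) = (1 - monomial w n) + monomial w n * (1 - monomial w m)"
      using torus_nonzero[OF that] by (simp add: monomial_add algebra_simps)
    then show ?thesis
      unfolding D_def
      by (simp only:) (rule order_trans[OF norm_triangle_ineq], simp add: norm_mult norm_monomial_torus[OF that])
  qed
  have D_axis: "D w (axis i 1) \<le> dist_to_1 w" for w i
    unfolding D_def monomial_axis by (rule member_le_sum) auto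
  have D_minus: "D w (- n) = D w n" if "w \<in> torus" for w n
  proof -
    have "monomial w n \<noteq> 0" by (rule monomial_nonzero[OF torus_nonzero[OF that]])
    then have "1 - monomial w (- n) = monomial w (- n) * - (1 - monomial w n)"
      by (simp add: monomial_minus algebra_simps)
    then show ?thesis
      unfolding D_def by (simp only: norm_mult norm_monomial_torus[OF that] norm_minus_cancel mult_1)
  qed
  have "\<exists>K\<ge>0. \<forall>w\<in>torus. D w n \<le> K * dist_to_1 w"
  proof (induction n rule: int_vec_induct)
    case zero
    then show ?case by (auto simp: D_def)
  next
    case (plus n i)
    then obtain K where K: "K \<ge> 0" "\<And>w. w \<in> torus \<Longrightarrow> D w n \<le> K * dist_to_1 w" by blast
    have "D w (n + axis i 1) \<le> (K + 1) * dist_to_1 w" if "w \<in> torus" for w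
      using D_add[OF that, of n "axis i 1"] K(2)[OF that] D_axis[of w i] by (simp add: algebra_simps)
    then show ?case using K(1) by (intro exI[of _ "K + 1"]) auto
  next
    case (minus n i)
    then obtain K where K: "K \<ge> 0" "\<And>w. w \<in> torus \<Longrightarrow> D w n \<le> K * dist_to_1 w" by blast
    have "D w (n - axis i 1) \<le> (K + 1) * dist_to_1 w" if "w \<in> torus" for w
      using D_add[OF that, of n "- axis i 1"] K(2)[OF that] D_axis[of w i] D_minus[OF that, of "axis i 1"]
      by (simp add: algebra_simps)
    then show ?case using K(1) by (intro exI[of _ "K + 1"]) auto
  qed
  then show thesis using that unfolding D_def by blast
qed

lemma smul_apply [simp]: "smul c x n = c * x n"
  by (simp add: smul_def)

lemma translation_apply [simp]: "translation a x n = x (n - a)"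
  by (simp add: translation_def)

text \<open>
  Finite sequences under convolution form the monoid algebra of the lattice.  The type of finitely
  supported functions supplies its ring structure, to which the seminorm results above apply.
\<close>

abbreviation coeffs :: "(int ^ 'k \<Rightarrow>\<^sub>0 complex) \<Rightarrow> 'k::finite seq" where
  "coeffs \<equiv> Poly_Mapping.lookup"

abbreviation const :: "complex \<Rightarrow> int ^ 'k::finite \<Rightarrow>\<^sub>0 complex" where
  "const \<equiv> Poly_Mapping.single 0"

lemma coeffs_finseqs: "coeffs f \<in> finseqs"
  by (simp add: finseqs_def)

lemma poly_mapping_linear_induct [case_names single add]:
  assumes single: "\<And>m c. P (Poly_Mapping.single m c)" and add: "\<And>f g. P f \<Longrightarrow> P g \<Longrightarrow> P (f + g)"
  shows "P f"
proof (induction f rule: update_induct)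
  case const
  then show ?case using single[of undefined 0] by simp
next
  case (update f a b)
  then have "Poly_Mapping.update a b f = f + Poly_Mapping.single a b"
    by (intro poly_mapping_eqI) (auto simp: lookup_update lookup_add lookup_single when_def in_keys_iff)
  then show ?case using add single update by metis
qed

lemma coeffs_single: "coeffs (Poly_Mapping.single m c) = smul c (delta m)"
  by (auto simp: fun_eq_iff lookup_single delta_def when_def)

lemma coeffs_add: "coeffs (f + g) = coeffs f + coeffs g"
  by (simp add: fun_eq_iff lookup_add)

lemma coeffs_diff: "coeffs (f - g) = coeffs f - (coeffs g :: 'k::finite seq)"
  by (simp add: fun_eq_iff lookup_minus)

lemma finseqs_coeffs_cases:
  assumes "x \<in> finseqs"
  obtains f where "x = coeffs f"
  using assms that[of "Abs_poly_mapping x"] by (simp add: finseqs_def)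

lemma finseqs_induct [consumes 1, case_names delta add]:
  assumes "x \<in> finseqs" and "\<And>c n. P (smul c (delta n))"
    and "\<And>x y. x \<in> finseqs \<Longrightarrow> y \<in> finseqs \<Longrightarrow> P x \<Longrightarrow> P y \<Longrightarrow> P (x + y)"
  shows "P x"
proof -
  obtain f where "x = coeffs f" using finseqs_coeffs_cases assms(1) by blast
  moreover have "P (coeffs f)"
  proof (induction f rule: poly_mapping_linear_induct)
    case (single m c)
    show ?case unfolding coeffs_single by (rule assms(2))
  next
    case (add f g)
    show ?case unfolding coeffs_add by (rule assms(3)) (rule add coeffs_finseqs)+
  qed
  ultimately show ?thesis by simp
qed

lemma finseqs_add: "x \<in> finseqs \<Longrightarrow> y \<in> finseqs \<Longrightarrow> x + y \<in> finseqs"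
  by (metis finseqs_coeffs_cases coeffs_finseqs coeffs_add)

lemma finseqs_diff: "x \<in> finseqs \<Longrightarrow> y \<in> finseqs \<Longrightarrow> x - y \<in> finseqs"
  by (metis finseqs_coeffs_cases coeffs_finseqs coeffs_diff)

lemma finseqs_delta: "delta n \<in> finseqs"
  by (simp add: finseqs_def delta_def)

lemma finseqs_mult: "p \<in> finseqs \<Longrightarrow> (\<lambda>n. p n * x n) \<in> finseqs"
  by (auto simp: finseqs_def elim: rev_finite_subset)

lemma finseqs_smul: "x \<in> finseqs \<Longrightarrow> smul c x \<in> finseqs"
  by (auto simp: finseqs_def smul_def elim: rev_finite_subset)

lemma finseqs_translation:
  assumes "x \<in> finseqs"
  shows "translation a x \<in> finseqs"
proof -
  have "{n. translation a x n \<noteq> 0} = (\<lambda>n. n + a) ` {n. x n \<noteq> 0}"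
    by (force simp: image_iff intro: exI[of _ "_ - a"])
  then show ?thesis using assms by (simp add: finseqs_def)
qed

lemma conv_eq_sum:
  assumes "finite F" "{m. \<phi> m \<noteq> 0} \<subseteq> F"
  shows "conv \<phi> f n = (\<Sum>m\<in>F. \<phi> m * f (n - m))"
  unfolding conv_def using assms by (intro sum.mono_neutral_left) auto

lemma laurent_eq_sum:
  assumes "finite F" "{m. \<phi> m \<noteq> 0} \<subseteq> F"
  shows "laurent \<phi> z = (\<Sum>m\<in>F. \<phi> m * monomial z m)"
  unfolding laurent_def using assms by (intro sum.mono_neutral_left) auto

lemma conv_add_left:
  assumes "x \<in> finseqs" "y \<in> finseqs"
  shows "conv (x + y) f = conv x f + conv y f"
proof
  fix n
  let ?F = "{m. x m \<noteq> 0} \<union> {m. y m \<noteq> 0}"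
  have "finite ?F" using assms by (simp add: finseqs_def)
  then show "conv (x + y) f n = (conv x f + conv y f) n"
    using conv_eq_sum[of ?F x] conv_eq_sum[of ?F y] conv_eq_sum[of ?F "x + y"]
    by (subst conv_eq_sum[of ?F "x + y"]; fastforce simp: algebra_simps sum.distrib)
qed

lemma laurent_add:
  assumes "x \<in> finseqs" "y \<in> finseqs"
  shows "laurent (x + y) z = laurent x z + laurent y z"
proof -
  let ?F = "{m. x m \<noteq> 0} \<union> {m. y m \<noteq> 0}"
  have F: "finite ?F" using assms by (simp add: finseqs_def)
  have "laurent (x + y) z = (\<Sum>m\<in>?F. (x + y) m * monomial z m)"
    using F by (intro laurent_eq_sum) auto
  moreover have "laurent x z = (\<Sum>m\<in>?F. x m * monomial z m)" using F by (intro laurent_eq_sum) auto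
  moreover have "laurent y z = (\<Sum>m\<in>?F. y m * monomial z m)" using F by (intro laurent_eq_sum) auto
  ultimately show ?thesis by (simp add: algebra_simps sum.distrib)
qed

lemma conv_smul_left: "conv (smul c x) f = smul c (conv x f)"
  by (cases "c = 0") (auto simp: conv_def fun_eq_iff sum_distrib_left mult.assoc)

lemma laurent_smul: "laurent (smul c x) z = c * laurent x z"
  by (cases "c = 0") (auto simp: laurent_def sum_distrib_left mult.assoc)

lemma laurent_delta: "laurent (delta n) z = monomial z n"
  by (simp add: laurent_def delta_def)

lemma laurent_diff:
  assumes "x \<in> finseqs" "y \<in> finseqs"
  shows "laurent (x - y) z = laurent x z - laurent y z"
proof -
  have "x - y = x + smul (-1) y" by (simp add: fun_eq_iff)
  then show ?thesis using assms by (simp only:) (simp add: laurent_add finseqs_smul laurent_smul)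
qed

lemma conv_add_right: "conv x (f + g) = conv x f + conv x g"
  by (simp add: fun_eq_iff conv_def algebra_simps sum.distrib)

lemma conv_smul_right: "conv x (smul c f) = smul c (conv x f)"
  by (simp add: fun_eq_iff conv_def sum_distrib_left mult.left_commute)

lemma conv_diff_left:
  assumes "x \<in> finseqs" "y \<in> finseqs"
  shows "conv (x - y) f = conv x f - conv y f"
proof -
  have "x - y = x + smul (-1) y" by (simp add: fun_eq_iff)
  then show ?thesis
    using assms by (simp only:) (simp add: conv_add_left finseqs_smul conv_smul_left fun_eq_iff)
qed

lemma translation_add: "translation (a + b) x = translation a (translation b x)"
  by (simp add: fun_eq_iff algebra_simps)

lemma translation_0 [simp]: "translation 0 x = x"
  by (simp add: fun_eq_iff)

lemma conv_translation_left: "conv (translation a x) f = translation a (conv x f)"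
proof
  fix n
  show "conv (translation a x) f n = translation a (conv x f) n"
    unfolding conv_def translation_def
    by (rule sum.reindex_bij_witness[of _ "\<lambda>m. m + a" "\<lambda>m. m - a"]) (auto simp: algebra_simps)
qed

lemma conv_translation_right: "conv x (translation a f) = translation a (conv x f)"
  by (simp add: fun_eq_iff conv_def algebra_simps)

lemma laurent_translation:
  assumes "\<forall>i. z $ i \<noteq> 0"
  shows "laurent (translation a x) z = monomial z a * laurent x z"
proof -
  have "laurent (translation a x) z = (\<Sum>m | x m \<noteq> 0. x m * monomial z (m + a))"
    unfolding laurent_def translation_def
    by (rule sum.reindex_bij_witness[of _ "\<lambda>m. m + a" "\<lambda>m. m - a"]) auto
  then show ?thesis
    using assms by (simp add: monomial_add laurent_def sum_distrib_left mult_ac)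
qed

lemma conv_delta_left: "conv (delta a) f = translation a f"
  by (simp add: conv_delta)

lemma conv_delta_right:
  assumes "x \<in> finseqs"
  shows "conv x (delta a) = translation a x"
  using assms
proof (induction rule: finseqs_induct)
  case (delta c n)
  have "translation n (delta a) = translation a (delta n)"
    by (auto simp: fun_eq_iff delta_def algebra_simps)
  then show ?case by (simp only: conv_smul_left conv_delta_left) (simp add: fun_eq_iff)
next
  case (add x y)
  then show ?case by (simp only: conv_add_left) (simp add: fun_eq_iff)
qed

lemma conv_in_finseqs:
  assumes "x \<in> finseqs" "y \<in> finseqs"
  shows "conv x y \<in> finseqs"
  using assms
  by (induction rule: finseqs_induct)
     (auto simp: conv_add_left conv_smul_left conv_delta_left intro: finseqs_add finseqs_smul finseqs_translation)

lemma conv_assoc: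
  assumes "x \<in> finseqs" "y \<in> finseqs"
  shows "conv (conv x y) f = conv x (conv y f)"
  using assms
  by (induction rule: finseqs_induct)
     (auto simp: conv_add_left conv_smul_left conv_delta_left conv_translation_left conv_in_finseqs)

lemma laurent_conv:
  assumes "x \<in> finseqs" "y \<in> finseqs" "\<forall>i. z $ i \<noteq> 0"
  shows "laurent (conv x y) z = laurent x z * laurent y z"
  using assms
  by (induction rule: finseqs_induct)
     (simp_all add: conv_add_left conv_smul_left conv_delta_left laurent_add conv_in_finseqs
        laurent_smul laurent_translation laurent_delta algebra_simps)

lemma coeffs_mult: "coeffs (f * g) = conv (coeffs f) (coeffs g)"
proof (induction f rule: poly_mapping_linear_induct)
  case (single m c)
  show ?case
  proof (induction g rule: poly_mapping_linear_induct)
    case (single l d)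
    have "smul (c * d) (delta (m + l)) = smul c (translation m (smul d (delta l)))"
      by (auto simp: fun_eq_iff delta_def algebra_simps)
    then show ?case
      by (simp only: mult_single coeffs_single conv_smul_left conv_delta_left)
  next
    case (add f g)
    then show ?case by (simp only: distrib_left coeffs_add conv_add_right)
  qed
next
  case (add f g)
  then show ?case by (simp only: distrib_right coeffs_add conv_add_left coeffs_finseqs)
qed

section \<open>Means over torsion points and the Fejer kernel\<close>

text \<open>
  A monomial with nonzero exponent has mean zero over these points once \<open>m\<close> is large.  For a fixed
  Laurent polynomial the finite means therefore agree with the integral over the torus from some
  \<open>m\<close> on.
\<close>

definition torsion_points :: "nat \<Rightarrow> (complex ^ 'k::finite) set" where
  "torsion_points m = {w. \<forall>i. (w $ i) ^ m = 1}"

lemma finite_torsion_points: "m > 0 \<Longrightarrow> finite (torsion_points m)"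
  using finite_vec_box[of "\<lambda>_. {z::complex. z ^ m = 1}"] finite_roots_unity[of m]
  by (auto simp: torsion_points_def)

lemma card_torsion_points_pos: "m > 0 \<Longrightarrow> card (torsion_points m :: (complex ^ 'k::finite) set) > 0"
proof -
  assume "m > 0"
  moreover have "(\<chi> i. 1) \<in> (torsion_points m :: (complex ^ 'k) set)" by (simp add: torsion_points_def)
  ultimately show ?thesis using finite_torsion_points[of m] card_gt_0_iff by blast
qed

lemma torsion_points_torus: "m > 0 \<Longrightarrow> w \<in> torsion_points m \<Longrightarrow> w \<in> torus"
  using power_eq_1_iff by (fastforce simp: torsion_points_def torus_def)

text \<open>
  Multiplying the \<open>i\<close>-th coordinate by a suitable root of unity \<open>\<zeta>\<close> permutes the torsion points and
  multiplies the sum by a number different from 1.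
\<close>

lemma sum_monomial_torsion_points:
  fixes n :: "int ^ 'k::finite"
  assumes m: "m > 0" and n: "\<not> int m dvd n $ i"
  shows "(\<Sum>w\<in>torsion_points m. monomial w n) = 0"
proof -
  obtain \<zeta> :: complex where \<zeta>: "\<zeta> ^ m = 1" "\<zeta> powi (n $ i) \<noteq> 1"
    using root_of_unity_not_annihilated[OF m n] by blast
  have nz: "\<zeta> \<noteq> 0" using \<zeta>(1) m by (auto simp: power_0_left)
  define g where "g u w = (\<chi> j. if j = i then u * w $ j else w $ j)" for u and w :: "complex ^ 'k"
  have g: "monomial (g \<zeta> w) n = \<zeta> powi (n $ i) * monomial w n" for w
  proof -
    have "monomial (g \<zeta> w) n =
        (\<Prod>j\<in>UNIV. (if j = i then \<zeta> powi (n $ j) else 1) * (w $ j) powi (n $ j))"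
      unfolding monomial_def g_def by (intro prod.cong) (auto simp: power_int_mult_distrib)
    then show ?thesis by (simp add: prod.distrib monomial_def)
  qed
  have inv: "g \<zeta> (g (inverse \<zeta>) w) = w" "g (inverse \<zeta>) (g \<zeta> w) = w" for w
    using nz by (auto simp: g_def vec_eq_iff)
  have mem: "g u w \<in> torsion_points m" if "u ^ m = 1" "w \<in> torsion_points m" for u w
    using that by (auto simp: g_def torsion_points_def power_mult_distrib)
  have "(\<Sum>w\<in>torsion_points m. monomial w n) = (\<Sum>w\<in>torsion_points m. monomial (g \<zeta> w) n)"
    by (rule sum.reindex_bij_witness[of _ "g \<zeta>" "g (inverse \<zeta>)"])
       (use \<zeta> in \<open>simp_all add: inv mem power_inverse\<close>)
  also have "\<dots> = \<zeta> powi (n $ i) * (\<Sum>w\<in>torsion_points m. monomial w n)"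
    by (simp add: g sum_distrib_left)
  finally show ?thesis using \<zeta>(2) by simp
qed

definition torsion_mean :: "nat \<Rightarrow> (complex ^ 'k::finite \<Rightarrow> 'a::real_vector) \<Rightarrow> 'a" where
  "torsion_mean m f = (\<Sum>w\<in>torsion_points m. f w) /\<^sub>R card (torsion_points m :: (complex ^ 'k) set)"

lemma torsion_mean_mono:
  fixes f g :: "complex ^ 'k::finite \<Rightarrow> real"
  assumes "m > 0" "\<And>w. w \<in> torus \<Longrightarrow> f w \<le> g w"
  shows "torsion_mean m f \<le> torsion_mean m g"
  unfolding torsion_mean_def using assms torsion_points_torus
  by (intro scaleR_left_mono sum_mono) auto

lemma torsion_mean_add: "torsion_mean m (\<lambda>w. f w + g w) = torsion_mean m f + torsion_mean m g"
  by (simp add: torsion_mean_def sum.distrib scaleR_add_right)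

lemma torsion_mean_diff: "torsion_mean m (\<lambda>w. f w - g w) = torsion_mean m f - torsion_mean m g"
  by (simp add: torsion_mean_def sum_subtractf scaleR_diff_right)

lemma torsion_mean_cmult:
  "torsion_mean m (\<lambda>w. c * f w) = c * torsion_mean m f" for c :: "'a::real_algebra"
  by (simp add: torsion_mean_def sum_distrib_left[symmetric])

lemma torsion_mean_multc:
  "torsion_mean m (\<lambda>w. f w * c) = torsion_mean m f * c" for c :: "'a::real_algebra"
  by (simp add: torsion_mean_def sum_distrib_right[symmetric])

lemma torsion_mean_const:
  assumes "m > 0"
  shows "torsion_mean m (\<lambda>w :: complex ^ 'k::finite. c) = (c :: real)"
  using card_torsion_points_pos[OF assms, where 'k = 'k] by (simp add: torsion_mean_def)

lemma torsion_mean_sum: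
  "torsion_mean m (\<lambda>w. \<Sum>i\<in>A. f i w) = (\<Sum>i\<in>A. torsion_mean m (f i))"
  unfolding torsion_mean_def by (subst sum.swap) (simp add: scaleR_sum_right)

lemma torsion_mean_cong:
  assumes "m > 0" "\<And>w. w \<in> torus \<Longrightarrow> f w = g w"
  shows "torsion_mean m f = torsion_mean m g"
  unfolding torsion_mean_def using assms torsion_points_torus by (metis (no_types, lifting) sum.cong)

lemma eventually_mean_monomial:
  fixes n :: "int ^ 'k::finite"
  shows "\<forall>\<^sub>F m in sequentially. torsion_mean m (\<lambda>w. monomial w n) = (if n = 0 then 1 else 0)"
proof (cases "n = 0")
  case True
  have "torsion_mean m (\<lambda>w. monomial w n) = 1" if "m > 0" for m
    using True card_torsion_points_pos[OF that, where 'k = 'k]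
    by (simp add: torsion_mean_def scaleR_conv_of_real)
  then show ?thesis using True by (intro eventually_mono[OF eventually_gt_at_top[of 0]]) simp
next
  case False
  then obtain i where i: "n $ i \<noteq> 0" by (auto simp: vec_eq_iff)
  have "torsion_mean m (\<lambda>w. monomial w n) = 0" if "m > nat \<bar>n $ i\<bar>" for m
  proof -
    have "\<not> int m dvd n $ i" using that i zdvd_not_zless[of "\<bar>n $ i\<bar>" "int m"] by auto
    then show ?thesis using sum_monomial_torsion_points[of m n i] that by (simp add: torsion_mean_def)
  qed
  then show ?thesis
    using False by (intro eventually_mono[OF eventually_gt_at_top[of "nat \<bar>n $ i\<bar>"]]) simp
qed

lemma eventually_mean_laurent:
  assumes "p \<in> finseqs"
  shows "\<forall>\<^sub>F m in sequentially. torsion_mean m (\<lambda>w. laurent p w * monomial w n) = p (- n)"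
proof -
  let ?S = "{l. p l \<noteq> 0}"
  have fin: "finite ?S" using assms by (simp add: finseqs_def)
  have "\<forall>\<^sub>F m in sequentially. \<forall>l\<in>?S.
      torsion_mean m (\<lambda>w. monomial w (l + n)) = (if l + n = 0 then 1 else 0)"
    by (intro eventually_ball_finite ballI fin eventually_mean_monomial)
  then show ?thesis using eventually_gt_at_top[of 0]
  proof eventually_elim
    case (elim m)
    have "(\<Sum>w\<in>torsion_points m. laurent p w * monomial w n) =
        (\<Sum>w\<in>torsion_points m. \<Sum>l\<in>?S. p l * monomial w (l + n))"
    proof (rule sum.cong[OF refl])
      fix w :: "complex ^ 'a" assume "w \<in> torsion_points m"
      then have "\<forall>i. w $ i \<noteq> 0" using torsion_points_torus[OF elim(2)] torus_nonzero by blast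
      then show "laurent p w * monomial w n = (\<Sum>l\<in>?S. p l * monomial w (l + n))"
        by (simp add: laurent_def sum_distrib_right monomial_add mult.assoc)
    qed
    also have "\<dots> = (\<Sum>l\<in>?S. p l * (\<Sum>w\<in>torsion_points m. monomial w (l + n)))"
      by (subst sum.swap) (simp add: sum_distrib_left)
    finally have "torsion_mean m (\<lambda>w. laurent p w * monomial w n) =
        (\<Sum>l\<in>?S. p l * torsion_mean m (\<lambda>w. monomial w (l + n)))"
      by (simp add: torsion_mean_def scaleR_conv_of_real sum_distrib_left mult_ac)
    also have "\<dots> = (\<Sum>l\<in>?S. if l = - n then p l else 0)"
      using elim(1) by (intro sum.cong) (auto simp: eq_neg_iff_add_eq_0)
    also have "\<dots> = p (- n)" using fin by auto
    finally show ?case .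
  qed
qed

definition lattice_box :: "nat \<Rightarrow> (int ^ 'k::finite) set" where
  "lattice_box d = {a. \<forall>i. a $ i \<in> {0..<int d}}"

text \<open>
  The autocorrelation of the indicator of a cube, normalized to be 1 at 0; as a trigonometric
  polynomial it is the squared modulus of a Dirichlet kernel.
\<close>

definition fejer :: "nat \<Rightarrow> 'k::finite seq" where
  "fejer d = smul (1 / of_nat (d ^ CARD('k)))
     (conv (\<lambda>a. if a \<in> lattice_box d then 1 else 0) (\<lambda>a. if - a \<in> lattice_box d then 1 else 0))"

lemma finite_lattice_box: "finite (lattice_box d)"
  unfolding lattice_box_def by (rule finite_vec_box) simp

lemma card_lattice_box: "card (lattice_box d :: (int ^ 'k::finite) set) = d ^ CARD('k)"
  unfolding lattice_box_def by (subst card_vec_box) simp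

lemma finite_uminus_lattice_box: "finite {a. - a \<in> lattice_box d}"
  by (rule finite_subset[OF _ finite_imageI[OF finite_lattice_box[of d], of uminus]]) force

lemma lattice_box_indicator_finseqs:
  "(\<lambda>a. if a \<in> lattice_box d then 1 else 0) \<in> finseqs"
  "(\<lambda>a. if - a \<in> lattice_box d then 1 else 0) \<in> finseqs"
  by (simp_all add: finseqs_def finite_lattice_box finite_uminus_lattice_box)

lemma fejer_finseqs: "fejer d \<in> finseqs"
  unfolding fejer_def by (intro finseqs_smul conv_in_finseqs lattice_box_indicator_finseqs)

lemma fejer_eq_card:
  "fejer d n = of_nat (card {a \<in> lattice_box d. a - n \<in> lattice_box d}) / of_nat (d ^ CARD('k))"
  for n :: "int ^ 'k::finite"
proof -
  have "conv (\<lambda>a. if a \<in> lattice_box d then 1 else 0) (\<lambda>a. if - a \<in> lattice_box d then 1 else 0) n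
      = (\<Sum>m\<in>lattice_box d. (if m - n \<in> lattice_box d then 1 else 0) :: complex)"
    by (subst conv_eq_sum[of "lattice_box d"]) (auto simp: finite_lattice_box intro!: sum.cong)
  also have "\<dots> = of_nat (card {a \<in> lattice_box d. a - n \<in> lattice_box d})"
    by (simp add: sum.If_cases finite_lattice_box Int_def)
  finally show ?thesis by (simp add: fejer_def)
qed

lemma fejer_0:
  assumes "d > 0"
  shows "fejer d 0 = 1"
  using assms by (simp add: fejer_eq_card card_lattice_box)

text \<open>
  The cube and its translate by \<open>n\<close> have asymptotically the same number of points: they meet in a box
  with sides \<open>d - \<bar>n $ i\<bar>\<close>.
\<close>

lemma fejer_tendsto_1:
  fixes n :: "int ^ 'k::finite"
  shows "(\<lambda>d. fejer d n) \<longlonglongrightarrow> 1"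
proof -
  have card: "card {a \<in> lattice_box d. a - n \<in> lattice_box d} = (\<Prod>i\<in>UNIV. nat (int d - \<bar>n $ i\<bar>))" for d
  proof -
    have "{a \<in> lattice_box d. a - n \<in> lattice_box d} =
        {a. \<forall>i. a $ i \<in> {max 0 (n $ i)..<int d + min 0 (n $ i)}}"
    proof -
      have "x \<in> {0..<int d} \<and> x - m \<in> {0..<int d} \<longleftrightarrow> x \<in> {max 0 m..<int d + min 0 m}" for x m :: int
        by (auto simp: max_def min_def)
      then show ?thesis
        unfolding lattice_box_def set_eq_iff mem_Collect_eq vector_minus_component by blast
    qed
    then have "card {a \<in> lattice_box d. a - n \<in> lattice_box d} =
        (\<Prod>i\<in>UNIV. card {max 0 (n $ i)..<int d + min 0 (n $ i)})"
      by (simp only: card_vec_box)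
    also have "\<dots> = (\<Prod>i\<in>UNIV. nat (int d - \<bar>n $ i\<bar>))"
      by (intro prod.cong) (auto simp: max_def min_def)
    finally show ?thesis .
  qed
  have "(\<lambda>d. \<Prod>i\<in>UNIV. of_real ((real d - \<bar>real_of_int (n $ i)\<bar>) / real d) :: complex) \<longlonglongrightarrow> (\<Prod>i\<in>(UNIV :: 'k set). of_real 1)"
  proof (intro tendsto_prod tendsto_of_real)
    fix i
    have "(\<lambda>d. 1 - \<bar>real_of_int (n $ i)\<bar> / real d) \<longlonglongrightarrow> 1 - 0"
      by (intro tendsto_intros lim_const_over_n)
    then have "(\<lambda>d. 1 - \<bar>real_of_int (n $ i)\<bar> / real d) \<longlonglongrightarrow> 1" by simp
    then show "(\<lambda>d. (real d - \<bar>real_of_int (n $ i)\<bar>) / real d) \<longlonglongrightarrow> 1"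
      by (rule Lim_transform_eventually)
         (rule eventually_mono[OF eventually_gt_at_top[of 0]], simp add: field_simps)
  qed
  moreover have "\<forall>\<^sub>F d in sequentially. (\<Prod>i\<in>UNIV. of_real ((real d - \<bar>real_of_int (n $ i)\<bar>) / real d)) = fejer d n"
    using eventually_gt_at_top[of "nat (Max (range (\<lambda>i. \<bar>n $ i\<bar>)))"]
  proof eventually_elim
    case (elim d)
    have "real (nat (int d - \<bar>n $ i\<bar>)) = real d - \<bar>real_of_int (n $ i)\<bar>" for i
    proof -
      have "\<bar>n $ i\<bar> \<le> Max (range (\<lambda>i. \<bar>n $ i\<bar>))" by (rule Max_ge) auto
      then have "\<bar>n $ i\<bar> < int d" using elim by linarith
      then show ?thesis by simp
    qed
    then have "complex_of_nat (nat (int d - \<bar>n $ i\<bar>)) = of_real (real d - \<bar>real_of_int (n $ i)\<bar>)" for i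
      by (metis of_real_of_nat_eq)
    then show ?case by (simp add: fejer_eq_card card prod_dividef)
  qed
  ultimately show ?thesis by (auto intro: Lim_transform_eventually)
qed

lemma laurent_fejer_nonneg:
  assumes w: "w \<in> torus"
  shows "laurent (fejer d) w = of_real (cmod (laurent (fejer d) w))"
proof -
  let ?u = "\<lambda>a. if a \<in> lattice_box d then 1 else 0 :: complex" and ?v = "\<lambda>a. if - a \<in> lattice_box d then 1 else 0 :: complex"
  have "laurent ?v w = (\<Sum>a\<in>lattice_box d. monomial w (- a))"
  proof -
    have "laurent ?v w = (\<Sum>a | - a \<in> lattice_box d. monomial w a)" by (auto simp: laurent_def)
    also have "\<dots> = (\<Sum>a\<in>lattice_box d. monomial w (- a))"
      by (rule sum.reindex_bij_witness[of _ uminus uminus]) auto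
    finally show ?thesis .
  qed
  also have "\<dots> = (\<Sum>a\<in>lattice_box d. cnj (monomial w a))"
  proof (rule sum.cong[OF refl])
    fix a
    have "monomial w a * cnj (monomial w a) = 1"
      using norm_monomial_torus[OF w, of a] by (simp add: complex_norm_square[symmetric])
    then show "monomial w (- a) = cnj (monomial w a)" by (simp add: monomial_minus inverse_unique)
  qed
  also have "\<dots> = cnj (laurent ?u w)" by (simp add: laurent_def)
  finally have "laurent (fejer d) w = laurent ?u w * cnj (laurent ?u w) / of_nat (d ^ CARD('a))"
    unfolding fejer_def
    by (simp add: laurent_smul laurent_conv lattice_box_indicator_finseqs torus_nonzero[OF w])
  also have "\<dots> = of_real ((cmod (laurent ?u w))\<^sup>2 / real (d ^ CARD('a)))"
    by (simp add: complex_norm_square[symmetric])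
  finally show ?thesis
    by (metis abs_of_nonneg divide_nonneg_nonneg norm_of_real of_nat_0_le_iff zero_le_power2)
qed

lemma eventually_mean_fejer_mult:
  fixes n :: "int ^ 'k::finite"
  shows "\<forall>\<^sub>F m in sequentially. torsion_mean m
     (\<lambda>w. of_real (cmod (laurent (fejer d) w)) * monomial w n) = (fejer d (- n) :: complex)"
proof -
  have "(fejer d :: 'k seq) \<in> finseqs" by (rule fejer_finseqs)
  from eventually_mean_laurent[OF this, of n] eventually_gt_at_top[of 0] show ?thesis
  proof eventually_elim
    case (elim m)
    have "torsion_mean m (\<lambda>w. of_real (cmod (laurent (fejer d) w)) * monomial w n) =
        torsion_mean m (\<lambda>w. laurent (fejer d) w * monomial w n)"
      by (rule torsion_mean_cong[OF elim(2)]) (simp add: laurent_fejer_nonneg[symmetric])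
    then show ?case using elim(1) by simp
  qed
qed

lemma eventually_mean_fejer:
  assumes "d > 0"
  shows "\<forall>\<^sub>F m in sequentially. torsion_mean m (\<lambda>w :: complex ^ 'k::finite. cmod (laurent (fejer d) w)) = 1"
  using eventually_mean_fejer_mult[of d "0 :: int ^ 'k"]
proof eventually_elim
  case (elim m)
  have "complex_of_real (torsion_mean m (\<lambda>w :: complex ^ 'k. cmod (laurent (fejer d) w))) =
      torsion_mean m (\<lambda>w :: complex ^ 'k. of_real (cmod (laurent (fejer d) w)))"
    by (simp add: torsion_mean_def scaleR_conv_of_real)
  also have "\<dots> = 1" using elim by (simp add: fejer_0[OF assms])
  finally show ?case by (metis of_real_eq_1_iff)
qed

text \<open>
  The second moment of the distance to 1 in coordinate \<open>i\<close> can be read off the coefficients: on the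
  torus the square of \<open>cmod (1 - w $ i)\<close> is \<open>2 - w $ i - cnj (w $ i)\<close>, so the mean against the kernel is
  2 minus its coefficients at the two unit vectors, which tends to 0.  The first moment follows by
  \<open>x \<le> \<eta> / 2 + x\<^sup>2 / (2 * \<eta>)\<close>.
\<close>

lemma fejer_concentration:
  assumes e: "e > 0"
  shows "\<exists>d>0. \<forall>\<^sub>F m in sequentially. torsion_mean m
     (\<lambda>w :: complex ^ 'k::finite. cmod (laurent (fejer d) w) * dist_to_1 w) \<le> e"
proof -
  define \<eta> where "\<eta> = e / real CARD('k)"
  have \<eta>: "\<eta> > 0" using e by (simp add: \<eta>_def)
  define \<tau> where "\<tau> d = (\<Sum>i\<in>(UNIV :: 'k set). Re (2 - fejer d (axis i 1) - fejer d (- axis i 1)))" for d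
  have "\<tau> \<longlonglongrightarrow> (\<Sum>i\<in>(UNIV :: 'k set). Re (2 - 1 - 1))"
    unfolding \<tau>_def by (intro tendsto_intros fejer_tendsto_1)
  then have "\<forall>\<^sub>F d in sequentially. \<tau> d < \<eta> * e" using \<eta> e by (intro order_tendstoD) auto
  then have "\<forall>\<^sub>F d in sequentially. \<tau> d < \<eta> * e \<and> d > 0"
    using eventually_gt_at_top[of 0] by eventually_elim simp
  then obtain d where d: "\<tau> d < \<eta> * e" "d > 0" using eventually_happens'[OF sequentially_bot] by blast
  let ?p = "\<lambda>w :: complex ^ 'k. cmod (laurent (fejer d) w)"
  have "\<forall>\<^sub>F m in sequentially. \<forall>n\<in>{0} \<union> range (\<lambda>i. axis i 1) \<union> range (\<lambda>i. - axis i 1).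
      torsion_mean m (\<lambda>w. of_real (?p w) * monomial w n) = fejer d (- n)"
    by (intro eventually_ball_finite ballI eventually_mean_fejer_mult) auto
  then have "\<forall>\<^sub>F m in sequentially. torsion_mean m (\<lambda>w. ?p w * dist_to_1 w) \<le> e"
    using eventually_gt_at_top[of 0]
  proof eventually_elim
    case (elim m)
    have m: "m > 0" by fact
    have mean_eq: "torsion_mean m (\<lambda>w. of_real (?p w) * monomial w n) = fejer d (- n)"
      if "n = 0 \<or> n = axis i 1 \<or> n = - axis i 1" for n i
      using elim(1) that by blast
    have of_real_mean: "of_real (torsion_mean m f) = (torsion_mean m (\<lambda>w. of_real (f w)) :: complex)"
      for f :: "complex ^ 'k \<Rightarrow> real"
      by (simp add: torsion_mean_def scaleR_conv_of_real)
    have "of_real (torsion_mean m ?p) = (1 :: complex)"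
      unfolding of_real_mean using mean_eq[of 0] fejer_0[OF d(2)] by simp
    then have mass: "torsion_mean m ?p = 1" by (metis of_real_eq_1_iff)
    have second: "torsion_mean m (\<lambda>w. ?p w * (cmod (1 - w $ i))\<^sup>2) =
        Re (2 - fejer d (axis i 1) - fejer d (- axis i 1))" for i
    proof -
      have "complex_of_real (torsion_mean m (\<lambda>w. ?p w * (cmod (1 - w $ i))\<^sup>2)) =
          torsion_mean m (\<lambda>w. 2 * (of_real (?p w) * monomial w 0) -
            of_real (?p w) * monomial w (- axis i 1) - of_real (?p w) * monomial w (axis i 1))"
        unfolding of_real_mean
      proof (rule torsion_mean_cong[OF m])
        fix w :: "complex ^ 'k" assume w: "w \<in> torus"
        then have "w $ i * cnj (w $ i) = 1" by (simp add: torus_def complex_norm_square[symmetric])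
        moreover from this have "monomial w (- axis i 1) = cnj (w $ i)"
          by (simp add: monomial_minus inverse_unique)
        moreover have "complex_of_real ((cmod (1 - w $ i))\<^sup>2) = 1 - w $ i - cnj (w $ i) + w $ i * cnj (w $ i)"
          by (simp only: complex_norm_square) (simp add: algebra_simps)
        ultimately show "complex_of_real (?p w * (cmod (1 - w $ i))\<^sup>2) =
            2 * (of_real (?p w) * monomial w 0) -
            of_real (?p w) * monomial w (- axis i 1) - of_real (?p w) * monomial w (axis i 1)"
          by (simp only: of_real_mult) (simp add: algebra_simps)
      qed
      also have "\<dots> = 2 * fejer d (0 :: int ^ 'k) - fejer d (axis i 1) - fejer d (- axis i 1)"
      proof -
        have "torsion_mean m (\<lambda>w. of_real (?p w) * monomial w 0) = fejer d (0 :: int ^ 'k)"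
          using mean_eq[of 0] by simp
        moreover have "torsion_mean m (\<lambda>w. of_real (?p w) * monomial w (axis i 1)) = fejer d (- axis i 1)"
          by (rule mean_eq[of _ i]) simp
        moreover have "torsion_mean m (\<lambda>w. of_real (?p w) * monomial w (- axis i 1)) = fejer d (axis i 1)"
          by (rule trans[OF mean_eq[of _ i]]) simp_all
        ultimately show ?thesis by (simp only: torsion_mean_diff torsion_mean_cmult)
      qed
      finally have "complex_of_real (torsion_mean m (\<lambda>w. ?p w * (cmod (1 - w $ i))\<^sup>2)) =
          2 - fejer d (axis i 1) - fejer d (- axis i 1)"
        by (simp add: fejer_0[OF d(2)])
      from arg_cong[OF this, of Re] show ?thesis by (simp only: Re_complex_of_real)
    qed
    have "torsion_mean m (\<lambda>w. ?p w * dist_to_1 w) \<le>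
        torsion_mean m (\<lambda>w. \<Sum>i\<in>UNIV. (\<eta> / 2) * ?p w + (1 / (2 * \<eta>)) * (?p w * (cmod (1 - w $ i))\<^sup>2))"
    proof (rule torsion_mean_mono[OF m])
      fix w :: "complex ^ 'k"
      have amgm: "a \<le> \<eta> / 2 + 1 / (2 * \<eta>) * a\<^sup>2" for a :: real
      proof -
        have "0 \<le> (a - \<eta>)\<^sup>2 / (2 * \<eta>)" using \<eta> by simp
        also have "\<dots> = \<eta> / 2 + 1 / (2 * \<eta>) * a\<^sup>2 - a" using \<eta> by (simp add: field_simps power2_eq_square)
        finally show ?thesis by simp
      qed
      have "?p w * dist_to_1 w \<le>
          ?p w * (\<Sum>i\<in>UNIV. \<eta> / 2 + 1 / (2 * \<eta>) * (cmod (1 - w $ i))\<^sup>2)"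
        by (intro mult_left_mono sum_mono amgm) auto
      then show "?p w * dist_to_1 w \<le>
          (\<Sum>i\<in>UNIV. (\<eta> / 2) * ?p w + (1 / (2 * \<eta>)) * (?p w * (cmod (1 - w $ i))\<^sup>2))"
        by (simp add: sum_distrib_left distrib_left mult_ac)
    qed
    also have "\<dots> = (\<Sum>i\<in>(UNIV :: 'k set). \<eta> / 2 + 1 / (2 * \<eta>) * Re (2 - fejer d (axis i 1) - fejer d (- axis i 1)))"
      by (simp only: torsion_mean_sum torsion_mean_add torsion_mean_cmult mass second mult_1_right)
    also have "\<dots> = e / 2 + 1 / (2 * \<eta>) * \<tau> d"
      by (simp add: sum.distrib \<tau>_def sum_distrib_left \<eta>_def)
    also have "\<dots> \<le> e / 2 + 1 / (2 * \<eta>) * (\<eta> * e)"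
      using d(1) \<eta> by (intro add_left_mono mult_left_mono) auto
    also have "\<dots> = e" using \<eta> by simp
    finally show ?case .
  qed
  then show ?thesis using d(2) by blast
qed

section \<open>Bounded operators on spaces of sequences\<close>

text \<open>
  Sequences are treated as vectors from here on.  The pointwise rules, which turn a sum of sequences
  into a lambda abstraction and so hide it from linearity, are removed from the simplifier and used
  on demand.
\<close>

lemmas pointwise = fun_eq_iff plus_fun_apply zero_fun_apply minus_apply smul_apply translation_apply

declare plus_fun_apply [simp del] zero_fun_apply [simp del] minus_apply [simp del]
  smul_apply [simp del] translation_apply [simp del]

lemma sum_fun_apply: "(\<Sum>a\<in>A. F a) n = (\<Sum>a\<in>A. F a n)"
  for F :: "'a \<Rightarrow> 'b \<Rightarrow> 'c::comm_monoid_add"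
  by (induction A rule: infinite_finite_induct) (simp_all add: pointwise)

definition seq_mean :: "nat \<Rightarrow> (complex ^ 'k \<Rightarrow> 'k seq) \<Rightarrow> 'k::finite seq" where
  "seq_mean m F = (\<lambda>n. torsion_mean m (\<lambda>w. F w n))"

lemma seq_mean_eq:
  "seq_mean m F = smul (1 / of_nat (card (torsion_points m :: (complex ^ 'k) set)))
     (\<Sum>w\<in>torsion_points m. F w)"
  for F :: "complex ^ 'k::finite \<Rightarrow> 'k seq"
  by (simp add: pointwise seq_mean_def torsion_mean_def sum_fun_apply scaleR_conv_of_real divide_inverse)

text \<open>
  Conjugation by a rotation multiplies the coefficient at \<open>n\<close> by \<open>monomial w (- n)\<close>.
\<close>

definition rot :: "complex ^ 'k \<Rightarrow> ('k seq \<Rightarrow> 'k seq) \<Rightarrow> 'k seq \<Rightarrow> 'k::finite seq" where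
  "rot w T x = psi (vinverse w) (T (psi w x))"

definition invertible_op :: "'k seq set \<Rightarrow> ('k seq \<Rightarrow> real) \<Rightarrow> ('k seq \<Rightarrow> 'k::finite seq) \<Rightarrow> bool" where
  "invertible_op E N T \<longleftrightarrow> (\<exists>R. bounded_op E N R \<and> (\<forall>x\<in>E. R (T x) = x \<and> T (R x) = x))"

lemma op_spectrum_iff: "c \<in> op_spectrum E N T \<longleftrightarrow> \<not> invertible_op E N (\<lambda>x. T x - smul c x)"
  by (simp add: op_spectrum_def invertible_op_def)

lemma invertible_opE:
  assumes "invertible_op E N T"
  obtains R where "bounded_op E N R" "\<And>x. x \<in> E \<Longrightarrow> R (T x) = x" "\<And>x. x \<in> E \<Longrightarrow> T (R x) = x"
  using assms by (auto simp: invertible_op_def)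

lemma bounded_opI:
  assumes "\<And>x. x \<in> E \<Longrightarrow> T x \<in> E" "\<And>x y. x \<in> E \<Longrightarrow> y \<in> E \<Longrightarrow> T (x + y) = T x + T y"
    "\<And>c x. x \<in> E \<Longrightarrow> T (smul c x) = smul c (T x)" "\<And>x. x \<in> E \<Longrightarrow> N (T x) \<le> C * N x"
  shows "bounded_op E N T"
  unfolding bounded_op_def using assms by blast

context normed_seq_space
begin

lemma op_mem: "bounded_op E N T \<Longrightarrow> x \<in> E \<Longrightarrow> T x \<in> E"
  by (auto simp: bounded_op_def)

lemma op_add: "bounded_op E N T \<Longrightarrow> x \<in> E \<Longrightarrow> y \<in> E \<Longrightarrow> T (x + y) = T x + T y"
  by (auto simp: bounded_op_def)

lemma op_smul: "bounded_op E N T \<Longrightarrow> x \<in> E \<Longrightarrow> T (smul c x) = smul c (T x)"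
  by (auto simp: bounded_op_def)

lemma diff_conv_smul: "x - y = x + smul (-1) (y :: 'k seq)"
  by (simp add: pointwise)

lemma op_diff: "bounded_op E N T \<Longrightarrow> x \<in> E \<Longrightarrow> y \<in> E \<Longrightarrow> T (x - y) = T x - T y"
  using op_add[of T x "smul (-1) y"] op_smul[of T y "-1"] by (simp add: diff_conv_smul smul_mem)

lemma op_0: "bounded_op E N T \<Longrightarrow> T 0 = 0"
  proof -
  assume T: "bounded_op E N T"
  have "smul 0 x = 0" for x :: "'k seq" by (simp add: pointwise)
  then show ?thesis using op_smul[OF T zero_mem, of 0] by simp
qed

lemma op_boundE:
  assumes "bounded_op E N T"
  obtains C where "C \<ge> 0" "\<And>x. x \<in> E \<Longrightarrow> N (T x) \<le> C * N x"
proof -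
  obtain C where C: "\<And>x. x \<in> E \<Longrightarrow> N (T x) \<le> C * N x"
    using assms unfolding bounded_op_def by blast
  have "N (T x) \<le> max C 0 * N x" if "x \<in> E" for x
    using C[OF that] mult_right_mono[of C "max C 0" "N x"] N_nonneg[OF that] by linarith
  then show thesis using that[of "max C 0"] by simp
qed

lemma N_0 [simp]: "N 0 = 0"
  using N_eq_0 zero_mem by blast

lemma N_triangle_diff: "x \<in> E \<Longrightarrow> y \<in> E \<Longrightarrow> N (x - y) \<le> N x + N y"
  using N_triangle[of x "smul (-1) y"] smul_mem[of y "-1"] N_smul[of y "-1"]
  by (simp only: diff_conv_smul) simp

lemma N_le_add_diff: "x \<in> E \<Longrightarrow> y \<in> E \<Longrightarrow> N x \<le> N y + N (x - y)"
  using N_triangle[of y "x - y"] diff_mem by simp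

lemma sum_mem: "(\<And>a. a \<in> A \<Longrightarrow> F a \<in> E) \<Longrightarrow> sum F A \<in> E"
  by (induction A rule: infinite_finite_induct) (auto simp: zero_mem intro: add_mem)

lemma N_sum: "(\<And>a. a \<in> A \<Longrightarrow> F a \<in> E) \<Longrightarrow> N (sum F A) \<le> (\<Sum>a\<in>A. N (F a))"
proof (induction A rule: infinite_finite_induct)
  case (insert a A)
  then have "N (F a + sum F A) \<le> N (F a) + N (sum F A)" by (intro N_triangle sum_mem) auto
  also have "N (sum F A) \<le> (\<Sum>a\<in>A. N (F a))" using insert by simp
  finally show ?case using insert.hyps by simp
qed simp_all

lemma bounded_op_id: "bounded_op E N (\<lambda>x. x)"
  by (rule bounded_opI[of _ _ _ 1]) auto

lemma bounded_op_zero: "bounded_op E N (\<lambda>x. 0)"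
  by (rule bounded_opI[of _ _ _ 0]) (auto simp: zero_mem pointwise)

lemma bounded_op_comp:
  assumes "bounded_op E N T" "bounded_op E N S"
  shows "bounded_op E N (\<lambda>x. T (S x))"
proof -
  obtain C where C: "C \<ge> 0" "\<And>x. x \<in> E \<Longrightarrow> N (T x) \<le> C * N x" using op_boundE[OF assms(1)] by blast
  obtain D where D: "D \<ge> 0" "\<And>x. x \<in> E \<Longrightarrow> N (S x) \<le> D * N x" using op_boundE[OF assms(2)] by blast
  show ?thesis
  proof (rule bounded_opI)
    fix x assume x: "x \<in> E"
    have "N (T (S x)) \<le> C * N (S x)" using C x op_mem[OF assms(1)] op_mem[OF assms(2)] assms by blast
    also have "\<dots> \<le> C * (D * N x)" using C D x by (intro mult_left_mono) auto
    finally show "N (T (S x)) \<le> (C * D) * N x" by (simp add: mult.assoc)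
  qed (simp_all add: assms op_mem[OF assms(1)] op_mem[OF assms(2)] op_add[OF assms(1)] op_add[OF assms(2)] op_smul[OF assms(1)] op_smul[OF assms(2)])
qed

lemma bounded_op_add:
  assumes "bounded_op E N T" "bounded_op E N S"
  shows "bounded_op E N (\<lambda>x. T x + S x)"
proof -
  obtain C where C: "\<And>x. x \<in> E \<Longrightarrow> N (T x) \<le> C * N x" using op_boundE[OF assms(1)] by blast
  obtain D where D: "\<And>x. x \<in> E \<Longrightarrow> N (S x) \<le> D * N x" using op_boundE[OF assms(2)] by blast
  show ?thesis
  proof (rule bounded_opI)
    fix x assume x: "x \<in> E"
    have "N (T x + S x) \<le> N (T x) + N (S x)" using x op_mem[OF assms(1)] op_mem[OF assms(2)] assms by (intro N_triangle) auto
    then show "N (T x + S x) \<le> (C + D) * N x" using C[OF x] D[OF x] by (simp add: algebra_simps)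
  next
    fix x y assume "x \<in> E" "y \<in> E"
    then show "T (x + y) + S (x + y) = T x + S x + (T y + S y)" by (simp add: assms op_add[OF assms(1)] op_add[OF assms(2)])
  next
    fix c x assume "x \<in> E"
    then show "T (smul c x) + S (smul c x) = smul c (T x + S x)"
      by (simp add: assms op_smul[OF assms(1)] op_smul[OF assms(2)] pointwise algebra_simps)
  qed (simp add: assms op_mem[OF assms(1)] op_mem[OF assms(2)] add_mem)
qed

lemma bounded_op_smul:
  assumes "bounded_op E N T"
  shows "bounded_op E N (\<lambda>x. smul c (T x))"
proof -
  obtain C where C: "\<And>x. x \<in> E \<Longrightarrow> N (T x) \<le> C * N x" using op_boundE[OF assms(1)] by blast
  show ?thesis
  proof (rule bounded_opI)
    fix x assume x: "x \<in> E"
    then show "N (smul c (T x)) \<le> (cmod c * C) * N x"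
      using mult_left_mono[OF C[OF x], of "cmod c"] by (simp add: N_smul op_mem[OF assms] assms mult.assoc)
  qed (simp_all add: assms op_mem[OF assms] smul_mem op_add[OF assms] op_smul[OF assms] pointwise algebra_simps)
qed

lemma bounded_op_diff:
  assumes "bounded_op E N T" "bounded_op E N S"
  shows "bounded_op E N (\<lambda>x. T x - S x)"
  using bounded_op_add[OF assms(1) bounded_op_smul[OF assms(2), of "-1"]] by (simp only: diff_conv_smul)

lemma N_op_le_op_norm:
  assumes T: "bounded_op E N T" and x: "x \<in> E" "N x \<le> 1"
  shows "N (T x) \<le> op_norm E N T"
proof -
  obtain C where C: "C \<ge> 0" "\<And>x. x \<in> E \<Longrightarrow> N (T x) \<le> C * N x" using op_boundE[OF T] by blast
  have "N (T y) \<le> C" if "y \<in> E" "N y \<le> 1" for y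
    using C(2)[OF that(1)] mult_left_mono[OF that(2) C(1)] by simp
  then have "bdd_above ((\<lambda>x. N (T x)) ` {x \<in> E. N x \<le> 1})" by (auto intro!: bdd_aboveI)
  then show ?thesis unfolding op_norm_def by (rule cSUP_upper2) (use x in auto)
qed

lemma norm_le_op_norm:
  assumes T: "bounded_op E N T" and x: "x \<in> E"
  shows "N (T x) \<le> op_norm E N T * N x"
proof (cases "N x = 0")
  case True
  then show ?thesis using x T by (simp add: N_eq_0 op_0[OF T])
next
  case False
  have pos: "N x > 0" using False N_nonneg[OF x] by simp
  define y where "y = smul (of_real (1 / N x)) x"
  have "N y = 1" using pos by (simp add: y_def N_smul[OF x] norm_divide)
  moreover have "y \<in> E" by (simp add: y_def smul_mem x)
  ultimately have "N (T y) \<le> op_norm E N T" by (intro N_op_le_op_norm[OF T]) auto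
  then show ?thesis
    using pos by (simp add: y_def op_smul[OF T x] N_smul op_mem[OF T x] norm_divide field_simps)
qed

lemma op_norm_leI:
  assumes "C \<ge> 0" "\<And>x. x \<in> E \<Longrightarrow> N (T x) \<le> C * N x"
  shows "op_norm E N T \<le> C"
  unfolding op_norm_def
proof (rule cSUP_least)
  show "{x \<in> E. N x \<le> 1} \<noteq> {}" using zero_mem N_0 by fastforce
  fix x assume "x \<in> {x \<in> E. N x \<le> 1}"
  then show "N (T x) \<le> C" using assms(2)[of x] mult_left_mono[of "N x" 1 C] assms(1) by auto
qed

lemma op_norm_nonneg:
  assumes "bounded_op E N T"
  shows "0 \<le> op_norm E N T"
  using N_op_le_op_norm[OF assms zero_mem] by (simp add: op_0[OF assms])

lemma Z_set_bound:
  assumes "z \<in> Z_set E N" "\<phi> \<in> finseqs" "C \<ge> 0" "\<And>x. x \<in> E \<Longrightarrow> N (conv \<phi> x) \<le> C * N x"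
  shows "cmod (laurent \<phi> z) \<le> C"
  using assms op_norm_leI[of C "conv \<phi>"] by (fastforce simp: Z_set_def)

end

context banach_seq_space
begin

lemma finseqs_mem: "x \<in> finseqs \<Longrightarrow> x \<in> E"
  using finseqs_subset by blast

text \<open>
  The Neumann series in the form of a fixed point: \<open>T x = y\<close> means \<open>x = y + (x - T x)\<close>, and the right-hand
  side is a contraction in \<open>x\<close>.
\<close>

lemma invertible_near_identity:
  assumes T: "bounded_op E N T" and \<theta>: "\<theta> < 1" "\<And>x. x \<in> E \<Longrightarrow> N (x - T x) \<le> \<theta> * N x"
  shows "invertible_op E N T"
proof -
  have surj: "\<exists>x\<in>E. T x = y" if y: "y \<in> E" for y
  proof -
    have "(\<lambda>x. y + (x - T x)) \<in> E \<rightarrow> E" using y T by (auto intro!: add_mem diff_mem op_mem[OF T])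
    moreover have "seq_dist E N (y + (u - T u)) (y + (v - T v)) \<le> \<theta> * seq_dist E N u v"
      if uv: "u \<in> E" "v \<in> E" for u v
    proof -
      have "(y + (u - T u)) - (y + (v - T v)) = (u - v) - T (u - v)"
        using uv T by (simp add: op_diff[OF T])
      moreover have "y + (u - T u) \<in> E" "y + (v - T v) \<in> E"
        using uv y T by (auto intro!: add_mem diff_mem op_mem[OF T])
      ultimately show ?thesis using uv \<theta>(2)[of "u - v"] diff_mem by (simp only: seq_dist_def) simp
    qed
    ultimately obtain x where "x \<in> E" "y + (x - T x) = x"
      using Banach_fixedpoint_thm[OF complete _ _ \<theta>(1), of "\<lambda>x. y + (x - T x)"] zero_mem by blast
    then show ?thesis by (auto simp: pointwise intro!: bexI[of _ x])
  qed
  have bound: "N x \<le> 1 / (1 - \<theta>) * N (T x)" if x: "x \<in> E" for x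
    using N_le_add_diff[OF x op_mem[OF T x]] \<theta>(2)[OF x] \<theta>(1) by (simp add: field_simps)
  have inj: "x = y" if "x \<in> E" "y \<in> E" "T x = T y" for x y
  proof -
    have "N (x - y) \<le> 0" using bound[of "x - y"] that T by (simp add: op_diff[OF T] diff_mem)
    then show ?thesis using N_nonneg[of "x - y"] N_eq_0[of "x - y"] diff_mem that by simp
  qed
  obtain R where R: "\<And>y. y \<in> E \<Longrightarrow> R y \<in> E \<and> T (R y) = y" using surj by metis
  have "bounded_op E N R"
  proof (rule bounded_opI)
    fix y assume y: "y \<in> E"
    show "N (R y) \<le> 1 / (1 - \<theta>) * N y" using bound[of "R y"] R[OF y] by simp
    show "R y \<in> E" using R[OF y] by simp
  next
    fix x y assume xy: "x \<in> E" "y \<in> E"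
    show "R (x + y) = R x + R y"
    proof (rule inj)
      show "T (R (x + y)) = T (R x + R y)"
        using R[OF add_mem[OF xy]] R[OF xy(1)] R[OF xy(2)] op_add[OF T, of "R x" "R y"] by simp
    qed (use R[OF add_mem[OF xy]] R[OF xy(1)] R[OF xy(2)] add_mem in auto)
  next
    fix c x assume x: "x \<in> E"
    show "R (smul c x) = smul c (R x)"
    proof (rule inj)
      show "T (R (smul c x)) = T (smul c (R x))"
        using R[OF smul_mem[OF x, of c]] R[OF x] op_smul[OF T, of "R x" c] by simp
    qed (use R[OF smul_mem[OF x, of c]] R[OF x] smul_mem in auto)
  qed
  then show ?thesis unfolding invertible_op_def using R inj op_mem[OF T] by blast
qed

lemma invertible_open:
  assumes T_bdd: "bounded_op E N T" and T: "invertible_op E N T"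
  obtains \<eta> where "\<eta> > 0" "\<And>T'. bounded_op E N T' \<Longrightarrow>
      (\<And>x. x \<in> E \<Longrightarrow> N (T' x - T x) \<le> \<eta> * N x) \<Longrightarrow> invertible_op E N T'"
proof -
  obtain R where R: "bounded_op E N R" "\<And>x. x \<in> E \<Longrightarrow> R (T x) = x" "\<And>x. x \<in> E \<Longrightarrow> T (R x) = x"
    using invertible_opE[OF T] by blast
  obtain K where K: "K \<ge> 0" "\<And>x. x \<in> E \<Longrightarrow> N (R x) \<le> K * N x" using op_boundE[OF R(1)] by blast
  show thesis
  proof (rule that[of "1 / (2 * (K + 1))"])
    show "1 / (2 * (K + 1)) > 0" using K(1) by simp
  next
    fix T' assume T': "bounded_op E N T'"
      and near: "\<And>x. x \<in> E \<Longrightarrow> N (T' x - T x) \<le> 1 / (2 * (K + 1)) * N x"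
    have TE: "T x \<in> E" if "x \<in> E" for x using op_mem[OF T_bdd that] .
    have "N (x - R (T' x)) \<le> 1 / 2 * N x" if x: "x \<in> E" for x
    proof -
      have "N (x - R (T' x)) = N (R (T x - T' x))"
        using x R T' TE by (simp add: op_diff[OF R(1)] op_mem[OF T'])
      also have "\<dots> \<le> K * N (T x - T' x)" using x T' TE by (intro K diff_mem op_mem[OF T'])
      also have "N (T x - T' x) = N (T' x - T x)" using x T' TE by (intro N_diff_commute op_mem[OF T'])
      also have "K * \<dots> \<le> K * (1 / (2 * (K + 1)) * N x)" using near K x by (intro mult_left_mono) auto
      also have "\<dots> = (K / (K + 1)) * (1 / 2 * N x)" by simp
      also have "\<dots> \<le> 1 * (1 / 2 * N x)" using K N_nonneg[OF x] by (intro mult_right_mono) auto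
      finally show ?thesis by simp
    qed
    then have "invertible_op E N (\<lambda>x. R (T' x))"
      using invertible_near_identity[OF bounded_op_comp[OF R(1) T'], of "1 / 2"] by simp
    then obtain V where V: "bounded_op E N V" "\<And>x. x \<in> E \<Longrightarrow> V (R (T' x)) = x"
        "\<And>x. x \<in> E \<Longrightarrow> R (T' (V x)) = x"
      unfolding invertible_op_def by blast
    have "T' (V (R y)) = y" if y: "y \<in> E" for y
    proof -
      have "T' (V (R y)) = T (R (T' (V (R y))))"
        using R(3)[OF op_mem[OF T' op_mem[OF V(1) op_mem[OF R(1) y]]]] by simp
      also have "\<dots> = y" using V(3)[OF op_mem[OF R(1) y]] R(3)[OF y] by simp
      finally show ?thesis .
    qed
    then show "invertible_op E N T'"
      unfolding invertible_op_def using V R bounded_op_comp[OF V(1) R(1)] by blast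
  qed
qed

lemma finseqs_approx:
  assumes "x \<in> E" "e > 0"
  obtains y where "y \<in> finseqs" "N (x - y) < e"
proof -
  have "x \<in> mtopology closure_of finseqs" using assms(1) finseqs_dense by simp
  then obtain y where "y \<in> finseqs" "y \<in> mball x e"
    using assms(2) by (auto simp: metric_closure_of)
  then show thesis using that by (auto simp: seq_dist_def)
qed

lemma eval_bound:
  obtains K where "K \<ge> 0" "\<And>x. x \<in> E \<Longrightarrow> cmod (x n) \<le> K * N x"
proof -
  have "openin mtopology {x \<in> topspace mtopology. x n \<in> ball 0 1}"
    using continuous_eval[of n] by (rule openin_continuous_map_preimage) simp
  moreover have "(0 :: 'k seq) \<in> {x \<in> topspace mtopology. x n \<in> ball 0 1}"
    by (simp add: zero_mem zero_fun_apply)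
  ultimately obtain r where r: "r > 0" "mball 0 r \<subseteq> {x \<in> topspace mtopology. x n \<in> ball 0 1}"
    unfolding openin_mtopology by blast
  have "cmod (x n) \<le> (2 / r) * N x" if x: "x \<in> E" for x
  proof (cases "N x = 0")
    case True
    then show ?thesis using x by (simp add: N_eq_0 zero_fun_apply)
  next
    case False
    then have pos: "N x > 0" using N_nonneg[OF x] by simp
    define y where "y = smul (of_real (r / (2 * N x))) x"
    have "N y = r / 2"
      using pos r by (simp add: y_def N_smul[OF x] norm_divide norm_mult)
    then have "N (0 - y) = r / 2"
      using N_diff_commute[OF zero_mem smul_mem[OF x]] by (simp add: y_def)
    then have "y \<in> mball 0 r"
      using r x by (simp add: in_mball seq_dist_def zero_mem y_def smul_mem)
    then have "cmod (y n) < 1" using r by auto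
    then show ?thesis using pos r by (simp add: y_def norm_mult norm_divide field_simps smul_apply)
  qed
  then show thesis using that[of "2 / r"] r by simp
qed

lemma extend_bound:
  assumes T: "bounded_op E N T" and bound: "\<And>x. x \<in> finseqs \<Longrightarrow> N (T x) \<le> C * N x"
    and C: "C \<ge> 0" and x: "x \<in> E"
  shows "N (T x) \<le> C * N x"
proof -
  obtain D where D: "D \<ge> 0" "\<And>x. x \<in> E \<Longrightarrow> N (T x) \<le> D * N x" using op_boundE[OF T] by blast
  show ?thesis
  proof (rule field_le_epsilon)
    fix e :: real assume e: "e > 0"
    have "e / (C + D + 1) > 0" using e C D by simp
    then obtain y where y: "y \<in> finseqs" "N (x - y) < e / (C + D + 1)"
      using finseqs_approx[OF x] by blast
    have yE: "y \<in> E" using y finseqs_mem by blast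
    have "N (T x) \<le> N (T y) + N (T (x - y))"
      using N_le_add_diff[of "T x" "T y"] x yE T by (simp add: op_mem[OF T] op_diff[OF T])
    also have "\<dots> \<le> C * N y + D * N (x - y)"
      using bound[OF y(1)] D(2)[of "x - y"] x yE diff_mem by (intro add_mono) auto
    also have "C * N y \<le> C * (N x + N (x - y))"
      using C N_le_add_diff[OF yE x] N_diff_commute[OF x yE] by (intro mult_left_mono) auto
    finally have "N (T x) \<le> C * N x + (C + D) * N (x - y)" by (simp add: algebra_simps)
    also have "(C + D) * N (x - y) \<le> (C + D + 1) * (e / (C + D + 1))"
      using y(2) C D N_nonneg[of "x - y"] x yE diff_mem by (intro mult_mono) auto
    also have "\<dots> = e" using C D by simp
    finally show "N (T x) \<le> C * N x + e" by simp
  qed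
qed

text \<open>
  Density with uniform bounds: for both applications \<open>\<Phi> m x\<close> measures the error of the \<open>m\<close>-th
  approximation at \<open>x\<close>, which is elementary for finite sequences and is Lipschitz in \<open>x\<close> uniformly in \<open>m\<close>.
\<close>

lemma tendsto_0_by_density:
  fixes \<Phi> :: "nat \<Rightarrow> 'k seq \<Rightarrow> real"
  assumes x: "x \<in> E" and D: "D \<ge> 0"
    and fin: "\<And>y. y \<in> finseqs \<Longrightarrow> (\<lambda>m. \<Phi> m y) \<longlonglongrightarrow> 0"
    and near: "\<And>m y. m > 0 \<Longrightarrow> y \<in> E \<Longrightarrow> \<Phi> m x \<le> \<Phi> m y + D * N (x - y)"
    and nonneg: "\<And>m. m > 0 \<Longrightarrow> 0 \<le> \<Phi> m x"
  shows "(\<lambda>m. \<Phi> m x) \<longlonglongrightarrow> 0"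
proof (rule tendstoI)
  fix e :: real assume e: "e > 0"
  then have "e / (2 * (D + 1)) > 0" using D by simp
  then obtain y where y: "y \<in> finseqs" "N (x - y) < e / (2 * (D + 1))"
    using finseqs_approx[OF x] by blast
  have yE: "y \<in> E" using y finseqs_mem by blast
  have "D * N (x - y) \<le> (D + 1) * (e / (2 * (D + 1)))"
    using y(2) D N_nonneg[OF diff_mem[OF x yE]] by (intro mult_mono) auto
  also have "\<dots> = e / 2" using D by (simp add: field_simps)
  finally have le: "D * N (x - y) \<le> e / 2" .
  have "\<forall>\<^sub>F m in sequentially. \<Phi> m y < e / 2" using order_tendstoD(2)[OF fin[OF y(1)], of "e / 2"] e by simp
  then show "\<forall>\<^sub>F m in sequentially. dist (\<Phi> m x) 0 < e"
    using eventually_gt_at_top[of 0]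
  proof eventually_elim
    case (elim m)
    then show ?case using near[OF elim(2) yE] nonneg[OF elim(2)] le by simp
  qed
qed

lemma psi_closed: "w \<in> torus \<Longrightarrow> x \<in> E \<Longrightarrow> psi w x \<in> E"
  using psi_mem by blast

lemma rot_mem: "bounded_op E N T \<Longrightarrow> w \<in> torus \<Longrightarrow> x \<in> E \<Longrightarrow> rot w T x \<in> E"
  unfolding rot_def by (intro psi_closed vinverse_torus op_mem[where T = T])

lemma rot_add:
  "bounded_op E N T \<Longrightarrow> w \<in> torus \<Longrightarrow> x \<in> E \<Longrightarrow> y \<in> E \<Longrightarrow> rot w T (x + y) = rot w T x + rot w T y"
  using op_add[of T "psi w x" "psi w y"] by (simp add: rot_def psi_add psi_closed)

definition psi_norm :: real where
  "psi_norm = (SOME C. C \<ge> 0 \<and> (\<forall>w\<in>torus. \<forall>x\<in>E. N (psi w x) \<le> C * N x))"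

lemma psi_norm: "psi_norm \<ge> 0" "w \<in> torus \<Longrightarrow> x \<in> E \<Longrightarrow> N (psi w x) \<le> psi_norm * N x"
proof -
  obtain C where C: "\<forall>z\<in>torus. \<forall>x\<in>E. N (psi z x) \<le> C * N x" using psi_bounded by blast
  have "N (psi w x) \<le> max C 0 * N x" if "w \<in> torus" "x \<in> E" for w x
    using C[rule_format, OF that] mult_right_mono[of C "max C 0" "N x"] N_nonneg[OF that(2)] by linarith
  then have "\<exists>C. C \<ge> 0 \<and> (\<forall>w\<in>torus. \<forall>x\<in>E. N (psi w x) \<le> C * N x)"
    by (intro exI[of _ "max C 0"]) auto
  then have "psi_norm \<ge> 0 \<and> (\<forall>w\<in>torus. \<forall>x\<in>E. N (psi w x) \<le> psi_norm * N x)"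
    unfolding psi_norm_def by (rule someI_ex)
  then show "psi_norm \<ge> 0" "w \<in> torus \<Longrightarrow> x \<in> E \<Longrightarrow> N (psi w x) \<le> psi_norm * N x" by auto
qed

lemma rot_bound:
  assumes T: "bounded_op E N T" and bound: "\<And>x. x \<in> E \<Longrightarrow> N (T x) \<le> C * N x"
    and C: "C \<ge> 0" and w: "w \<in> torus" and x: "x \<in> E"
  shows "N (rot w T x) \<le> psi_norm\<^sup>2 * C * N x"
proof -
  have "N (rot w T x) \<le> psi_norm * N (T (psi w x))"
    unfolding rot_def using w x T by (intro psi_norm vinverse_torus op_mem[OF T] psi_closed)
  also have "\<dots> \<le> psi_norm * (C * N (psi w x))"
    using w x psi_norm(1) by (intro mult_left_mono bound psi_closed)
  also have "\<dots> \<le> psi_norm * (C * (psi_norm * N x))"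
    using w x psi_norm C by (intro mult_left_mono) auto
  finally show ?thesis by (simp add: power2_eq_square mult_ac)
qed

lemma seq_mean_mem:
  assumes "m > 0" "\<And>w. w \<in> torus \<Longrightarrow> F w \<in> E"
  shows "seq_mean m F \<in> E"
  unfolding seq_mean_eq using assms torsion_points_torus by (intro smul_mem sum_mem) auto

lemma N_seq_mean:
  assumes "m > 0" "\<And>w. w \<in> torus \<Longrightarrow> F w \<in> E"
  shows "N (seq_mean m F) \<le> torsion_mean m (\<lambda>w. N (F w))"
proof -
  have F: "F w \<in> E" if "w \<in> torsion_points m" for w using assms torsion_points_torus that by blast
  have "N (sum F (torsion_points m)) \<le> (\<Sum>w\<in>torsion_points m. N (F w))"
    by (rule N_sum) (rule F)
  then show ?thesis
    unfolding seq_mean_eq torsion_mean_def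
    by (subst N_smul) (auto intro!: sum_mem F mult_left_mono simp: norm_divide divide_inverse norm_inverse)
qed

lemma bounded_op_multiply:
  assumes "p \<in> finseqs"
  shows "bounded_op E N (\<lambda>x. (\<lambda>n. p n * x n))"
  using assms
proof (induction rule: finseqs_induct)
  case (delta c l)
  obtain K where K: "K \<ge> 0" "\<And>x. x \<in> E \<Longrightarrow> cmod (x l) \<le> K * N x" using eval_bound[of l] by blast
  have eq: "(\<lambda>n. smul c (delta l) n * x n) = smul (c * x l) (delta l)" for x
    by (auto simp: pointwise delta_def)
  show ?case unfolding eq
  proof (rule bounded_opI)
    fix x assume x: "x \<in> E"
    have "N (smul (c * x l) (delta l)) = cmod c * N (delta l) * cmod (x l)"
      by (simp add: N_smul finseqs_mem finseqs_delta norm_mult)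
    also have "\<dots> \<le> cmod c * N (delta l) * (K * N x)"
      using K x by (intro mult_left_mono) (auto simp: N_nonneg finseqs_mem finseqs_delta)
    finally show "N (smul (c * x l) (delta l)) \<le> (cmod c * N (delta l) * K) * N x" by (simp add: mult_ac)
  qed (auto simp: finseqs_mem finseqs_delta smul_mem pointwise algebra_simps)
next
  case (add x y)
  have "(\<lambda>n. (x + y) n * u n) = (\<lambda>n. x n * u n) + (\<lambda>n. y n * u n)" for u
    by (simp add: pointwise algebra_simps)
  then show ?case using bounded_op_add[OF add.IH] by simp
qed

lemma laurent_torus_bound:
  assumes "w \<in> torus"
  shows "cmod (laurent p w) \<le> (\<Sum>n | p n \<noteq> 0. cmod (p n))"
  unfolding laurent_def using norm_monomial_torus[OF assms]
  by (intro sum_norm_le) (simp add: norm_mult)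

lemma eventually_mean_psi_finseqs:
  assumes y: "y \<in> finseqs" and p: "p \<in> finseqs"
  shows "\<forall>\<^sub>F m in sequentially.
    seq_mean m (\<lambda>w. smul (laurent p w) (psi (vinverse w) y)) = (\<lambda>n. p n * y n)"
proof -
  have eq: "seq_mean m (\<lambda>w. smul (laurent p w) (psi (vinverse w) y)) n =
      y n * torsion_mean m (\<lambda>w. laurent p w * monomial w (- n))" for m n
    by (simp add: seq_mean_def psi_def monomial_vinverse monomial_minus torsion_mean_cmult[symmetric] smul_apply mult_ac)
  have "finite {n. y n \<noteq> 0}" using y by (simp add: finseqs_def)
  then have "\<forall>\<^sub>F m in sequentially. \<forall>n\<in>{n. y n \<noteq> 0}.
      torsion_mean m (\<lambda>w. laurent p w * monomial w (- n)) = p (- (- n))"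
    by (intro eventually_ball_finite ballI eventually_mean_laurent p)
  then show ?thesis
  proof eventually_elim
    case (elim m)
    then show ?case unfolding pointwise eq by (metis (mono_tags, lifting) mem_Collect_eq minus_minus mult.commute mult_zero_left)
  qed
qed

text \<open>
  At coordinate \<open>n\<close> the mean multiplies \<open>y\<close> by the mean of \<open>laurent p w * monomial w (- n)\<close>, which is
  eventually \<open>p n\<close>.  For finite \<open>y\<close> this gives eventual equality; density extends it to \<open>E\<close>.
\<close>

lemma mean_psi_tendsto:
  assumes y: "y \<in> E" and p: "p \<in> finseqs"
  shows "(\<lambda>m. N (seq_mean m (\<lambda>w. smul (laurent p w) (psi (vinverse w) y)) - (\<lambda>n. p n * y n))) \<longlonglongrightarrow> 0"
proof -
  define S where "S m y = seq_mean m (\<lambda>w. smul (laurent p w) (psi (vinverse w) y))" for m y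
  define P where "P y = (\<lambda>n. p n * y n)" for y :: "'k seq"
  have P: "bounded_op E N P" unfolding P_def by (rule bounded_op_multiply[OF p])
  obtain D where D: "D \<ge> 0" "\<And>x. x \<in> E \<Longrightarrow> N (P x) \<le> D * N x" using op_boundE[OF P] by blast
  define B where "B = (\<Sum>n | p n \<noteq> 0. cmod (p n)) * psi_norm"
  have B: "B \<ge> 0" by (simp add: B_def sum_nonneg psi_norm)
  have S_mem: "S m x \<in> E" if "m > 0" "x \<in> E" for m x
    unfolding S_def using that by (intro seq_mean_mem smul_mem psi_closed vinverse_torus)
  have S_bound: "N (S m x) \<le> B * N x" if m: "m > 0" and x: "x \<in> E" for m x
  proof -
    have "N (S m x) \<le> torsion_mean m (\<lambda>w. N (smul (laurent p w) (psi (vinverse w) x)))"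
      unfolding S_def using m x by (intro N_seq_mean smul_mem psi_closed vinverse_torus)
    also have "\<dots> \<le> torsion_mean m (\<lambda>w :: complex ^ 'k. B * N x)"
    proof (rule torsion_mean_mono[OF m])
      fix w :: "complex ^ 'k" assume w: "w \<in> torus"
      have "N (smul (laurent p w) (psi (vinverse w) x)) = cmod (laurent p w) * N (psi (vinverse w) x)"
        using w x by (intro N_smul psi_closed vinverse_torus)
      also have "\<dots> \<le> (\<Sum>n | p n \<noteq> 0. cmod (p n)) * (psi_norm * N x)"
        using w x by (intro mult_mono laurent_torus_bound psi_norm vinverse_torus)
           (auto intro: sum_nonneg N_nonneg psi_closed vinverse_torus)
      finally show "N (smul (laurent p w) (psi (vinverse w) x)) \<le> B * N x" by (simp add: B_def)
    qed
    also have "\<dots> = B * N x" using m by (rule torsion_mean_const)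
    finally show ?thesis .
  qed
  have S_diff: "S m (u - v) = S m u - S m v" for m u v
    by (simp add: S_def seq_mean_def pointwise psi_def torsion_mean_diff[symmetric] algebra_simps)
  have "(\<lambda>m. N (S m y - P y)) \<longlonglongrightarrow> 0"
  proof (rule tendsto_0_by_density[OF y, where D = "B + D"])
    show "0 \<le> B + D" using B D by simp
    show "(\<lambda>m. N (S m u - P u)) \<longlonglongrightarrow> 0" if u: "u \<in> finseqs" for u
    proof (rule tendsto_eventually)
      show "\<forall>\<^sub>F m in sequentially. N (S m u - P u) = 0"
        using eventually_mean_psi_finseqs[OF u p] by eventually_elim (simp add: S_def P_def)
    qed
    show "0 \<le> N (S m y - P y)" if "m > 0" for m
      by (rule N_nonneg[OF diff_mem[OF S_mem[OF that y] op_mem[OF P y]]])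
    fix m :: nat and u assume m: "m > 0" and u: "u \<in> E"
    have d: "y - u \<in> E" using y u diff_mem by blast
    have Smem: "S m u - P u \<in> E" "S m (y - u) \<in> E" "P (y - u) \<in> E"
      using diff_mem[OF S_mem[OF m u] op_mem[OF P u]] S_mem[OF m d] op_mem[OF P d] by auto
    have eq: "S m y - P y = (S m u - P u) + (S m (y - u) - P (y - u))"
      using y u by (simp add: S_diff op_diff[OF P])
    have "N (S m y - P y) \<le> N (S m u - P u) + N (S m (y - u) - P (y - u))"
      unfolding eq by (rule N_triangle[OF Smem(1) diff_mem[OF Smem(2,3)]])
    also have "\<dots> \<le> N (S m u - P u) + (B * N (y - u) + D * N (y - u))"
      using N_triangle_diff[OF Smem(2,3)] S_bound[OF m d] D(2)[OF d] by simp
    finally show "N (S m y - P y) \<le> N (S m u - P u) + (B + D) * N (y - u)" by (simp add: algebra_simps)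
  qed
  then show ?thesis unfolding S_def P_def .
qed

end

section \<open>Fourier coefficients of multipliers\<close>

locale shift_invariant_space = banach_seq_space E N
  for E :: "'k::finite seq set" and N :: "'k seq \<Rightarrow> real" +
  assumes shift_bounded: "bounded_op E N (translation (axis i 1))"
    and shift_inverse_bounded: "bounded_op E N (translation (- axis i 1))"
begin

lemma bounded_op_translation: "bounded_op E N (translation n)"
proof (induction n rule: int_vec_induct)
  case zero
  have "translation 0 = (\<lambda>x :: 'k seq. x)" by (simp add: pointwise)
  then show ?case using bounded_op_id by simp
next
  case (plus n i)
  then show ?case
    using bounded_op_comp[OF plus shift_bounded[of i]]
    by (simp add: translation_add[symmetric])
next
  case (minus n i)
  then show ?case
    using bounded_op_comp[OF minus shift_inverse_bounded[of i]]
    by (simp add: translation_add[symmetric])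
qed

lemma translation_mem: "x \<in> E \<Longrightarrow> translation n x \<in> E"
  using bounded_op_translation op_mem[OF bounded_op_translation] by blast

lemma bounded_op_conv:
  assumes "\<phi> \<in> finseqs"
  shows "bounded_op E N (conv \<phi>)"
  using assms
proof (induction rule: finseqs_induct)
  case (delta c n)
  have "conv (smul c (delta n)) = (\<lambda>x. smul c (translation n x))"
    by (intro ext) (simp only: conv_smul_left conv_delta_left)
  then show ?case using bounded_op_smul[OF bounded_op_translation] by simp
next
  case (add x y)
  have "conv (x + y) = (\<lambda>u. conv x u + conv y u)"
    by (intro ext) (simp only: conv_add_left[OF add.hyps])
  then show ?case using bounded_op_add[OF add.IH] by simp
qed

lemma conv_mem: "\<phi> \<in> finseqs \<Longrightarrow> x \<in> E \<Longrightarrow> conv \<phi> x \<in> E"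
  using bounded_op_conv op_mem[OF bounded_op_conv] by blast

lemma delta_mem: "delta n \<in> E"
  by (simp add: finseqs_mem finseqs_delta)

lemma multiplier_bounded: "M \<in> multipliers E N \<Longrightarrow> bounded_op E N M"
  by (simp add: multipliers_def)

lemma multiplier_translation:
  assumes M: "M \<in> multipliers E N" and "x \<in> E"
  shows "M (translation n x) = translation n (M x)"
  using assms(2)
proof (induction n arbitrary: x rule: int_vec_induct)
  case zero
  then show ?case by simp
next
  case (plus n i)
  have "M (translation (n + axis i 1) x) = M (translation n (translation (axis i 1) x))"
    by (simp only: translation_add)
  also have "\<dots> = translation n (translation (axis i 1) (M x))"
    using plus M by (simp add: translation_mem multipliers_def)
  finally show ?case by (simp only: translation_add)
next
  case (minus n i)
  define y where "y = translation (- axis i 1) x"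
  have y: "y \<in> E" "x = translation (axis i 1) y"
    using minus.prems by (simp_all add: y_def translation_mem translation_add[symmetric])
  then have "M x = translation (axis i 1) (M y)" using M by (simp add: multipliers_def)
  then have "M y = translation (- axis i 1) (M x)" by (simp add: translation_add[symmetric])
  moreover have "M (translation (n - axis i 1) x) = translation n (M y)"
    using minus.IH[OF y(1)] by (simp add: y_def translation_add[symmetric])
  ultimately show ?case by (simp add: translation_add[symmetric])
qed

lemma multiplier_conv:
  assumes M: "M \<in> multipliers E N" and \<phi>: "\<phi> \<in> finseqs" and x: "x \<in> E"
  shows "M (conv \<phi> x) = conv \<phi> (M x)"
  using \<phi>
proof (induction rule: finseqs_induct)
  case (delta c n)
  show ?case
    using multiplier_bounded[OF M] x translation_mem[OF x]
    by (simp only: conv_smul_left conv_delta_left op_smul[OF multiplier_bounded[OF M]] multiplier_translation[OF M])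
next
  case (add y z)
  then show ?case
    using multiplier_bounded[OF M] x by (simp only: conv_add_left op_add[OF multiplier_bounded[OF M]] conv_mem)
qed

text \<open>
  On a unit vector the rotated operator is, up to a monomial factor, a rotation of the single
  sequence \<open>M (delta j)\<close>, so \<open>mean_psi_tendsto\<close> applies; linearity then gives all finite \<open>x\<close>.
\<close>

lemma mean_rot_tendsto:
  assumes M: "M \<in> multipliers E N" and p: "p \<in> finseqs" and x: "x \<in> finseqs"
  shows "(\<lambda>m. N (seq_mean m (\<lambda>w. smul (laurent p w) (rot w M x)) -
            conv (\<lambda>n. p n * M (delta 0) n) x)) \<longlonglongrightarrow> 0"
  using x
proof (induction rule: finseqs_induct)
  case (delta c j)
  have Mb: "bounded_op E N M" using multiplier_bounded[OF M] .
  have MdE: "M (delta j) \<in> E" using op_mem[OF Mb delta_mem] .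
  have Md: "M (delta j) n = M (delta 0) (n - j)" for n
  proof -
    have "delta j = translation j (delta 0)" by (auto simp: pointwise delta_def)
    then show ?thesis using multiplier_translation[OF M delta_mem, of j 0] by (simp add: translation_apply)
  qed
  have "psi w (smul c (delta j)) = smul (c * monomial w j) (delta j)" for w
    by (auto simp: pointwise psi_def delta_def)
  then have "rot w M (smul c (delta j)) = smul (c * monomial w j) (psi (vinverse w) (M (delta j)))" for w
    by (simp only: rot_def op_smul[OF Mb delta_mem] psi_smul)
  then have "smul (laurent p w) (rot w M (smul c (delta j))) =
      smul c (smul (laurent (translation j p) w) (psi (vinverse w) (M (delta j))))" if "w \<in> torus" for w
    using torus_nonzero[OF that] by (simp add: laurent_translation pointwise)
  then have eq1: "seq_mean m (\<lambda>w. smul (laurent p w) (rot w M (smul c (delta j)))) =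
      smul c (seq_mean m (\<lambda>w. smul (laurent (translation j p) w) (psi (vinverse w) (M (delta j)))))"
    if m: "m > 0" for m
    unfolding seq_mean_def pointwise smul_apply torsion_mean_cmult[symmetric]
    by (intro allI torsion_mean_cong[OF m]) simp
  have eq2: "conv (\<lambda>n. p n * M (delta 0) n) (smul c (delta j)) =
      smul c (\<lambda>n. translation j p n * M (delta j) n)"
    by (simp add: conv_smul_right conv_delta_right finseqs_mult p pointwise Md)
  define s where "s m = seq_mean m (\<lambda>w. smul (laurent (translation j p) w) (psi (vinverse w) (M (delta j)))) -
      (\<lambda>n. translation j p n * M (delta j) n)" for m
  have "(\<lambda>m. cmod c * N (s m)) \<longlonglongrightarrow> cmod c * 0"
    unfolding s_def by (intro tendsto_mult_left mean_psi_tendsto MdE finseqs_translation p)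
  moreover have "\<forall>\<^sub>F m in sequentially. cmod c * N (s m) =
      N (seq_mean m (\<lambda>w. smul (laurent p w) (rot w M (smul c (delta j)))) -
            conv (\<lambda>n. p n * M (delta 0) n) (smul c (delta j)))"
    using eventually_gt_at_top[of 0]
  proof eventually_elim
    case (elim m)
    have sE: "s m \<in> E"
      unfolding s_def using elim MdE
      by (intro diff_mem seq_mean_mem smul_mem psi_closed vinverse_torus
            op_mem[OF bounded_op_multiply] finseqs_translation p)
    have "seq_mean m (\<lambda>w. smul (laurent p w) (rot w M (smul c (delta j)))) -
            conv (\<lambda>n. p n * M (delta 0) n) (smul c (delta j)) = smul c (s m)"
      unfolding eq1[OF elim] eq2 s_def by (simp add: pointwise algebra_simps)
    then show ?case by (simp only: N_smul[OF sE])
  qed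
  ultimately show ?case by (simp add: tendsto_cong)
next
  case (add x y)
  have Mb: "bounded_op E N M" using multiplier_bounded[OF M] .
  define F where "F x m = seq_mean m (\<lambda>w. smul (laurent p w) (rot w M x)) -
            conv (\<lambda>n. p n * M (delta 0) n) x" for x m
  have xy: "x \<in> E" "y \<in> E" using add.hyps finseqs_mem by auto
  have FE: "F u m \<in> E" if "u \<in> E" "m > 0" for u m
    unfolding F_def using that Mb by (intro diff_mem seq_mean_mem smul_mem rot_mem conv_mem finseqs_mult p)
  have F_add: "F (x + y) m = F x m + F y m" if m: "m > 0" for m
  proof -
    have "seq_mean m (\<lambda>w. smul (laurent p w) (rot w M (x + y))) n =
        torsion_mean m (\<lambda>w. laurent p w * rot w M x n + laurent p w * rot w M y n)" for n
      unfolding seq_mean_def by (intro torsion_mean_cong[OF m]) (simp add: rot_add[OF Mb] xy algebra_simps smul_apply plus_fun_apply)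
    then show ?thesis
      unfolding F_def by (simp add: pointwise torsion_mean_add seq_mean_def conv_add_right)
  qed
  have "\<forall>\<^sub>F m in sequentially. norm (N (F (x + y) m)) \<le> N (F x m) + N (F y m)"
    using eventually_gt_at_top[of 0]
  proof eventually_elim
    case (elim m)
    have "F (x + y) m \<in> E" using elim xy by (intro FE add_mem)
    then have "norm (N (F (x + y) m)) = N (F (x + y) m)" using N_nonneg by simp
    also have "\<dots> \<le> N (F x m) + N (F y m)" using F_add[OF elim] N_triangle[OF FE FE] xy elim by simp
    finally show ?case .
  qed
  moreover have "(\<lambda>m. N (F x m) + N (F y m)) \<longlonglongrightarrow> 0"
    using tendsto_add[OF add.IH] by (simp add: F_def)
  ultimately show ?case unfolding F_def by (rule Lim_null_comparison)
qed

text \<open>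
  The comparison operator \<open>T\<close> serves two purposes: with \<open>T = 0\<close> it yields norm bounds for the
  averaged operator, and with \<open>T = M\<close> it measures the distance of the averaged operator from \<open>M\<close> by
  the modulus of continuity \<open>\<kappa>\<close> of its rotations.
\<close>

lemma mean_bound:
  assumes M: "M \<in> multipliers E N" and p: "p \<in> finseqs" and T: "bounded_op E N T"
    and close: "\<And>w x. w \<in> torus \<Longrightarrow> x \<in> E \<Longrightarrow> N (rot w M x - T x) \<le> \<kappa> w * N x"
    and mean: "\<forall>\<^sub>F m in sequentially. torsion_mean m (\<lambda>w. cmod (laurent p w) * \<kappa> w) \<le> B"
    and B: "B \<ge> 0" and x: "x \<in> E"
  shows "N (conv (\<lambda>n. p n * M (delta 0) n) x - smul (p 0) (T x)) \<le> B * N x"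
proof (rule extend_bound[OF _ _ B x])
  have Mb: "bounded_op E N M" using multiplier_bounded[OF M] .
  let ?C = "conv (\<lambda>n. p n * M (delta 0) n)"
  show "bounded_op E N (\<lambda>x. ?C x - smul (p 0) (T x))"
    by (intro bounded_op_diff bounded_op_conv finseqs_mult p bounded_op_smul T)
  fix x :: "'k seq" assume x: "x \<in> finseqs"
  have xE: "x \<in> E" using x finseqs_mem by blast
  define A where "A m = seq_mean m (\<lambda>w. smul (laurent p w) (rot w M x))" for m
  have "(\<lambda>m. N (A m - ?C x) + B * N x) \<longlonglongrightarrow> 0 + B * N x"
    unfolding A_def by (intro tendsto_add tendsto_const mean_rot_tendsto M p x)
  moreover have "\<forall>\<^sub>F m in sequentially. N (?C x - smul (p 0) (T x)) \<le> N (A m - ?C x) + B * N x"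
    using mean eventually_gt_at_top[of 0] eventually_mean_laurent[OF p, of 0]
  proof eventually_elim
    case (elim m)
    have m: "m > 0" by fact
    define F where "F w = smul (laurent p w) (rot w M x - T x)" for w
    have FE: "F w \<in> E" if "w \<in> torus" for w
      unfolding F_def using that xE Mb T by (intro smul_mem diff_mem rot_mem op_mem[OF T])
    have AE: "A m \<in> E" unfolding A_def using m xE Mb by (intro seq_mean_mem smul_mem rot_mem)
    have CE: "?C x \<in> E" using xE by (intro conv_mem finseqs_mult p)
    have TE: "smul (p 0) (T x) \<in> E" using xE T by (intro smul_mem op_mem[OF T])
    have "torsion_mean m (\<lambda>w. laurent p w) = p 0" using elim(3) by simp
    then have "A m - smul (p 0) (T x) = seq_mean m F"
      by (simp add: A_def F_def pointwise seq_mean_def right_diff_distrib torsion_mean_diff torsion_mean_multc)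
    then have "N (A m - smul (p 0) (T x)) \<le> torsion_mean m (\<lambda>w. N (F w))"
      using N_seq_mean[OF m FE] by simp
    also have "\<dots> \<le> torsion_mean m (\<lambda>w. cmod (laurent p w) * \<kappa> w * N x)"
    proof (rule torsion_mean_mono[OF m])
      fix w :: "complex ^ 'k" assume w: "w \<in> torus"
      have "N (F w) = cmod (laurent p w) * N (rot w M x - T x)"
        unfolding F_def using w xE Mb T by (intro N_smul diff_mem rot_mem op_mem[OF T])
      also have "\<dots> \<le> cmod (laurent p w) * (\<kappa> w * N x)" using close[OF w xE] by (intro mult_left_mono) auto
      finally show "N (F w) \<le> cmod (laurent p w) * \<kappa> w * N x" by (simp add: mult.assoc)
    qed
    also have "\<dots> = torsion_mean m (\<lambda>w. cmod (laurent p w) * \<kappa> w) * N x" by (rule torsion_mean_multc)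
    also have "\<dots> \<le> B * N x" using elim(1) N_nonneg[OF xE] by (intro mult_right_mono) auto
    finally have 1: "N (A m - smul (p 0) (T x)) \<le> B * N x" .
    have "N (?C x - smul (p 0) (T x)) \<le> N (A m - smul (p 0) (T x)) + N (?C x - A m)"
      using N_le_add_diff[of "?C x - smul (p 0) (T x)" "A m - smul (p 0) (T x)"] AE CE TE diff_mem by simp
    then show ?case using 1 N_diff_commute[OF AE CE] by simp
  qed
  ultimately show "N (?C x - smul (p 0) (T x)) \<le> B * N x"
    by (intro tendsto_lowerbound[where f = "\<lambda>m. N (A m - ?C x) + B * N x" and F = sequentially]) simp_all
qed

lemma mean_bound_norm:
  assumes M: "M \<in> multipliers E N" and p: "p \<in> finseqs"
    and C: "C \<ge> 0" "\<And>x. x \<in> E \<Longrightarrow> N (M x) \<le> C * N x"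
    and mean: "\<forall>\<^sub>F m in sequentially. torsion_mean m (\<lambda>w :: complex ^ 'k. cmod (laurent p w)) \<le> 1"
    and x: "x \<in> E"
  shows "N (conv (\<lambda>n. p n * M (delta 0) n) x) \<le> psi_norm\<^sup>2 * C * N x"
proof -
  have "N (conv (\<lambda>n. p n * M (delta 0) n) x - smul (p 0) ((\<lambda>x. 0) x)) \<le> psi_norm\<^sup>2 * C * N x"
  proof (rule mean_bound[OF M p bounded_op_zero, where \<kappa> = "\<lambda>_. psi_norm\<^sup>2 * C"])
    show "N (rot w M x - 0) \<le> psi_norm\<^sup>2 * C * N x" if "w \<in> torus" "x \<in> E" for w x
      using rot_bound[OF multiplier_bounded[OF M] C(2) C(1) that] by simp
    show "\<forall>\<^sub>F m in sequentially. torsion_mean m (\<lambda>w :: complex ^ 'k. cmod (laurent p w) * (psi_norm\<^sup>2 * C)) \<le> psi_norm\<^sup>2 * C"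
      using mean
    proof eventually_elim
      case (elim m)
      then show ?case unfolding torsion_mean_multc
        using mult_right_mono[OF elim, of "psi_norm\<^sup>2 * C"] C(1) by simp
    qed
  qed (use C x in auto)
  moreover have "u - smul c 0 = u" for c and u :: "'k seq" by (simp add: pointwise)
  ultimately show ?thesis by simp
qed

text \<open>
  Averaging against a monomial bounds the operator \<open>M (delta 0) n\<close> times translation by \<open>n\<close>, whose
  Laurent polynomial has at \<open>z\<close> the value to be estimated.
\<close>

lemma fourier_coefficient_bound:
  assumes M: "M \<in> multipliers E N" and C: "C \<ge> 0" "\<And>x. x \<in> E \<Longrightarrow> N (M x) \<le> C * N x"
    and z: "z \<in> Z_set E N"
  shows "cmod (M (delta 0) n * monomial z n) \<le> psi_norm\<^sup>2 * C"
proof -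
  define \<phi> where "\<phi> = (\<lambda>l. delta n l * M (delta 0) l)"
  have "\<phi> = smul (M (delta 0) n) (delta n)" by (auto simp: \<phi>_def pointwise delta_def)
  then have "laurent \<phi> z = M (delta 0) n * monomial z n" by (simp only: laurent_smul laurent_delta)
  moreover have "cmod (laurent \<phi> z) \<le> psi_norm\<^sup>2 * C"
  proof (rule Z_set_bound[OF z])
    show "\<phi> \<in> finseqs" unfolding \<phi>_def by (intro finseqs_mult finseqs_delta)
    fix x assume x: "x \<in> E"
    have "torsion_mean m (\<lambda>w :: complex ^ 'k. cmod (laurent (delta n) w)) \<le> 1" if "m > 0" for m
    proof -
      have "torsion_mean m (\<lambda>w :: complex ^ 'k. cmod (laurent (delta n) w)) = torsion_mean m (\<lambda>w :: complex ^ 'k. 1)"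
        by (rule torsion_mean_cong[OF that]) (simp add: laurent_delta norm_monomial_torus)
      then show ?thesis by (simp add: torsion_mean_const[OF that])
    qed
    then have "\<forall>\<^sub>F m in sequentially. torsion_mean m (\<lambda>w :: complex ^ 'k. cmod (laurent (delta n) w)) \<le> 1"
      by (rule eventually_mono[OF eventually_gt_at_top[of 0]])
    then show "N (conv \<phi> x) \<le> psi_norm\<^sup>2 * C * N x"
      unfolding \<phi>_def by (intro mean_bound_norm[OF M finseqs_delta C _ x])
  qed (use C in simp)
  ultimately show ?thesis by simp
qed

lemma fejer_mean_bound:
  assumes M: "M \<in> multipliers E N" and C: "C \<ge> 0" "\<And>x. x \<in> E \<Longrightarrow> N (M x) \<le> C * N x"
    and d: "d > 0" and x: "x \<in> E"
  shows "N (conv (\<lambda>n. fejer d n * M (delta 0) n) x) \<le> psi_norm\<^sup>2 * C * N x"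
proof (rule mean_bound_norm[OF M fejer_finseqs C _ x])
  show "\<forall>\<^sub>F m in sequentially. torsion_mean m (\<lambda>w :: complex ^ 'k. cmod (laurent (fejer d) w)) \<le> 1"
    using eventually_mean_fejer[OF d, where 'k = 'k] by eventually_elim simp
qed

end

section \<open>Interior points\<close>

definition l1_norm :: "int ^ 'k::finite \<Rightarrow> nat" where
  "l1_norm n = (\<Sum>i\<in>UNIV. nat \<bar>n $ i\<bar>)"

lemma sum_symmetric_geometric_le:
  fixes r :: real
  assumes "0 \<le> r" "r < 1"
  shows "(\<Sum>j\<in>{- int m..int m}. r ^ nat \<bar>j\<bar>) \<le> 2 / (1 - r)"
proof -
  have geo: "(\<Sum>j\<le>m. r ^ j) \<le> 1 / (1 - r)"
  proof -
    have "(\<Sum>j\<le>m. r ^ j) = (1 - r ^ Suc m) / (1 - r)"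
      using assms sum_gp0[of r m] by simp
    also have "\<dots> \<le> 1 / (1 - r)" using assms by (intro divide_right_mono) auto
    finally show ?thesis .
  qed
  have "{- int m..int m} = int ` {..m} \<union> (\<lambda>j. - int j) ` {..m}"
  proof (intro set_eqI iffI)
    fix j assume j: "j \<in> {- int m..int m}"
    show "j \<in> int ` {..m} \<union> (\<lambda>j. - int j) ` {..m}"
    proof (cases "j \<ge> 0")
      case True
      then have "j = int (nat j)" "nat j \<in> {..m}" using j by auto
      then show ?thesis by blast
    next
      case False
      then have "j = - int (nat (- j))" "nat (- j) \<in> {..m}" using j by auto
      then show ?thesis by blast
    qed
  qed auto
  then have "(\<Sum>j\<in>{- int m..int m}. r ^ nat \<bar>j\<bar>) =
      (\<Sum>j\<in>int ` {..m} \<union> (\<lambda>j. - int j) ` {..m}. r ^ nat \<bar>j\<bar>)" by simp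
  also have "\<dots> \<le> (\<Sum>j\<in>int ` {..m}. r ^ nat \<bar>j\<bar>) + (\<Sum>j\<in>(\<lambda>j. - int j) ` {..m}. r ^ nat \<bar>j\<bar>)"
    using assms by (subst sum_Un) (auto intro!: sum_nonneg)
  also have "\<dots> = (\<Sum>j\<le>m. r ^ j) + (\<Sum>j\<le>m. r ^ j)"
    by (simp add: sum.reindex inj_on_def)
  also have "\<dots> \<le> 2 / (1 - r)" using geo by simp
  finally show ?thesis .
qed

lemma summable_power_l1_norm:
  fixes r :: real
  assumes r: "0 \<le> r" "r < 1"
  shows "(\<lambda>n :: int ^ 'k::finite. r ^ l1_norm n) summable_on UNIV"
proof (rule nonneg_bdd_above_summable_on)
  show "bdd_above (sum (\<lambda>n :: int ^ 'k. r ^ l1_norm n) ` {F. F \<subseteq> UNIV \<and> finite F})"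
  proof (rule bdd_aboveI2)
    fix F :: "(int ^ 'k) set" assume "F \<in> {F. F \<subseteq> UNIV \<and> finite F}"
    then have fin: "finite F" by simp
    define m where "m = (\<Sum>n\<in>F. l1_norm n)"
    let ?B = "{n :: int ^ 'k. \<forall>i. n $ i \<in> {- int m..int m}}"
    have "F \<subseteq> ?B"
    proof
      fix n assume n: "n \<in> F"
      have "n $ i \<in> {- int m..int m}" for i
      proof -
        have "nat \<bar>n $ i\<bar> \<le> l1_norm n" unfolding l1_norm_def by (rule member_le_sum) auto
        also have "\<dots> \<le> m" unfolding m_def using n fin by (intro member_le_sum) auto
        finally show ?thesis by auto
      qed
      then show "n \<in> ?B" by simp
    qed
    then have "(\<Sum>n\<in>F. r ^ l1_norm n) \<le> (\<Sum>n\<in>?B. r ^ l1_norm n)"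
      using r by (intro sum_mono2 finite_vec_box) auto
    also have "\<dots> = (\<Sum>g\<in>PiE (UNIV :: 'k set) (\<lambda>_. {- int m..int m}). \<Prod>i\<in>UNIV. r ^ nat \<bar>g i\<bar>)"
      using sum.reindex_bij_betw[OF bij_betw_vec_nth, of "\<lambda>g. \<Prod>i\<in>UNIV. r ^ nat \<bar>g i\<bar>" "\<lambda>_ :: 'k. {- int m..int m}"]
      by (simp add: l1_norm_def power_sum)
    also have "\<dots> = (\<Prod>i\<in>(UNIV :: 'k set). \<Sum>j\<in>{- int m..int m}. r ^ nat \<bar>j\<bar>)"
      by (rule prod_sum_PiE[symmetric]) auto
    also have "\<dots> \<le> (\<Prod>i\<in>(UNIV :: 'k set). 2 / (1 - r))"
      using r by (intro prod_mono conjI sum_symmetric_geometric_le sum_nonneg) auto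
    finally show "(\<Sum>n\<in>F. r ^ l1_norm n) \<le> (2 / (1 - r)) ^ CARD('k)" by simp
  qed
qed (use r in auto)

lemma has_sum_conv_monomial:
  assumes G: "G \<in> finseqs" and z: "\<forall>i. z $ i \<noteq> 0" and f: "((\<lambda>n. f n * monomial z n) has_sum 0) UNIV"
  shows "((\<lambda>n. conv G f n * monomial z n) has_sum 0) UNIV"
  using G
proof (induction rule: finseqs_induct)
  case (delta c m)
  have "bij_betw (\<lambda>n. n - m) UNIV UNIV"
    by (rule bij_betwI[where g = "\<lambda>n. n + m"]) auto
  from has_sum_reindex_bij_betw[OF this, of "\<lambda>n. f n * monomial z n" 0]
  have "((\<lambda>n. f (n - m) * monomial z (n - m)) has_sum 0) UNIV" using f by simp
  from has_sum_cmult_right[OF this, of "c * monomial z m"]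
  have "((\<lambda>n. c * monomial z m * (f (n - m) * monomial z (n - m))) has_sum 0) UNIV" by simp
  moreover have "c * monomial z m * (f (n - m) * monomial z (n - m)) = conv (smul c (delta m)) f n * monomial z n" for n
    using monomial_add[OF z, of m "n - m"]
    by (simp add: conv_smul_left conv_delta_left smul_apply translation_apply)
  ultimately show ?case by simp
next
  case (add x y)
  have "conv (x + y) f n * monomial z n = conv x f n * monomial z n + conv y f n * monomial z n" for n
    by (simp only: conv_add_left[OF add.hyps]) (simp add: plus_fun_apply distrib_right)
  then show ?case using has_sum_add[OF add.IH] by simp
qed

text \<open>
  Dominated convergence for unconditional sums that all vanish, with a limit of finite support.
\<close>

lemma dominated_has_sum_0_limit:
  fixes h :: "nat \<Rightarrow> 'a \<Rightarrow> complex"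
  assumes sum0: "\<And>d. (h d has_sum 0) UNIV" and dom: "\<And>d n. cmod (h d n) \<le> b n"
    and b: "b summable_on UNIV" and lim: "\<And>n. (\<lambda>d. h d n) \<longlonglongrightarrow> l n" and "a \<in> A" "finite A"
    and l: "\<And>n. n \<notin> A \<Longrightarrow> l n = 0"
  shows "(\<Sum>n\<in>A. l n) = 0"
proof (rule ccontr)
  assume nz: "(\<Sum>n\<in>A. l n) \<noteq> 0"
  define e where "e = cmod (\<Sum>n\<in>A. l n) / 2"
  have e: "e > 0" using nz by (simp add: e_def)
  obtain S where S: "(b has_sum S) UNIV" using b by (auto simp: summable_on_def)
  obtain F where F: "finite F" "dist (sum b F) S \<le> e"
    using has_sum_finite_approximation[OF S e] by blast
  define G where "G = F \<union> A"
  have G: "finite G" "A \<subseteq> G" using F \<open>finite A\<close> by (auto simp: G_def)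
  have b0: "b n \<ge> 0" for n using dom[of 0 n] norm_ge_zero order_trans by blast
  have "sum b F \<le> sum b G" using G b0 by (intro sum_mono2) (auto simp: G_def)
  then have tail: "S - sum b G \<le> e" using F(2) by (simp add: dist_real_def)
  have small: "cmod (\<Sum>n\<in>G. h d n) \<le> e" for d
  proof -
    have 1: "(h d has_sum (0 - (\<Sum>n\<in>G. h d n))) (UNIV - G)"
      using has_sum_Diff[OF sum0 has_sum_finite[OF G(1)]] by simp
    have 2: "(b has_sum (S - sum b G)) (UNIV - G)"
      using has_sum_Diff[OF S has_sum_finite[OF G(1)]] by simp
    have "(\<lambda>n. norm (h d n)) summable_on (UNIV - G)"
      by (rule Infinite_Sum.abs_summable_on_comparison_test'[where g = b])
         (use 2 dom in \<open>auto simp: summable_on_def\<close>)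
    then have "cmod (0 - (\<Sum>n\<in>G. h d n)) \<le> infsum (\<lambda>n. norm (h d n)) (UNIV - G)"
      using norm_has_sum_bound[OF has_sum_infsum 1] by blast
    also have "\<dots> \<le> S - sum b G"
      using \<open>(\<lambda>n. norm (h d n)) summable_on (UNIV - G)\<close> 2 dom by (intro has_sum_mono[OF has_sum_infsum 2]) auto
    finally show ?thesis using tail by simp
  qed
  have "(\<lambda>d. cmod (\<Sum>n\<in>G. h d n)) \<longlonglongrightarrow> cmod (\<Sum>n\<in>G. l n)"
    by (intro tendsto_intros lim)
  then have "cmod (\<Sum>n\<in>G. l n) \<le> e"
    by (rule tendsto_upperbound) (use small in auto)
  moreover have "(\<Sum>n\<in>G. l n) = (\<Sum>n\<in>A. l n)" using G l by (intro sum.mono_neutral_right) auto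
  ultimately show False using e by (simp add: e_def)
qed

lemma norm_vec_le_sum: "norm (x :: complex ^ 'k::finite) \<le> (\<Sum>i\<in>UNIV. cmod (x $ i))"
  unfolding norm_vec_def by (rule L2_set_le_sum) auto

text \<open>
  Move each coordinate of \<open>z\<close> radially by the factor \<open>t\<close> or \<open>1 / t\<close> according to the sign of \<open>n $ i\<close>; for
  \<open>t\<close> close to 1 the point stays in a ball around \<open>z\<close> inside \<open>S\<close>, whatever the signs are.
\<close>

lemma interior_monomial_gain:
  fixes S :: "(complex ^ 'k::finite) set"
  assumes "z \<in> interior S"
  obtains t where "t > 1" "\<And>n. \<exists>w\<in>S. cmod (monomial w n) = t ^ l1_norm n * cmod (monomial z n)"
proof -
  obtain e where e: "e > 0" "ball z e \<subseteq> S" using assms mem_interior by blast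
  define s where "s = (\<Sum>i\<in>UNIV. cmod (z $ i))"
  have s: "s \<ge> 0" by (simp add: s_def sum_nonneg)
  define t where "t = 1 + e / (2 * (s + 1))"
  have t: "t > 1" using e s by (simp add: t_def)
  show thesis
  proof (rule that[OF t])
    fix n :: "int ^ 'k"
    define u where "u i = (if n $ i \<ge> 0 then t else 1 / t)" for i
    define w where "w = (\<chi> i. z $ i * of_real (u i))"
    have u: "\<bar>u i - 1\<bar> \<le> t - 1" for i
    proof -
      have "1 - 1 / t \<le> t - 1"
      proof -
        have "0 \<le> (t - 1) * (t - 1) / t" using t by simp
        also have "\<dots> = (t - 1) - (1 - 1 / t)" using t by (simp add: field_simps)
        finally show ?thesis by simp
      qed
      moreover have "1 / t \<le> 1" using t by simp
      ultimately show ?thesis using t by (auto simp: u_def)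
    qed
    have "norm (z - w) \<le> (\<Sum>i\<in>UNIV. cmod ((z - w) $ i))" by (rule norm_vec_le_sum)
    also have "\<dots> \<le> (\<Sum>i\<in>UNIV. cmod (z $ i) * (t - 1))"
    proof (rule sum_mono)
      fix i
      have "(z - w) $ i = z $ i * of_real (1 - u i)" by (simp add: w_def algebra_simps)
      then have "cmod ((z - w) $ i) = cmod (z $ i) * \<bar>u i - 1\<bar>" by (simp only: norm_mult norm_of_real abs_minus_commute)
      then show "cmod ((z - w) $ i) \<le> cmod (z $ i) * (t - 1)" using u[of i] by (simp add: mult_left_mono)
    qed
    also have "\<dots> = s * (t - 1)" by (simp add: s_def sum_distrib_right)
    also have "\<dots> < e"
    proof -
      have "s * (t - 1) = (s / (s + 1)) * (e / 2)" unfolding t_def by simp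
      also have "\<dots> \<le> 1 * (e / 2)" using s e by (intro mult_right_mono) auto
      also have "\<dots> < e" using e by simp
      finally show ?thesis .
    qed
    finally have "w \<in> S" using e(2) by (auto simp: dist_norm)
    moreover have "cmod (monomial w n) = t ^ l1_norm n * cmod (monomial z n)"
    proof -
      have up: "cmod (of_real (u i) powi (n $ i)) = t ^ nat \<bar>n $ i\<bar>" for i
      proof (cases "n $ i \<ge> 0")
        case True
        then show ?thesis using t by (simp add: u_def power_int_def norm_power)
      next
        case False
        then show ?thesis using t by (simp add: u_def power_int_def norm_divide norm_power power_divide field_simps)
      qed
      have "cmod (monomial w n) = (\<Prod>i\<in>UNIV. cmod ((z $ i) powi (n $ i)) * cmod (of_real (u i) powi (n $ i)))"
        by (simp add: monomial_def w_def prod_norm[symmetric] power_int_mult_distrib norm_mult)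
      also have "\<dots> = cmod (monomial z n) * (\<Prod>i\<in>UNIV. t ^ nat \<bar>n $ i\<bar>)"
        unfolding up by (simp add: prod.distrib monomial_def prod_norm)
      finally show ?thesis by (simp add: l1_norm_def power_sum mult.commute)
    qed
    ultimately show "\<exists>w\<in>S. cmod (monomial w n) = t ^ l1_norm n * cmod (monomial z n)" by blast
  qed
qed

lemma conv_algebra_eq_conv: "A \<in> conv_algebra \<Longrightarrow> \<exists>\<phi>\<in>finseqs. A = conv \<phi>"
proof (induction rule: conv_algebra.induct)
  case (conv \<phi>)
  then show ?case by blast
next
  case (add A B)
  then obtain \<phi> \<psi> where "\<phi> \<in> finseqs" "\<psi> \<in> finseqs" "A = conv \<phi>" "B = conv \<psi>" by blast
  moreover from this have "A + B = conv (\<phi> + \<psi>)" by (intro ext) (simp add: conv_add_left plus_fun_apply)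
  ultimately show ?case using finseqs_add by blast
next
  case (scale A c)
  then obtain \<phi> where "\<phi> \<in> finseqs" "A = conv \<phi>" by blast
  moreover from this have "(\<lambda>x. smul c (A x)) = conv (smul c \<phi>)" by (intro ext) (simp add: conv_smul_left)
  ultimately show ?case using finseqs_smul by blast
next
  case (compose A B)
  then obtain \<phi> \<psi> where "\<phi> \<in> finseqs" "\<psi> \<in> finseqs" "A = conv \<phi>" "B = conv \<psi>" by blast
  moreover from this have "A \<circ> B = conv (conv \<phi> \<psi>)" by (intro ext) (simp add: conv_assoc)
  ultimately show ?case using conv_in_finseqs by blast
qed

context shift_invariant_space
begin

lemma multipliersI:
  assumes "bounded_op E N T" "\<And>i x. x \<in> E \<Longrightarrow> T (translation (axis i 1) x) = translation (axis i 1) (T x)"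
  shows "T \<in> multipliers E N"
  using assms by (simp add: multipliers_def)

lemma translation_diff: "translation a (x - y) = translation a x - translation a y"
  by (simp add: pointwise)

lemma translation_smul: "translation a (smul c x) = smul c (translation a x)"
  by (simp add: pointwise)

lemma multiplier_sub_scalar:
  assumes "M \<in> multipliers E N"
  shows "(\<lambda>x. M x - smul c x) \<in> multipliers E N"
  by (rule multipliersI[OF bounded_op_diff[OF multiplier_bounded[OF assms] bounded_op_smul[OF bounded_op_id]]])
     (simp add: multiplier_translation[OF assms] translation_diff translation_smul)

lemma multiplier_inverse:
  assumes M: "M \<in> multipliers E N" and R: "bounded_op E N R"
    and inv: "\<And>x. x \<in> E \<Longrightarrow> R (M x) = x" "\<And>x. x \<in> E \<Longrightarrow> M (R x) = x"
  shows "R \<in> multipliers E N"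
proof (rule multipliersI[OF R])
  fix i x assume x: "x \<in> E"
  have Rx: "R x \<in> E" using op_mem[OF R x] .
  have "M (translation (axis i 1) (R x)) = translation (axis i 1) x"
    using multiplier_translation[OF M Rx] inv(2)[OF x] by simp
  then show "R (translation (axis i 1) x) = translation (axis i 1) (R x)"
    using inv(1)[OF translation_mem[OF Rx]] by metis
qed

lemma multiplier_conv_op:
  assumes "\<phi> \<in> finseqs"
  shows "conv \<phi> \<in> multipliers E N"
  by (intro multipliersI bounded_op_conv assms conv_translation_right)

lemma multiplier_comp:
  assumes "S \<in> multipliers E N" "T \<in> multipliers E N"
  shows "(\<lambda>x. S (T x)) \<in> multipliers E N"
  using op_mem[OF multiplier_bounded[OF assms(2)]]
  by (intro multipliersI[OF bounded_op_comp[OF multiplier_bounded[OF assms(1)] multiplier_bounded[OF assms(2)]]])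
     (simp add: multiplier_translation[OF assms(1)] multiplier_translation[OF assms(2)])

text \<open>
  At each coordinate of a finite \<open>x\<close> this is the convergence of the kernel to 1; the uniform norm
  bound of the Fejer means and continuity of evaluation extend it to \<open>E\<close>.
\<close>

lemma fejer_mean_pointwise:
  assumes R: "R \<in> multipliers E N" and x: "x \<in> E"
  shows "(\<lambda>d. conv (\<lambda>n. fejer d n * R (delta 0) n) x n) \<longlonglongrightarrow> R x n"
proof -
  define G where "G d = (\<lambda>n. fejer d n * R (delta 0) n)" for d
  have G: "G d \<in> finseqs" for d unfolding G_def by (intro finseqs_mult fejer_finseqs)
  have Rb: "bounded_op E N R" using multiplier_bounded[OF R] .
  obtain C where C: "C \<ge> 0" "\<And>x. x \<in> E \<Longrightarrow> N (R x) \<le> C * N x" using op_boundE[OF Rb] by blast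
  obtain K where K: "K \<ge> 0" "\<And>x. x \<in> E \<Longrightarrow> cmod (x n) \<le> K * N x" using eval_bound[of n] by blast
  have fin: "(\<lambda>d. conv (G d) y n) \<longlonglongrightarrow> R y n" if "y \<in> finseqs" for y
    using that
  proof (induction rule: finseqs_induct)
    case (delta c j)
    have "delta j = translation j (delta 0)" by (auto simp: pointwise delta_def)
    then have Rd: "R (delta j) = translation j (R (delta 0))"
      using multiplier_translation[OF R delta_mem] by simp
    have eq: "conv (G d) (smul c (delta j)) n = c * (fejer d (n - j) * R (delta 0) (n - j))" for d
      by (simp add: conv_smul_right conv_delta_right[OF G] smul_apply translation_apply) (simp add: G_def)
    have "R (smul c (delta j)) n = c * (1 * R (delta 0) (n - j))"
      by (simp add: op_smul[OF Rb delta_mem] Rd smul_apply translation_apply)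
    then show ?case unfolding eq by (simp only:) (intro tendsto_intros fejer_tendsto_1)
  next
    case (add u v)
    then have "u \<in> E" "v \<in> E" using finseqs_mem by auto
    then have "R (u + v) n = R u n + R v n" by (simp only: op_add[OF Rb]) (simp add: plus_fun_apply)
    moreover have "conv (G d) (u + v) n = conv (G d) u n + conv (G d) v n" for d
      by (simp only: conv_add_right) (simp add: plus_fun_apply)
    ultimately show ?case using tendsto_add[OF add.IH] by simp
  qed
  have bound: "N (conv (G d) u) \<le> (psi_norm\<^sup>2 * C) * N u" if "d > 0" "u \<in> E" for d u
    unfolding G_def using fejer_mean_bound[OF R C that] .
  define D where "D = K * (psi_norm\<^sup>2 * C) + K * C"
  have D: "D \<ge> 0" using K C by (simp add: D_def)
  have "(\<lambda>d. cmod (conv (G d) x n - R x n)) \<longlonglongrightarrow> 0"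
  proof (rule tendsto_0_by_density[OF x D])
    show "(\<lambda>d. cmod (conv (G d) y n - R y n)) \<longlonglongrightarrow> 0" if "y \<in> finseqs" for y
      using fin[OF that] by (simp add: tendsto_norm_zero LIM_zero)
    fix d :: nat and y assume d: "d > 0" and y: "y \<in> E"
    have dE: "x - y \<in> E" using x y diff_mem by blast
    have "conv (G d) x n - R x n =
        (conv (G d) y n - R y n) + (conv (G d) (x - y) n - R (x - y) n)"
      using x y by (simp add: op_diff[OF bounded_op_conv[OF G]] op_diff[OF Rb] minus_apply)
    also have "cmod \<dots> \<le> cmod (conv (G d) y n - R y n) +
        (cmod (conv (G d) (x - y) n) + cmod (R (x - y) n))"
      by (intro order_trans[OF norm_triangle_ineq] add_mono order_refl norm_triangle_ineq4)
    also have "cmod (conv (G d) (x - y) n) \<le> K * ((psi_norm\<^sup>2 * C) * N (x - y))"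
      using K(2)[OF conv_mem[OF G dE]] mult_left_mono[OF bound[OF d dE] K(1)] by (rule order_trans)
    also have "cmod (R (x - y) n) \<le> K * (C * N (x - y))"
      using K(2)[OF op_mem[OF Rb dE]] mult_left_mono[OF C(2)[OF dE] K(1)] by (rule order_trans)
    finally show "cmod (conv (G d) x n - R x n) \<le> cmod (conv (G d) y n - R y n) + D * N (x - y)"
      by (simp add: D_def algebra_simps)
  qed simp
  then have "(\<lambda>d. conv (G d) x n) \<longlonglongrightarrow> R x n"
    by (simp add: tendsto_norm_zero_iff LIM_zero_iff)
  then show ?thesis unfolding G_def .
qed

lemma Z_set_nonzero: "z \<in> Z_set E N \<Longrightarrow> \<forall>i. z $ i \<noteq> 0"
  by (simp add: Z_set_def)

lemma interior_coefficient_decay: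
  assumes z: "z \<in> interior (Z_set E N)"
  obtains r where "0 \<le> r" "r < 1"
    "\<And>M C n. \<lbrakk>M \<in> multipliers E N; C \<ge> 0; \<And>x. x \<in> E \<Longrightarrow> N (M x) \<le> C * N x\<rbrakk> \<Longrightarrow>
        cmod (M (delta 0) n * monomial z n) \<le> psi_norm\<^sup>2 * C * r ^ l1_norm n"
proof -
  obtain t where t: "t > 1"
    "\<And>n. \<exists>w\<in>Z_set E N. cmod (monomial w n) = t ^ l1_norm n * cmod (monomial z n)"
    using interior_monomial_gain[OF z] by blast
  show thesis
  proof (rule that[of "1 / t"])
    fix M C n assume M: "M \<in> multipliers E N" and C: "C \<ge> 0" "\<And>x. x \<in> E \<Longrightarrow> N (M x) \<le> C * N x"
    obtain w where w: "w \<in> Z_set E N" "cmod (monomial w n) = t ^ l1_norm n * cmod (monomial z n)"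
      using t(2) by blast
    have "cmod (M (delta 0) n) * (t ^ l1_norm n * cmod (monomial z n)) \<le> psi_norm\<^sup>2 * C"
      using fourier_coefficient_bound[OF M C w(1), of n] by (simp add: norm_mult w(2))
    then show "cmod (M (delta 0) n * monomial z n) \<le> psi_norm\<^sup>2 * C * (1 / t) ^ l1_norm n"
      using t(1) by (simp add: norm_mult power_divide pos_le_divide_eq mult_ac)
  qed (use t in auto)
qed

text \<open>
  As \<open>R (delta 0)\<close> is in general an infinite sequence, \<open>Q (R (delta 0))\<close> is not a priori the convolution of
  \<open>Q (delta 0)\<close> with it.  Replacing \<open>R\<close> by its Fejer means makes one factor finite, and the
  coefficients of the products are dominated uniformly since the products are themselves
  multipliers of uniformly bounded norm.
\<close>

theorem symbol_interior_in_spectrum: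
  assumes M: "M \<in> multipliers E N" and z: "z \<in> interior (Z_set E N)"
  shows "symbol M z \<in> op_spectrum E N M"
proof (rule ccontr)
  define c where "c = symbol M z"
  define Q where "Q = (\<lambda>x. M x - smul c x)"
  assume "symbol M z \<notin> op_spectrum E N M"
  then have "invertible_op E N Q" by (simp add: op_spectrum_iff Q_def c_def)
  then obtain R where R: "bounded_op E N R" "\<And>x. x \<in> E \<Longrightarrow> R (Q x) = x" "\<And>x. x \<in> E \<Longrightarrow> Q (R x) = x"
    unfolding invertible_op_def by blast
  have Q: "Q \<in> multipliers E N" unfolding Q_def by (rule multiplier_sub_scalar[OF M])
  have Rm: "R \<in> multipliers E N" using multiplier_inverse[OF Q R] .
  have zZ: "z \<in> Z_set E N" using z interior_subset by blast
  have znz: "\<forall>i. z $ i \<noteq> 0" using Z_set_nonzero[OF zZ] .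
  obtain r where r: "0 \<le> r" "r < 1"
    and decay: "\<And>M C n. \<lbrakk>M \<in> multipliers E N; C \<ge> 0; \<And>x. x \<in> E \<Longrightarrow> N (M x) \<le> C * N x\<rbrakk> \<Longrightarrow>
        cmod (M (delta 0) n * monomial z n) \<le> psi_norm\<^sup>2 * C * r ^ l1_norm n"
    using interior_coefficient_decay[OF z] by blast
  obtain CM where CM: "CM \<ge> 0" "\<And>x. x \<in> E \<Longrightarrow> N (M x) \<le> CM * N x"
    using op_boundE[OF multiplier_bounded[OF M]] by blast
  obtain CQ where CQ: "CQ \<ge> 0" "\<And>x. x \<in> E \<Longrightarrow> N (Q x) \<le> CQ * N x"
    using op_boundE[OF multiplier_bounded[OF Q]] by blast
  obtain CR where CR: "CR \<ge> 0" "\<And>x. x \<in> E \<Longrightarrow> N (R x) \<le> CR * N x"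
    using op_boundE[OF R(1)] by blast
  have sumr: "(\<lambda>n :: int ^ 'k. B * r ^ l1_norm n) summable_on UNIV" for B
    by (intro summable_on_cmult_right summable_power_l1_norm r)
  have "(\<lambda>n. cmod (M (delta 0) n * monomial z n)) summable_on UNIV"
    by (rule Infinite_Sum.abs_summable_on_comparison_test'[OF sumr[of "psi_norm\<^sup>2 * CM"]])
       (rule decay[OF M CM])
  then have "(\<lambda>n. M (delta 0) n * monomial z n) summable_on UNIV" by (rule abs_summable_summable)
  then have 1: "((\<lambda>n. M (delta 0) n * monomial z n) has_sum c) UNIV"
    by (simp add: c_def symbol_def has_sum_infsum)
  have 2: "((\<lambda>n. - c * (delta 0 n * monomial z n)) has_sum - c) UNIV"
    by (subst has_sum_cong_neutral[where S = "{0}" and g = "\<lambda>n. - c * (delta 0 n * monomial z n)", symmetric])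
       (auto simp: delta_def intro!: has_sum_finiteI)
  have f0: "((\<lambda>n. Q (delta 0) n * monomial z n) has_sum 0) UNIV"
    using has_sum_add[OF 1 2] by (simp add: Q_def minus_apply smul_apply algebra_simps)
  define G where "G d = (\<lambda>n. fejer (Suc d) n * R (delta 0) n)" for d
  have G: "G d \<in> finseqs" for d unfolding G_def by (intro finseqs_mult fejer_finseqs)
  have G_bound: "N (conv (G d) x) \<le> (psi_norm\<^sup>2 * CR) * N x" if "x \<in> E" for d x
    unfolding G_def using fejer_mean_bound[OF Rm CR _ that, of "Suc d"] by simp
  define h where "h d = conv (G d) (Q (delta 0))" for d
  have h: "h d = Q (conv (G d) (delta 0))" for d
    unfolding h_def by (rule multiplier_conv[OF Q G delta_mem, symmetric])
  define B where "B = psi_norm\<^sup>2 * (CQ * (psi_norm\<^sup>2 * CR))"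
  have "(\<Sum>n\<in>{0}. delta 0 n * monomial z n) = 0"
  proof (rule dominated_has_sum_0_limit[where h = "\<lambda>d n. h d n * monomial z n" and b = "\<lambda>n. B * r ^ l1_norm n"])
    show "((\<lambda>n. h d n * monomial z n) has_sum 0) UNIV" for d
      unfolding h_def by (rule has_sum_conv_monomial[OF G znz f0])
    show "(\<lambda>n. B * r ^ l1_norm n) summable_on (UNIV :: (int ^ 'k) set)" by (rule sumr)
    show "cmod (h d n * monomial z n) \<le> B * r ^ l1_norm n" for d n
      unfolding h B_def
    proof (rule decay)
      show "(\<lambda>x. Q (conv (G d) x)) \<in> multipliers E N" by (rule multiplier_comp[OF Q multiplier_conv_op[OF G]])
      show "CQ * (psi_norm\<^sup>2 * CR) \<ge> 0" using CQ CR by simp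
      fix x assume x: "x \<in> E"
      have "N (Q (conv (G d) x)) \<le> CQ * N (conv (G d) x)" by (intro CQ conv_mem G x)
      also have "\<dots> \<le> CQ * ((psi_norm\<^sup>2 * CR) * N x)" by (intro mult_left_mono G_bound x CQ)
      finally show "N (Q (conv (G d) x)) \<le> CQ * (psi_norm\<^sup>2 * CR) * N x" by (simp add: mult_ac)
    qed
    show "(\<lambda>d. h d n * monomial z n) \<longlonglongrightarrow> delta 0 n * monomial z n" for n
    proof (intro tendsto_mult tendsto_const)
      have "Q (delta 0) \<in> E" using op_mem[OF multiplier_bounded[OF Q] delta_mem] .
      from fejer_mean_pointwise[OF Rm this, of n] R(2)[OF delta_mem, of 0]
      have "(\<lambda>d. conv (\<lambda>n. fejer d n * R (delta 0) n) (Q (delta 0)) n) \<longlonglongrightarrow> delta 0 n" by simp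
      then show "(\<lambda>d. h d n) \<longlonglongrightarrow> delta 0 n" unfolding h_def G_def by (rule LIMSEQ_Suc)
    qed
  qed (auto simp: delta_def)
  then show False by (simp add: delta_def)
qed

text \<open>
  Gives the closure in the first assertion of the theorem.
\<close>

lemma closed_op_spectrum:
  assumes M: "bounded_op E N M"
  shows "closed (op_spectrum E N M)"
  unfolding closed_def open_dist
proof
  fix c assume "c \<in> - op_spectrum E N M"
  then have inv: "invertible_op E N (\<lambda>x. M x - smul c x)" by (simp add: op_spectrum_iff)
  have b: "bounded_op E N (\<lambda>x. M x - smul c x)" for c
    by (rule bounded_op_diff[OF M bounded_op_smul[OF bounded_op_id]])
  obtain \<eta> where \<eta>: "\<eta> > 0" "\<And>T'. bounded_op E N T' \<Longrightarrow>
      (\<And>x. x \<in> E \<Longrightarrow> N (T' x - (M x - smul c x)) \<le> \<eta> * N x) \<Longrightarrow> invertible_op E N T'"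
    using invertible_open[OF b inv] by blast
  have "c' \<notin> op_spectrum E N M" if "dist c' c < \<eta>" for c'
  proof -
    have "invertible_op E N (\<lambda>x. M x - smul c' x)"
    proof (rule \<eta>(2)[OF b])
      fix x assume x: "x \<in> E"
      have "(M x - smul c' x) - (M x - smul c x) = smul (c - c') x"
        by (simp add: pointwise algebra_simps)
      then show "N ((M x - smul c' x) - (M x - smul c x)) \<le> \<eta> * N x"
        using that N_nonneg[OF x] by (simp add: N_smul[OF x] dist_norm norm_minus_commute mult_right_mono)
    qed
    then show ?thesis by (simp add: op_spectrum_iff)
  qed
  then show "\<exists>e>0. \<forall>y. dist y c < e \<longrightarrow> y \<in> - op_spectrum E N M" using \<eta>(1) by auto
qed

end

section \<open>Inverses of convolutions and symbol values\<close>

context shift_invariant_space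
begin

lemma rot_conv_Lipschitz:
  assumes "P \<in> finseqs"
  shows "\<exists>L\<ge>0. \<forall>w\<in>torus. \<forall>y\<in>E. N (conv P y - rot w (conv P) y) \<le> L * dist_to_1 w * N y"
  using assms
proof (induction rule: finseqs_induct)
  case (delta c n)
  obtain K where K: "K \<ge> 0" "\<And>w. w \<in> torus \<Longrightarrow> cmod (1 - monomial w (- n)) \<le> K * dist_to_1 w"
    using one_minus_monomial_bound[of "- n"] by blast
  obtain C where C: "C \<ge> 0" "\<And>x. x \<in> E \<Longrightarrow> N (translation n x) \<le> C * N x"
    using op_boundE[OF bounded_op_translation[of n]] by blast
  have "N (conv (smul c (delta n)) y - rot w (conv (smul c (delta n))) y) \<le>
      (cmod c * K * C) * dist_to_1 w * N y" if w: "w \<in> torus" and y: "y \<in> E" for w y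
  proof -
    have "monomial w l * monomial w (- n) = monomial w (l - n)" for l
      using monomial_add[OF torus_nonzero[OF w], of l "- n"] by simp
    then have 1: "inverse (monomial w l) * monomial w (l - n) = monomial w (- n)" for l
      using monomial_nonzero[OF torus_nonzero[OF w], of l] by (metis left_inverse mult.assoc mult_1)
    have "rot w (conv (smul c (delta n))) y l = smul (c * monomial w (- n)) (translation n y) l" for l
      using 1[of l] by (simp only: rot_def conv_smul_left conv_delta_left)
        (simp add: psi_def smul_apply translation_apply monomial_vinverse mult_ac)
    then have "conv (smul c (delta n)) y - rot w (conv (smul c (delta n))) y =
        smul (c * (1 - monomial w (- n))) (translation n y)"
      by (simp only: conv_smul_left conv_delta_left fun_eq_iff)
         (simp add: minus_apply smul_apply translation_apply algebra_simps)
    then have "N (conv (smul c (delta n)) y - rot w (conv (smul c (delta n))) y) =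
        cmod c * cmod (1 - monomial w (- n)) * N (translation n y)"
      by (simp only: N_smul[OF translation_mem[OF y]] norm_mult)
    also have "\<dots> \<le> cmod c * (K * dist_to_1 w) * (C * N y)"
      using K(1) w y by (intro mult_mono mult_left_mono K C mult_nonneg_nonneg sum_nonneg N_nonneg translation_mem) auto
    finally show ?thesis by (simp add: mult_ac)
  qed
  then show ?case using K(1) C(1) by (intro exI[of _ "cmod c * K * C"]) auto
next
  case (add x y)
  obtain L1 where L1: "L1 \<ge> 0" "\<And>w u. w \<in> torus \<Longrightarrow> u \<in> E \<Longrightarrow>
      N (conv x u - rot w (conv x) u) \<le> L1 * dist_to_1 w * N u"
    using add.IH(1) by blast
  obtain L2 where L2: "L2 \<ge> 0" "\<And>w u. w \<in> torus \<Longrightarrow> u \<in> E \<Longrightarrow>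
      N (conv y u - rot w (conv y) u) \<le> L2 * dist_to_1 w * N u"
    using add.IH(2) by blast
  have "N (conv (x + y) u - rot w (conv (x + y)) u) \<le> (L1 + L2) * dist_to_1 w * N u"
    if w: "w \<in> torus" and u: "u \<in> E" for w u
  proof -
    have "rot w (conv (x + y)) u = rot w (conv x) u + rot w (conv y) u"
      by (simp only: rot_def conv_add_left[OF add.hyps] psi_add)
    then have "conv (x + y) u - rot w (conv (x + y)) u =
        (conv x u - rot w (conv x) u) + (conv y u - rot w (conv y) u)"
      by (simp only: conv_add_left[OF add.hyps]) simp
    then have "N (conv (x + y) u - rot w (conv (x + y)) u) \<le>
        N (conv x u - rot w (conv x) u) + N (conv y u - rot w (conv y) u)"
      using add.hyps w u
      by (simp only:) (intro N_triangle diff_mem conv_mem rot_mem[OF bounded_op_conv])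
    also have "\<dots> \<le> (L1 + L2) * dist_to_1 w * N u"
      using L1(2)[OF w u] L2(2)[OF w u] by (simp add: distrib_right)
    finally show ?thesis .
  qed
  then show ?case using L1(1) L2(1) by (intro exI[of _ "L1 + L2"]) auto
qed

text \<open>
  With \<open>Q = conv P\<close> and \<open>w\<close>-rotations written as subscripts, the resolvent identity
  $R_w - R = R_w (Q - Q_w) R$ transfers the Lipschitz bound from \<open>Q\<close> to \<open>R\<close>.
\<close>

lemma rot_inverse_Lipschitz:
  assumes P: "P \<in> finseqs" and R: "bounded_op E N R"
    and inv: "\<And>x. x \<in> E \<Longrightarrow> R (conv P x) = x" "\<And>x. x \<in> E \<Longrightarrow> conv P (R x) = x"
  obtains L where "L \<ge> 0"
    "\<And>w x. w \<in> torus \<Longrightarrow> x \<in> E \<Longrightarrow> N (rot w R x - R x) \<le> L * dist_to_1 w * N x"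
proof -
  obtain C where C: "C \<ge> 0" "\<And>x. x \<in> E \<Longrightarrow> N (R x) \<le> C * N x" using op_boundE[OF R] by blast
  obtain L where L: "L \<ge> 0" "\<And>w y. w \<in> torus \<Longrightarrow> y \<in> E \<Longrightarrow>
      N (conv P y - rot w (conv P) y) \<le> L * dist_to_1 w * N y"
    using rot_conv_Lipschitz[OF P] by blast
  show thesis
  proof (rule that[of "psi_norm\<^sup>2 * C * (L * C)"])
    show "0 \<le> psi_norm\<^sup>2 * C * (L * C)" using C L by simp
    fix w :: "complex ^ 'k" and x assume w: "w \<in> torus" and x: "x \<in> E"
    define S where "S = dist_to_1 w"
    have S: "S \<ge> 0" by (simp add: S_def sum_nonneg)
    have Rx: "R x \<in> E" using op_mem[OF R x] .
    have rotP: "rot w (conv P) (R x) \<in> E" by (rule rot_mem[OF bounded_op_conv[OF P] w Rx])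
    have PRx: "conv P (R x) \<in> E" by (rule conv_mem[OF P Rx])
    have "rot w R (rot w (conv P) (R x)) = R x"
      by (simp add: rot_def psi_psi_vinverse[OF w] inv(1)[OF psi_closed[OF w Rx]] psi_vinverse_psi[OF w])
    moreover have "rot w R (conv P (R x)) = rot w R x" by (simp add: inv(2)[OF x])
    moreover have "rot w R (conv P (R x) - rot w (conv P) (R x)) =
        rot w R (conv P (R x)) - rot w R (rot w (conv P) (R x))"
      using rot_add[OF R w diff_mem[OF PRx rotP] rotP] by simp
    ultimately have "N (rot w R x - R x) = N (rot w R (conv P (R x) - rot w (conv P) (R x)))" by simp
    also have "\<dots> \<le> psi_norm\<^sup>2 * C * N (conv P (R x) - rot w (conv P) (R x))"
      by (rule rot_bound[OF R C(2) C(1) w diff_mem[OF PRx rotP]])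
    also have "\<dots> \<le> psi_norm\<^sup>2 * C * (L * S * (C * N x))"
    proof (rule mult_left_mono)
      have "N (conv P (R x) - rot w (conv P) (R x)) \<le> L * S * N (R x)" unfolding S_def by (rule L(2)[OF w Rx])
      also have "\<dots> \<le> L * S * (C * N x)" using C(2)[OF x] L(1) S by (intro mult_left_mono) auto
      finally show "N (conv P (R x) - rot w (conv P) (R x)) \<le> L * S * (C * N x)" .
    qed (use C in simp)
    finally show "N (rot w R x - R x) \<le> psi_norm\<^sup>2 * C * (L * C) * dist_to_1 w * N x"
      by (simp add: S_def mult_ac)
  qed
qed

text \<open>
  The algebra of convolutions is inverse closed up to norm limits: an inverse whose rotations are
  norm continuous is the norm limit of its Fejer means.
\<close>

lemma inverse_in_closure:
  assumes P: "P \<in> finseqs" and R: "bounded_op E N R"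
    and inv: "\<And>x. x \<in> E \<Longrightarrow> R (conv P x) = x" "\<And>x. x \<in> E \<Longrightarrow> conv P (R x) = x" and e: "e > 0"
  obtains g where "g \<in> finseqs" "\<And>x. x \<in> E \<Longrightarrow> N (conv g x - R x) \<le> e * N x"
proof -
  have Rm: "R \<in> multipliers E N" by (rule multiplier_inverse[OF multiplier_conv_op[OF P] R inv])
  obtain L where L: "L \<ge> 0"
    "\<And>w x. w \<in> torus \<Longrightarrow> x \<in> E \<Longrightarrow> N (rot w R x - R x) \<le> L * dist_to_1 w * N x"
    using rot_inverse_Lipschitz[OF P R inv] by blast
  have "e / (L + 1) > 0" using e L by simp
  then obtain d where d: "d > 0" "\<forall>\<^sub>F m in sequentially. torsion_mean m
     (\<lambda>w :: complex ^ 'k. cmod (laurent (fejer d) w) * dist_to_1 w) \<le> e / (L + 1)"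
    using fejer_concentration[where 'k = 'k] by blast
  define g where "g = (\<lambda>n. fejer d n * R (delta 0) n)"
  show thesis
  proof (rule that[of g])
    show "g \<in> finseqs" unfolding g_def by (intro finseqs_mult fejer_finseqs)
    fix x assume x: "x \<in> E"
    have "N (conv g x - smul (fejer d (0 :: int ^ 'k)) (R x)) \<le> e * N x"
      unfolding g_def
    proof (rule mean_bound[where M = R and p = "fejer d" and T = R and B = e and x = x and
            \<kappa> = "\<lambda>w. L * dist_to_1 w", OF Rm fejer_finseqs R])
      show "\<forall>\<^sub>F m in sequentially. torsion_mean m
          (\<lambda>w :: complex ^ 'k. cmod (laurent (fejer d) w) * (L * dist_to_1 w)) \<le> e"
        using d(2)
      proof eventually_elim
        case (elim m)
        have "torsion_mean m (\<lambda>w :: complex ^ 'k. cmod (laurent (fejer d) w) * (L * dist_to_1 w)) =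
            L * torsion_mean m (\<lambda>w :: complex ^ 'k. cmod (laurent (fejer d) w) * dist_to_1 w)"
          by (simp add: torsion_mean_cmult[symmetric] mult.left_commute)
        also have "\<dots> \<le> L * (e / (L + 1))" using elim L(1) by (rule mult_left_mono)
        also have "\<dots> = L / (L + 1) * e" by simp
        also have "\<dots> \<le> 1 * e" using L(1) e by (intro mult_right_mono) auto
        finally show ?case by simp
      qed
    qed (use e x L(2) in auto)
    moreover have "smul 1 u = u" for u :: "'k seq" by (simp add: pointwise)
    ultimately show "N (conv g x - R x) \<le> e * N x" by (simp add: fejer_0[OF d(1)])
  qed
qed

text \<open>
  If \<open>conv g\<close> approximates the inverse, then \<open>\<phi> = delta 0 - conv P g\<close> acts with norm at most \<open>1 / 2\<close>,
  whereas its Laurent polynomial equals 1 at \<open>z\<close>.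
\<close>

lemma laurent_zero_not_invertible:
  assumes P: "P \<in> finseqs" and z: "z \<in> Z_set E N" and zero: "laurent P z = 0"
  shows "\<not> invertible_op E N (conv P)"
proof
  assume "invertible_op E N (conv P)"
  then obtain R where R: "bounded_op E N R" "\<And>x. x \<in> E \<Longrightarrow> R (conv P x) = x" "\<And>x. x \<in> E \<Longrightarrow> conv P (R x) = x"
    unfolding invertible_op_def by blast
  obtain C where C: "C \<ge> 0" "\<And>x. x \<in> E \<Longrightarrow> N (conv P x) \<le> C * N x"
    using op_boundE[OF bounded_op_conv[OF P]] by blast
  define e where "e = 1 / (2 * (C + 1))"
  have e: "e > 0" using C by (simp add: e_def)
  obtain g where g: "g \<in> finseqs" "\<And>x. x \<in> E \<Longrightarrow> N (conv g x - R x) \<le> e * N x"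
    using inverse_in_closure[OF P R e] by blast
  define \<phi> where "\<phi> = delta 0 - conv P g"
  have \<phi>: "\<phi> \<in> finseqs" unfolding \<phi>_def by (intro finseqs_diff finseqs_delta conv_in_finseqs P g)
  have "laurent \<phi> z = 1"
    using zero Z_set_nonzero[OF z]
    by (simp add: \<phi>_def laurent_diff finseqs_delta conv_in_finseqs P g laurent_conv laurent_delta)
  moreover have "cmod (laurent \<phi> z) \<le> C * e"
  proof (rule Z_set_bound[OF z \<phi>])
    show "0 \<le> C * e" using C e by simp
    fix x assume x: "x \<in> E"
    have Rx: "R x \<in> E" using op_mem[OF R(1) x] .
    have gx: "conv g x \<in> E" by (rule conv_mem[OF g(1) x])
    have "conv \<phi> x = x - conv P (conv g x)"
      unfolding \<phi>_def conv_diff_left[OF finseqs_delta conv_in_finseqs[OF P g(1)]]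
      by (simp add: conv_delta_left conv_assoc[OF P g(1)])
    also have "\<dots> = conv P (R x - conv g x)"
      using R(3)[OF x] op_diff[OF bounded_op_conv[OF P] Rx gx] by simp
    finally have "N (conv \<phi> x) = N (conv P (R x - conv g x))" by simp
    also have "\<dots> \<le> C * N (R x - conv g x)" by (rule C(2)[OF diff_mem[OF Rx gx]])
    also have "\<dots> \<le> C * (e * N x)"
      using g(2)[OF x] N_diff_commute[OF Rx gx] C(1) by (intro mult_left_mono) auto
    finally show "N (conv \<phi> x) \<le> C * e * N x" by simp
  qed
  moreover have "C * e < 1" using C by (simp add: e_def field_simps)
  ultimately show False by simp
qed

lemma op_norm_approx_nonneg:
  assumes "bounded_op E N M" "\<phi> \<in> finseqs"
  shows "0 \<le> op_norm E N (M - conv \<phi>)"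
  using op_norm_nonneg[OF bounded_op_diff[OF assms(1) bounded_op_conv[OF assms(2)]]]
  by (simp add: fun_diff_def)

lemma op_norm_approx_bound:
  assumes "bounded_op E N M" "\<phi> \<in> finseqs" "x \<in> E"
  shows "N (M x - conv \<phi> x) \<le> op_norm E N (M - conv \<phi>) * N x"
  using norm_le_op_norm[OF bounded_op_diff[OF assms(1) bounded_op_conv[OF assms(2)]] assms(3)]
  by (simp add: fun_diff_def)

text \<open>
  The generated algebra consists of convolutions only, so approximation by its elements is
  approximation by convolutions.
\<close>

lemma closed_conv_algebra_approx:
  assumes M: "M \<in> closed_conv_algebra E N"
  obtains \<phi> where "\<And>m. \<phi> m \<in> finseqs" "(\<lambda>m. op_norm E N (M - conv (\<phi> m))) \<longlonglongrightarrow> 0"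
proof -
  have Mb: "bounded_op E N M" using M by (simp add: closed_conv_algebra_def)
  have "\<exists>\<phi>. \<phi> \<in> finseqs \<and> op_norm E N (M - conv \<phi>) < 1 / Suc m" for m
  proof -
    have "\<forall>e>0. \<exists>A\<in>conv_algebra. op_norm E N (M - A) < e"
      using M by (simp add: closed_conv_algebra_def)
    from this[rule_format, of "1 / Suc m"]
    obtain A where "A \<in> conv_algebra" "op_norm E N (M - A) < 1 / Suc m" by auto
    then show ?thesis using conv_algebra_eq_conv by blast
  qed
  then obtain \<phi> where \<phi>: "\<And>m. \<phi> m \<in> finseqs" "\<And>m. op_norm E N (M - conv (\<phi> m)) < 1 / Suc m"
    by metis
  show thesis
  proof (rule that[OF \<phi>(1)])
    show "(\<lambda>m. op_norm E N (M - conv (\<phi> m))) \<longlonglongrightarrow> 0"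
      by (rule tendsto_sandwich[OF _ _ tendsto_const LIMSEQ_inverse_real_of_nat])
         (use op_norm_approx_nonneg[OF Mb \<phi>(1)] \<phi>(2) in \<open>auto simp: inverse_eq_divide less_imp_le intro!: always_eventually\<close>)
  qed
qed

lemma closed_conv_algebra_multiplier:
  assumes M: "M \<in> closed_conv_algebra E N"
  shows "M \<in> multipliers E N"
proof (rule multipliersI)
  show Mb: "bounded_op E N M" using M by (simp add: closed_conv_algebra_def)
  fix i x assume x: "x \<in> E"
  obtain \<phi> where \<phi>: "\<And>m. \<phi> m \<in> finseqs" "(\<lambda>m. op_norm E N (M - conv (\<phi> m))) \<longlonglongrightarrow> 0"
    using closed_conv_algebra_approx[OF M] by blast
  define a where "a m = op_norm E N (M - conv (\<phi> m))" for m
  let ?t = "translation (axis i 1) :: 'k seq \<Rightarrow> 'k seq"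
  obtain C where C: "C \<ge> 0" "\<And>x. x \<in> E \<Longrightarrow> N (?t x) \<le> C * N x"
    using op_boundE[OF bounded_op_translation[of "axis i 1"]] by blast
  have tx: "?t x \<in> E" by (rule translation_mem[OF x])
  have mem: "M (?t x) \<in> E" "?t (M x) \<in> E"
    using op_mem[OF Mb tx] translation_mem[OF op_mem[OF Mb x]] by auto
  have "N (M (?t x) - ?t (M x)) \<le> a m * N (?t x) + C * (a m * N x)" for m
  proof -
    have c: "conv (\<phi> m) (?t x) \<in> E" "conv (\<phi> m) x \<in> E" using conv_mem[OF \<phi>(1)] tx x by auto
    have Mc: "M x - conv (\<phi> m) x \<in> E" using diff_mem[OF op_mem[OF Mb x] c(2)] .
    have eq: "M (?t x) - ?t (M x) = (M (?t x) - conv (\<phi> m) (?t x)) - ?t (M x - conv (\<phi> m) x)"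
      by (simp add: conv_translation_right translation_diff)
    have "N (M (?t x) - ?t (M x)) \<le>
        N (M (?t x) - conv (\<phi> m) (?t x)) + N (?t (M x - conv (\<phi> m) x))"
      unfolding eq by (rule N_triangle_diff[OF diff_mem[OF mem(1) c(1)] translation_mem[OF Mc]])
    also have "\<dots> \<le> a m * N (?t x) + C * (a m * N x)"
    proof (rule add_mono)
      show "N (M (?t x) - conv (\<phi> m) (?t x)) \<le> a m * N (?t x)"
        unfolding a_def by (rule op_norm_approx_bound[OF Mb \<phi>(1) tx])
      have "N (?t (M x - conv (\<phi> m) x)) \<le> C * N (M x - conv (\<phi> m) x)" by (rule C(2)[OF Mc])
      also have "\<dots> \<le> C * (a m * N x)"
        unfolding a_def by (intro mult_left_mono op_norm_approx_bound Mb \<phi>(1) x C(1))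
      finally show "N (?t (M x - conv (\<phi> m) x)) \<le> C * (a m * N x)" .
    qed
    finally show ?thesis .
  qed
  moreover have "(\<lambda>m. a m * N (?t x) + C * (a m * N x)) \<longlonglongrightarrow> 0 * N (?t x) + C * (0 * N x)"
    unfolding a_def by (intro tendsto_intros \<phi>(2))
  ultimately have "N (M (?t x) - ?t (M x)) \<le> 0 * N (?t x) + C * (0 * N x)"
    by (intro tendsto_lowerbound[where F = sequentially and f = "\<lambda>m. a m * N (?t x) + C * (a m * N x)"]) auto
  then have "N (M (?t x) - ?t (M x)) = 0" using N_nonneg[OF diff_mem[OF mem]] by simp
  then show "M (?t x) = ?t (M x)" using N_eq_0[OF diff_mem[OF mem]] by simp
qed

text \<open>
  The choice operator in \<^const>\<open>ext_symbol\<close> has a witness: on \<^const>\<open>Z_set\<close> an approximating sequence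
  of Laurent polynomials is uniformly Cauchy, as differences are bounded by the operator norm.
\<close>

lemma ext_symbol_uniform_limit:
  assumes M: "M \<in> closed_conv_algebra E N"
  obtains \<phi> where "\<And>m. \<phi> m \<in> finseqs" "(\<lambda>m. op_norm E N (M - conv (\<phi> m))) \<longlonglongrightarrow> 0"
    "uniform_limit (Z_set E N) (\<lambda>m. laurent (\<phi> m)) (ext_symbol E N M) sequentially"
proof -
  have Mb: "bounded_op E N M" using M by (simp add: closed_conv_algebra_def)
  obtain \<phi> where \<phi>: "\<And>m. \<phi> m \<in> finseqs" "(\<lambda>m. op_norm E N (M - conv (\<phi> m))) \<longlonglongrightarrow> 0"
    using closed_conv_algebra_approx[OF M] by blast
  define a where "a m = op_norm E N (M - conv (\<phi> m))" for m
  have a0: "a m \<ge> 0" for m unfolding a_def by (rule op_norm_approx_nonneg[OF Mb \<phi>(1)])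
  have close: "cmod (laurent (\<phi> m) z - laurent (\<phi> l) z) \<le> a m + a l" if z: "z \<in> Z_set E N" for m l z
  proof -
    have "cmod (laurent (\<phi> m - \<phi> l) z) \<le> a m + a l"
    proof (rule Z_set_bound[OF z finseqs_diff[OF \<phi>(1) \<phi>(1)]])
      show "0 \<le> a m + a l" using a0 by (intro add_nonneg_nonneg)
      fix x assume x: "x \<in> E"
      have mem: "M x \<in> E" "conv (\<phi> m) x \<in> E" "conv (\<phi> l) x \<in> E"
        using op_mem[OF Mb x] conv_mem[OF \<phi>(1) x] by auto
      have "conv (\<phi> m - \<phi> l) x = (M x - conv (\<phi> l) x) - (M x - conv (\<phi> m) x)"
        by (simp only: conv_diff_left[OF \<phi>(1) \<phi>(1)]) simp
      then have "N (conv (\<phi> m - \<phi> l) x) \<le> N (M x - conv (\<phi> l) x) + N (M x - conv (\<phi> m) x)"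
        using N_triangle_diff[OF diff_mem[OF mem(1,3)] diff_mem[OF mem(1,2)]] by simp
      also have "\<dots> \<le> a l * N x + a m * N x"
        unfolding a_def by (intro add_mono op_norm_approx_bound Mb \<phi>(1) x)
      finally show "N (conv (\<phi> m - \<phi> l) x) \<le> (a m + a l) * N x" by (simp add: algebra_simps)
    qed
    then show ?thesis by (simp add: laurent_diff \<phi>(1))
  qed
  have "uniformly_Cauchy_on (Z_set E N) (\<lambda>m. laurent (\<phi> m))"
    unfolding uniformly_Cauchy_on_def
  proof (intro allI impI)
    fix e :: real assume "e > 0"
    then obtain K where K: "\<And>m. m \<ge> K \<Longrightarrow> a m < e / 2"
      using order_tendstoD(2)[OF \<phi>(2), of "e / 2"] unfolding eventually_sequentially a_def by auto
    have "dist (laurent (\<phi> m) z) (laurent (\<phi> l) z) < e"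
      if "z \<in> Z_set E N" "m \<ge> K" "l \<ge> K" for z m l
      using close[OF that(1), of m l] K[OF that(2)] K[OF that(3)] by (simp add: dist_norm)
    then show "\<exists>K. \<forall>z\<in>Z_set E N. \<forall>m\<ge>K. \<forall>l\<ge>K. dist (laurent (\<phi> m) z) (laurent (\<phi> l) z) < e" by blast
  qed
  then obtain f where "uniform_limit (Z_set E N) (\<lambda>m. laurent (\<phi> m)) f sequentially"
    using Cauchy_uniformly_convergent unfolding uniformly_convergent_on_def by blast
  with \<phi> have "\<exists>f \<phi>. (\<forall>m. \<phi> m \<in> finseqs) \<and> (\<lambda>m. op_norm E N (M - conv (\<phi> m))) \<longlonglongrightarrow> 0 \<and>
      uniform_limit (Z_set E N) (\<lambda>m. laurent (\<phi> m)) f sequentially" by blast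
  from someI_ex[OF this] show thesis
    unfolding ext_symbol_def[symmetric] using that by blast
qed

lemma ext_symbol_in_spectrum:
  assumes M: "M \<in> closed_conv_algebra E N" and z: "z \<in> Z_set E N"
  shows "ext_symbol E N M z \<in> op_spectrum E N M"
proof (rule ccontr)
  define c where "c = ext_symbol E N M z"
  assume "ext_symbol E N M z \<notin> op_spectrum E N M"
  then have inv: "invertible_op E N (\<lambda>x. M x - smul c x)" by (simp add: op_spectrum_iff c_def)
  have Mb: "bounded_op E N M" using M by (simp add: closed_conv_algebra_def)
  have Qb: "bounded_op E N (\<lambda>x. M x - smul c x)"
    by (rule bounded_op_diff[OF Mb bounded_op_smul[OF bounded_op_id]])
  obtain \<phi> where \<phi>: "\<And>m. \<phi> m \<in> finseqs" "(\<lambda>m. op_norm E N (M - conv (\<phi> m))) \<longlonglongrightarrow> 0"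
    "uniform_limit (Z_set E N) (\<lambda>m. laurent (\<phi> m)) (ext_symbol E N M) sequentially"
    using ext_symbol_uniform_limit[OF M] by blast
  have lim: "(\<lambda>m. laurent (\<phi> m) z) \<longlonglongrightarrow> c"
    unfolding c_def by (rule tendsto_uniform_limitI[OF \<phi>(3) z])
  obtain \<eta> where \<eta>: "\<eta> > 0" "\<And>T'. bounded_op E N T' \<Longrightarrow>
      (\<And>x. x \<in> E \<Longrightarrow> N (T' x - (M x - smul c x)) \<le> \<eta> * N x) \<Longrightarrow> invertible_op E N T'"
    using invertible_open[OF Qb inv] by blast
  have "\<forall>\<^sub>F m in sequentially. op_norm E N (M - conv (\<phi> m)) < \<eta> / 2 \<and> dist (laurent (\<phi> m) z) c < \<eta> / 2"
    using order_tendstoD(2)[OF \<phi>(2), of "\<eta> / 2"] tendstoD[OF lim, of "\<eta> / 2"] \<eta>(1)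
    by (simp add: eventually_conj)
  then obtain m where m: "op_norm E N (M - conv (\<phi> m)) < \<eta> / 2" "dist (laurent (\<phi> m) z) c < \<eta> / 2"
    using eventually_happens'[OF sequentially_bot] by blast
  define l where "l = laurent (\<phi> m) z"
  define P where "P = \<phi> m - smul l (delta 0)"
  have P: "P \<in> finseqs" unfolding P_def by (intro finseqs_diff finseqs_smul finseqs_delta \<phi>)
  have "laurent P z = 0"
    by (simp add: P_def laurent_diff \<phi>(1) finseqs_smul finseqs_delta laurent_smul laurent_delta l_def)
  moreover have "invertible_op E N (conv P)"
  proof (rule \<eta>(2)[OF bounded_op_conv[OF P]])
    fix x assume x: "x \<in> E"
    have mem: "M x \<in> E" "conv (\<phi> m) x \<in> E" using op_mem[OF Mb x] conv_mem[OF \<phi>(1) x] by auto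
    have "conv P x = conv (\<phi> m) x - smul l x"
      unfolding P_def
      by (simp only: conv_diff_left[OF \<phi>(1) finseqs_smul[OF finseqs_delta]] conv_smul_left conv_delta_left translation_0)
    then have eq: "conv P x - (M x - smul c x) = smul (c - l) x - (M x - conv (\<phi> m) x)"
      by (simp add: pointwise algebra_simps)
    have "N (conv P x - (M x - smul c x)) \<le> N (smul (c - l) x) + N (M x - conv (\<phi> m) x)"
      unfolding eq by (rule N_triangle_diff[OF smul_mem[OF x] diff_mem[OF mem]])
    also have "\<dots> \<le> \<eta> / 2 * N x + \<eta> / 2 * N x"
    proof (rule add_mono)
      show "N (smul (c - l) x) \<le> \<eta> / 2 * N x"
        unfolding N_smul[OF x] using m(2) N_nonneg[OF x]
        by (intro mult_right_mono) (simp_all add: l_def dist_norm norm_minus_commute)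
      have "N (M x - conv (\<phi> m) x) \<le> op_norm E N (M - conv (\<phi> m)) * N x"
        by (rule op_norm_approx_bound[OF Mb \<phi>(1) x])
      also have "\<dots> \<le> \<eta> / 2 * N x" using m(1) N_nonneg[OF x] by (intro mult_right_mono) auto
      finally show "N (M x - conv (\<phi> m) x) \<le> \<eta> / 2 * N x" .
    qed
    finally show "N (conv P x - (M x - smul c x)) \<le> \<eta> * N x" by simp
  qed
  ultimately show False using laurent_zero_not_invertible[OF P z] by blast
qed

section \<open>Characters from operators that are not invertible\<close>

lemma op_norm_add_le:
  assumes "bounded_op E N S" "bounded_op E N T"
  shows "op_norm E N (\<lambda>x. S x + T x) \<le> op_norm E N S + op_norm E N T"
proof (rule op_norm_leI)
  show "0 \<le> op_norm E N S + op_norm E N T" using op_norm_nonneg assms by (intro add_nonneg_nonneg)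
  fix x assume x: "x \<in> E"
  have "N (S x + T x) \<le> N (S x) + N (T x)"
    by (rule N_triangle[OF op_mem[OF assms(1) x] op_mem[OF assms(2) x]])
  then show "N (S x + T x) \<le> (op_norm E N S + op_norm E N T) * N x"
    using norm_le_op_norm[OF assms(1) x] norm_le_op_norm[OF assms(2) x] by (simp add: algebra_simps)
qed

lemma op_norm_comp_le:
  assumes "bounded_op E N S" "bounded_op E N T"
  shows "op_norm E N (\<lambda>x. S (T x)) \<le> op_norm E N S * op_norm E N T"
proof (rule op_norm_leI)
  show "0 \<le> op_norm E N S * op_norm E N T" using op_norm_nonneg assms by (intro mult_nonneg_nonneg)
  fix x assume x: "x \<in> E"
  have "N (S (T x)) \<le> op_norm E N S * N (T x)" by (rule norm_le_op_norm[OF assms(1) op_mem[OF assms(2) x]])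
  also have "\<dots> \<le> op_norm E N S * (op_norm E N T * N x)"
    by (rule mult_left_mono[OF norm_le_op_norm[OF assms(2) x] op_norm_nonneg[OF assms(1)]])
  finally show "N (S (T x)) \<le> op_norm E N S * op_norm E N T * N x" by (simp add: mult.assoc)
qed

lemma op_norm_smul_le:
  assumes "bounded_op E N T"
  shows "op_norm E N (\<lambda>x. smul c (T x)) \<le> cmod c * op_norm E N T"
proof (rule op_norm_leI)
  show "0 \<le> cmod c * op_norm E N T" using op_norm_nonneg[OF assms] by simp
  fix x assume x: "x \<in> E"
  show "N (smul c (T x)) \<le> cmod c * op_norm E N T * N x"
    using mult_left_mono[OF norm_le_op_norm[OF assms x], of "cmod c"]
    by (simp add: N_smul[OF op_mem[OF assms x]] mult.assoc)
qed

lemma op_norm_cong: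
  assumes "\<And>x. x \<in> E \<Longrightarrow> S x = T x"
  shows "op_norm E N S = op_norm E N T"
  unfolding op_norm_def using assms by (intro SUP_cong) auto

text \<open>
  Operators commuting with \<open>Q\<close> alone, not with everything: they are closed under the products that
  occur below, and a one-sided inverse of \<open>Q\<close> among them is two-sided.
\<close>

definition commutant :: "('k seq \<Rightarrow> 'k seq) \<Rightarrow> ('k seq \<Rightarrow> 'k seq) set" where
  "commutant Q = {Y. bounded_op E N Y \<and> (\<forall>x\<in>E. Y (Q x) = Q (Y x))}"

text \<open>
  The distance of \<open>conv (coeffs \<phi>)\<close> from the multiples of \<open>Q\<close> by operators commuting with \<open>Q\<close>.
\<close>

definition ideal_seminorm :: "('k seq \<Rightarrow> 'k seq) \<Rightarrow> (int ^ 'k \<Rightarrow>\<^sub>0 complex) \<Rightarrow> real" where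
  "ideal_seminorm Q \<phi> = (INF Y\<in>commutant Q. op_norm E N (\<lambda>x. conv (coeffs \<phi>) x + Q (Y x)))"

context
  fixes Q assumes Q: "Q \<in> multipliers E N"
begin

lemma Q_bounded: "bounded_op E N Q" using multiplier_bounded[OF Q] .

lemma commutantD:
  assumes "Y \<in> commutant Q"
  shows "bounded_op E N Y" "x \<in> E \<Longrightarrow> Y (Q x) = Q (Y x)"
  using assms by (auto simp: commutant_def)

lemma representative_bounded:
  assumes "Y \<in> commutant Q"
  shows "bounded_op E N (\<lambda>x. conv (coeffs \<phi>) x + Q (Y x))"
  by (rule bounded_op_add[OF bounded_op_conv[OF coeffs_finseqs] bounded_op_comp[OF Q_bounded commutantD(1)[OF assms]]])

lemma ideal_seminorm_le:
  assumes "Y \<in> commutant Q"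
  shows "ideal_seminorm Q \<phi> \<le> op_norm E N (\<lambda>x. conv (coeffs \<phi>) x + Q (Y x))"
  unfolding ideal_seminorm_def
  by (rule cINF_lower[OF _ assms]) (auto intro!: bdd_belowI[of _ 0] op_norm_nonneg representative_bounded)

lemma zero_in_commutant: "(\<lambda>x. 0) \<in> commutant Q"
  by (simp add: commutant_def bounded_op_zero op_0[OF Q_bounded])

lemma commutant_add:
  assumes "Y \<in> commutant Q" "Y' \<in> commutant Q"
  shows "(\<lambda>x. Y x + Y' x) \<in> commutant Q"
  unfolding commutant_def
  using bounded_op_add[OF commutantD(1)[OF assms(1)] commutantD(1)[OF assms(2)]]
    op_add[OF Q_bounded op_mem[OF commutantD(1)[OF assms(1)]] op_mem[OF commutantD(1)[OF assms(2)]]]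
    commutantD(2)[OF assms(1)] commutantD(2)[OF assms(2)] by simp

lemma commutant_smul:
  assumes "Y \<in> commutant Q"
  shows "(\<lambda>x. smul c (Y x)) \<in> commutant Q"
  unfolding commutant_def
  using bounded_op_smul[OF commutantD(1)[OF assms]]
    op_smul[OF Q_bounded op_mem[OF commutantD(1)[OF assms]]] commutantD(2)[OF assms] by simp

lemma commutant_comp:
  assumes "Y \<in> commutant Q" "Y' \<in> commutant Q"
  shows "(\<lambda>x. Y (Y' x)) \<in> commutant Q"
  unfolding commutant_def
  using bounded_op_comp[OF commutantD(1)[OF assms(1)] commutantD(1)[OF assms(2)]]
    commutantD(2)[OF assms(1) op_mem[OF commutantD(1)[OF assms(2)]]] commutantD(2)[OF assms(2)] by simp

lemma conv_in_commutant: "\<phi> \<in> finseqs \<Longrightarrow> conv \<phi> \<in> commutant Q"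
  by (simp add: commutant_def bounded_op_conv multiplier_conv[OF Q])

lemma self_in_commutant: "Q \<in> commutant Q"
  by (simp add: commutant_def Q_bounded)

text \<open>
  Submultiplicativity: the product of \<open>F + Q Y\<close> and \<open>G + Q Y'\<close> is \<open>F G + Q Z\<close> with
  \<open>Z = F Y' + Y G + Y Q Y'\<close>, as convolutions and \<open>Y\<close> commute with \<open>Q\<close>.  The value at 1 is at least 1
  because \<open>1 + Q Y\<close> of norm less than 1 would make \<open>- Q Y\<close>, and hence \<open>Q\<close>, invertible.
\<close>

lemma scalar_seminorm_ideal:
  assumes not_inv: "\<not> invertible_op E N Q"
  shows "scalar_seminorm (const) (ideal_seminorm Q)"
proof
  fix a b :: complex
  show "const (a + b) = const a + const b"
    by (rule single_add)
  show "const (a * b) = const a * const b"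
    by (simp add: mult_single)
  show "const 1 = 1" by simp
next
  fix \<phi> \<psi> :: "int ^ 'k \<Rightarrow>\<^sub>0 complex"
  have nonempty: "commutant Q \<noteq> {}" using zero_in_commutant by blast
  define F G where "F = conv (coeffs \<phi>)" and "G = conv (coeffs \<psi>)"
  have F: "F \<in> commutant Q" and G: "G \<in> commutant Q"
    unfolding F_def G_def by (intro conv_in_commutant coeffs_finseqs)+
  show "ideal_seminorm Q (\<phi> + \<psi>) \<le> ideal_seminorm Q \<phi> + ideal_seminorm Q \<psi>"
    unfolding ideal_seminorm_def[of Q \<phi>] ideal_seminorm_def[of Q \<psi>] F_def[symmetric] G_def[symmetric]
  proof (rule le_add_INF[OF nonempty nonempty])
    fix Y Y' assume Y: "Y \<in> commutant Q" and Y': "Y' \<in> commutant Q"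
    have "ideal_seminorm Q (\<phi> + \<psi>) \<le>
        op_norm E N (\<lambda>x. conv (coeffs (\<phi> + \<psi>)) x + Q (Y x + Y' x))"
      by (rule ideal_seminorm_le[OF commutant_add[OF Y Y']])
    also have "\<dots> = op_norm E N (\<lambda>x. (F x + Q (Y x)) + (G x + Q (Y' x)))"
    proof (rule op_norm_cong)
      fix x assume x: "x \<in> E"
      have "Q (Y x + Y' x) = Q (Y x) + Q (Y' x)"
        by (rule op_add[OF Q_bounded op_mem[OF commutantD(1)[OF Y] x] op_mem[OF commutantD(1)[OF Y'] x]])
      then show "conv (coeffs (\<phi> + \<psi>)) x + Q (Y x + Y' x) = (F x + Q (Y x)) + (G x + Q (Y' x))"
        by (simp only: F_def G_def coeffs_add conv_add_left[OF coeffs_finseqs coeffs_finseqs]) (simp add: add_ac)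
    qed
    also have "\<dots> \<le> op_norm E N (\<lambda>x. F x + Q (Y x)) + op_norm E N (\<lambda>x. G x + Q (Y' x))"
      unfolding F_def G_def by (rule op_norm_add_le[OF representative_bounded[OF Y] representative_bounded[OF Y']])
    finally show "ideal_seminorm Q (\<phi> + \<psi>) \<le>
        op_norm E N (\<lambda>x. F x + Q (Y x)) + op_norm E N (\<lambda>x. G x + Q (Y' x))" .
  qed
  show "ideal_seminorm Q (\<phi> * \<psi>) \<le> ideal_seminorm Q \<phi> * ideal_seminorm Q \<psi>"
    unfolding ideal_seminorm_def[of Q \<phi>] ideal_seminorm_def[of Q \<psi>] F_def[symmetric] G_def[symmetric]
  proof (rule le_mult_INF[OF nonempty nonempty])
    show "0 \<le> op_norm E N (\<lambda>x. F x + Q (Y x))" "0 \<le> op_norm E N (\<lambda>x. G x + Q (Y x))"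
      if "Y \<in> commutant Q" for Y
      unfolding F_def G_def by (rule op_norm_nonneg[OF representative_bounded[OF that]])+
    fix Y Y' assume Y: "Y \<in> commutant Q" and Y': "Y' \<in> commutant Q"
    define Z where "Z = (\<lambda>x. (F (Y' x) + Y (G x)) + Y (Q (Y' x)))"
    have Z: "Z \<in> commutant Q"
      unfolding Z_def
      by (rule commutant_add[OF commutant_add[OF commutant_comp[OF F Y'] commutant_comp[OF Y G]]
            commutant_comp[OF Y commutant_comp[OF self_in_commutant Y']]])
    have "ideal_seminorm Q (\<phi> * \<psi>) \<le> op_norm E N (\<lambda>x. conv (coeffs (\<phi> * \<psi>)) x + Q (Z x))"
      by (rule ideal_seminorm_le[OF Z])
    also have "\<dots> = op_norm E N (\<lambda>x. F (G x + Q (Y' x)) + Q (Y (G x + Q (Y' x))))"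
    proof (rule op_norm_cong)
      fix x assume x: "x \<in> E"
      note Fb = commutantD(1)[OF F] and Gb = commutantD(1)[OF G] and Yb = commutantD(1)[OF Y]
        and Yb' = commutantD(1)[OF Y']
      have Gx: "G x \<in> E" by (rule op_mem[OF Gb x])
      have Y'x: "Y' x \<in> E" by (rule op_mem[OF Yb' x])
      have QY'x: "Q (Y' x) \<in> E" by (rule op_mem[OF Q_bounded Y'x])
      have mem: "F (Y' x) \<in> E" "Y (G x) \<in> E" "Y (Q (Y' x)) \<in> E" "F (Y' x) + Y (G x) \<in> E"
        using op_mem[OF Fb Y'x] op_mem[OF Yb Gx] op_mem[OF Yb QY'x] add_mem by auto
      have "Q (Z x) = Q (F (Y' x)) + Q (Y (G x)) + Q (Y (Q (Y' x)))"
        by (simp only: Z_def op_add[OF Q_bounded mem(4,3)] op_add[OF Q_bounded mem(1,2)])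
      moreover have "F (G x + Q (Y' x)) = F (G x) + Q (F (Y' x))"
        by (simp only: op_add[OF Fb Gx QY'x] commutantD(2)[OF F Y'x])
      moreover have "Q (Y (G x + Q (Y' x))) = Q (Y (G x)) + Q (Y (Q (Y' x)))"
        by (simp only: op_add[OF Yb Gx QY'x] op_add[OF Q_bounded mem(2,3)])
      moreover have "conv (coeffs (\<phi> * \<psi>)) x = F (G x)"
        by (simp only: F_def G_def coeffs_mult conv_assoc[OF coeffs_finseqs coeffs_finseqs])
      ultimately show "conv (coeffs (\<phi> * \<psi>)) x + Q (Z x) =
          F (G x + Q (Y' x)) + Q (Y (G x + Q (Y' x)))"
        by (simp only:) (simp add: add_ac)
    qed
    also have "\<dots> \<le> op_norm E N (\<lambda>x. F x + Q (Y x)) * op_norm E N (\<lambda>x. G x + Q (Y' x))"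
      using op_norm_comp_le[OF representative_bounded[OF Y] representative_bounded[OF Y']]
      unfolding F_def G_def .
    finally show "ideal_seminorm Q (\<phi> * \<psi>) \<le>
        op_norm E N (\<lambda>x. F x + Q (Y x)) * op_norm E N (\<lambda>x. G x + Q (Y' x))" .
  qed
  fix c
  show "ideal_seminorm Q (const c * \<phi>) \<le> cmod c * ideal_seminorm Q \<phi>"
    unfolding ideal_seminorm_def[of Q \<phi>] F_def[symmetric]
  proof (rule le_cmult_INF[OF nonempty norm_ge_zero])
    fix Y assume Y: "Y \<in> commutant Q"
    have "ideal_seminorm Q (const c * \<phi>) \<le>
        op_norm E N (\<lambda>x. conv (coeffs (const c * \<phi>)) x + Q (smul c (Y x)))"
      by (rule ideal_seminorm_le[OF commutant_smul[OF Y]])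
    also have "\<dots> = op_norm E N (\<lambda>x. smul c (F x + Q (Y x)))"
    proof (rule op_norm_cong)
      fix x assume x: "x \<in> E"
      have "conv (coeffs (const c * \<phi>)) x = smul c (F x)"
        by (simp only: F_def coeffs_mult coeffs_single conv_smul_left conv_delta_left translation_0)
      moreover have "Q (smul c (Y x)) = smul c (Q (Y x))"
        by (rule op_smul[OF Q_bounded op_mem[OF commutantD(1)[OF Y] x]])
      ultimately show "conv (coeffs (const c * \<phi>)) x + Q (smul c (Y x)) =
          smul c (F x + Q (Y x))"
        by (simp only:) (simp add: pointwise algebra_simps)
    qed
    also have "\<dots> \<le> cmod c * op_norm E N (\<lambda>x. F x + Q (Y x))"
      unfolding F_def by (rule op_norm_smul_le[OF representative_bounded[OF Y]])
    finally show "ideal_seminorm Q (const c * \<phi>) \<le> cmod c * op_norm E N (\<lambda>x. F x + Q (Y x))" .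
  qed
next
  show "1 \<le> ideal_seminorm Q 1"
    unfolding ideal_seminorm_def
  proof (rule cINF_greatest)
    show "commutant Q \<noteq> {}" using zero_in_commutant by blast
    fix Y assume Y: "Y \<in> commutant Q"
    note Yb = commutantD(1)[OF Y]
    define A where "A = (\<lambda>x. conv (coeffs 1) x + Q (Y x))"
    have A: "bounded_op E N A" unfolding A_def by (rule representative_bounded[OF Y])
    have A_eq: "A x = x + Q (Y x)" for x
    proof -
      have "smul 1 u = u" for u :: "'k seq" by (simp add: pointwise)
      then have "coeffs 1 = (delta 0 :: 'k seq)"
        using coeffs_single[of "0 :: int ^ 'k" 1] by simp
      then show ?thesis by (simp add: A_def conv_delta_left)
    qed
    show "1 \<le> op_norm E N (\<lambda>x. conv (coeffs 1) x + Q (Y x))"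
    proof (rule ccontr)
      assume "\<not> ?thesis"
      then have less: "op_norm E N A < 1" by (simp add: A_def)
      define T where "T = (\<lambda>x. x - A x)"
      have T_bdd: "bounded_op E N T" unfolding T_def by (rule bounded_op_diff[OF bounded_op_id A])
      have "invertible_op E N T"
      proof (rule invertible_near_identity[OF T_bdd less])
        fix x assume x: "x \<in> E"
        have "x - T x = A x" by (simp add: T_def)
        then show "N (x - T x) \<le> op_norm E N A * N x" using norm_le_op_norm[OF A x] by simp
      qed
      then obtain V where V: "bounded_op E N V" "\<And>x. x \<in> E \<Longrightarrow> V (T x) = x" "\<And>x. x \<in> E \<Longrightarrow> T (V x) = x"
        unfolding invertible_op_def by blast
      have T_eq: "T x = smul (-1) (Q (Y x))" for x by (simp add: T_def A_eq pointwise)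
      \<comment> \<open>\<open>T = - Q Y = - Y Q\<close> is invertible, so \<open>Q\<close> has a right inverse and a left inverse.\<close>
      define R where "R = (\<lambda>x. smul (-1) (Y (V x)))"
      define L where "L = (\<lambda>x. V (smul (-1) (Y x)))"
      have R: "bounded_op E N R" unfolding R_def by (rule bounded_op_smul[OF bounded_op_comp[OF Yb V(1)]])
      have right: "Q (R x) = x" if x: "x \<in> E" for x
        using V(3)[OF x] op_smul[OF Q_bounded op_mem[OF Yb op_mem[OF V(1) x]], of "-1"]
        by (simp add: R_def T_eq)
      have left: "L (Q x) = x" if x: "x \<in> E" for x
        using V(2)[OF x] commutantD(2)[OF Y x] by (simp add: L_def T_eq)
      have "R (Q x) = x" if x: "x \<in> E" for x
      proof -
        have Qx: "Q x \<in> E" by (rule op_mem[OF Q_bounded x])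
        have "R (Q x) = L (Q (R (Q x)))" by (rule left[OF op_mem[OF R Qx], symmetric])
        also have "\<dots> = x" by (simp only: right[OF Qx] left[OF x])
        finally show ?thesis .
      qed
      then have "invertible_op E N Q" unfolding invertible_op_def using R right by blast
      then show False using not_inv by blast
    qed
  qed
qed

end

text \<open>
  Modulo the null ideal of the seminorm obtained from \<open>simultaneous_eigenvalues\<close>, every generator is a
  scalar \<open>z $ i\<close>, nonzero since generators are units.  Hence every \<open>\<phi>\<close> is congruent to its value at \<open>z\<close>,
  and \<open>1 \<le> q 1\<close> bounds that value.
\<close>

lemma character_exists:
  assumes sn: "scalar_seminorm (const) (q :: (int ^ 'k \<Rightarrow>\<^sub>0 complex) \<Rightarrow> real)"
  obtains z :: "complex ^ 'k" where "\<forall>i. z $ i \<noteq> 0"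
    "\<And>\<phi>. cmod (laurent (coeffs \<phi>) z) \<le> q \<phi>"
proof -
  define X where "X n = Poly_Mapping.single n (1 :: complex)" for n :: "int ^ 'k"
  have X_add: "X (n + m) = X n * X m" for n m by (simp add: X_def mult_single)
  have X_0: "X 0 = 1" by (simp add: X_def)
  define A where "A = range (\<lambda>i :: 'k. X (axis i 1))"
  obtain q' c where q': "scalar_seminorm (const) q'" "\<And>\<phi>. q' \<phi> \<le> q \<phi>"
      "\<And>a. a \<in> A \<Longrightarrow> q' (a - const (c a)) = 0"
    using simultaneous_eigenvalues[of A, OF _ sn] by (auto simp: A_def)
  interpret q': scalar_seminorm "const" q' by (rule q'(1))
  define s where "s = (const :: complex \<Rightarrow> int ^ 'k \<Rightarrow>\<^sub>0 complex)"
  define z where "z = (\<chi> i. c (X (axis i 1)))"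
  have null_mult: "q' (a * b) = 0" if "q' a = 0" for a b
    using q'.q_mult[of a b] q'.q_nonneg[of "a * b"] that by simp
  have null_add: "q' (a + b) = 0" if "q' a = 0" "q' b = 0" for a b
    using q'.q_add[of a b] q'.q_nonneg[of "a + b"] that by simp
  have null_diff: "q' (a - b) = 0" if "q' a = 0" "q' b = 0" for a b
    using q'.q_diff[of a b] q'.q_nonneg[of "a - b"] that by simp
  have gen: "q' (X (axis i 1) - s (z $ i)) = 0" for i
    unfolding s_def z_def using q'(3)[of "X (axis i 1)"] by (simp add: A_def)
  have nz: "\<forall>i. z $ i \<noteq> 0"
  proof (intro allI notI)
    fix i assume "z $ i = 0"
    then have "q' (X (axis i 1)) = 0" using gen[of i] by (simp add: s_def)
    then have "q' (X (axis i 1) * X (- axis i 1)) = 0" by (rule null_mult)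
    then have "q' 1 = 0" by (simp add: X_add[symmetric] X_0)
    then show False using q'.q_1 by simp
  qed
  have mono: "q' (X n - s (monomial z n)) = 0" for n
  proof (induction n rule: int_vec_induct)
    case zero
    then show ?case by (simp add: X_0 s_def q'.q_0)
  next
    case (plus n i)
    have "X (n + axis i 1) - s (monomial z (n + axis i 1)) =
        (X (axis i 1) - s (z $ i)) * X n + (X n - s (monomial z n)) * s (z $ i)"
      by (simp add: X_add monomial_add[OF nz] s_def q'.sc_mult algebra_simps)
    then show ?case using null_add[OF null_mult[OF gen] null_mult[OF plus]] by simp
  next
    case (minus n i)
    define u where "u = monomial z (n - axis i 1)"
    have n: "monomial z n = u * z $ i" "X n = X (n - axis i 1) * X (axis i 1)"
      using monomial_add[OF nz, of "n - axis i 1" "axis i 1"] X_add[of "n - axis i 1" "axis i 1"]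
      by (simp_all add: u_def)
    have "q' ((X n - s (monomial z n)) - (X (axis i 1) - s (z $ i)) * X (n - axis i 1)) = 0"
      by (rule null_diff[OF minus null_mult[OF gen]])
    also have "(X n - s (monomial z n)) - (X (axis i 1) - s (z $ i)) * X (n - axis i 1) =
        (X (n - axis i 1) - s u) * s (z $ i)"
      by (simp add: n s_def q'.sc_mult algebra_simps)
    finally have "q' ((X (n - axis i 1) - s u) * s (z $ i) * s (inverse (z $ i))) = 0" by (rule null_mult)
    moreover have "s (z $ i) * s (inverse (z $ i)) = 1"
      using nz by (simp add: s_def q'.sc_mult[symmetric])
    ultimately show ?case by (simp add: mult.assoc u_def)
  qed
  have all: "q' (\<phi> - s (laurent (coeffs \<phi>) z)) = 0" for \<phi>
  proof (induction \<phi> rule: poly_mapping_linear_induct)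
    case (single m c)
    have "laurent (coeffs (Poly_Mapping.single m c)) z = c * monomial z m"
      by (simp only: coeffs_single laurent_smul laurent_delta)
    then have "Poly_Mapping.single m c - s (laurent (coeffs (Poly_Mapping.single m c)) z) =
        (X m - s (monomial z m)) * s c"
      by (simp add: X_def s_def mult_single algebra_simps)
    then show ?case using null_mult[OF mono] by simp
  next
    case (add f g)
    have "f + g - s (laurent (coeffs (f + g)) z) =
        (f - s (laurent (coeffs f) z)) + (g - s (laurent (coeffs g) z))"
      by (simp only: coeffs_add laurent_add[OF coeffs_finseqs coeffs_finseqs] s_def q'.sc_add)
         (simp add: algebra_simps)
    then show ?case by (simp only: null_add[OF add])
  qed
  show thesis
  proof (rule that[OF nz])
    fix \<phi> :: "int ^ 'k \<Rightarrow>\<^sub>0 complex"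
    define l where "l = laurent (coeffs \<phi>) z"
    have "cmod l * 1 \<le> cmod l * q' 1" using q'.q_1 by (intro mult_left_mono) auto
    also have "\<dots> = q' (s l * 1)" unfolding s_def by (rule q'.q_sc[symmetric])
    also have "s l * 1 = \<phi> - (\<phi> - s l)" by simp
    also have "q' \<dots> \<le> q' \<phi> + q' (\<phi> - s l)" by (rule q'.q_diff)
    also have "\<dots> = q' \<phi>" using all[of \<phi>] by (simp add: l_def)
    also have "\<dots> \<le> q \<phi>" by (rule q'(2))
    finally show "cmod (laurent (coeffs \<phi>) z) \<le> q \<phi>" by (simp add: l_def)
  qed
qed

text \<open>
  Taking \<open>Y = 0\<close> in the seminorm shows that \<open>z\<close> belongs to \<^const>\<open>Z_set\<close>.  Taking \<open>Y = -1\<close> turns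
  \<open>conv (\<phi> m) - c\<close> into \<open>conv (\<phi> m) - M\<close>, whose norm tends to 0, so that \<open>laurent (\<phi> m) z\<close> tends
  to \<open>c\<close>.
\<close>

lemma spectrum_in_ext_symbol_image:
  assumes M: "M \<in> closed_conv_algebra E N" and c: "c \<in> op_spectrum E N M"
  shows "c \<in> ext_symbol E N M ` Z_set E N"
proof -
  define Q where "Q = (\<lambda>x. M x - smul c x)"
  have Mm: "M \<in> multipliers E N" by (rule closed_conv_algebra_multiplier[OF M])
  have Mb: "bounded_op E N M" by (rule multiplier_bounded[OF Mm])
  have Q: "Q \<in> multipliers E N" unfolding Q_def by (rule multiplier_sub_scalar[OF Mm])
  have Qb: "bounded_op E N Q" by (rule multiplier_bounded[OF Q])
  have "\<not> invertible_op E N Q" using c by (simp add: op_spectrum_iff Q_def)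
  from character_exists[OF scalar_seminorm_ideal[OF Q this]]
  obtain z :: "complex ^ 'k" where nz: "\<forall>i. z $ i \<noteq> 0"
    and z: "\<And>\<phi>. cmod (laurent (coeffs \<phi>) z) \<le> ideal_seminorm Q \<phi>" by blast
  have "cmod (laurent \<phi> z) \<le> op_norm E N (conv \<phi>)" if \<phi>: "\<phi> \<in> finseqs" for \<phi>
  proof -
    obtain f where f: "\<phi> = coeffs f" using finseqs_coeffs_cases[OF \<phi>] .
    have "ideal_seminorm Q f \<le> op_norm E N (\<lambda>x. conv (coeffs f) x + Q 0)"
      by (rule ideal_seminorm_le[OF Q zero_in_commutant[OF Q]])
    then show ?thesis using z[of f] by (simp add: f op_0[OF Qb])
  qed
  then have zZ: "z \<in> Z_set E N" using nz by (simp add: Z_set_def)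
  obtain \<phi> where \<phi>: "\<And>m. \<phi> m \<in> finseqs" "(\<lambda>m. op_norm E N (M - conv (\<phi> m))) \<longlonglongrightarrow> 0"
    "uniform_limit (Z_set E N) (\<lambda>m. laurent (\<phi> m)) (ext_symbol E N M) sequentially"
    using ext_symbol_uniform_limit[OF M] by blast
  have minus_id: "(\<lambda>x. smul (-1) x) \<in> commutant Q"
    using bounded_op_smul[OF bounded_op_id, of "-1"] op_smul[OF Qb] by (simp add: commutant_def)
  have "cmod (laurent (\<phi> m) z - c) \<le> op_norm E N (M - conv (\<phi> m))" for m
  proof -
    define P where "P = \<phi> m - smul c (delta 0)"
    have P: "P \<in> finseqs" unfolding P_def by (intro finseqs_diff finseqs_smul finseqs_delta \<phi>)
    obtain f where f: "P = coeffs f" using finseqs_coeffs_cases[OF P] .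
    have "laurent P z = laurent (\<phi> m) z - c"
      by (simp add: P_def laurent_diff \<phi>(1) finseqs_smul finseqs_delta laurent_smul laurent_delta)
    then have "cmod (laurent (\<phi> m) z - c) \<le> ideal_seminorm Q f" using z[of f] by (simp add: f)
    also have "\<dots> \<le> op_norm E N (\<lambda>x. conv (coeffs f) x + Q (smul (-1) x))"
      by (rule ideal_seminorm_le[OF Q minus_id])
    also have "\<dots> \<le> op_norm E N (M - conv (\<phi> m))"
    proof (rule op_norm_leI)
      show "0 \<le> op_norm E N (M - conv (\<phi> m))"
        by (rule op_norm_approx_nonneg[OF Mb \<phi>(1)])
      fix x assume x: "x \<in> E"
      have mem: "M x \<in> E" "conv (\<phi> m) x \<in> E" using op_mem[OF Mb x] conv_mem[OF \<phi>(1) x] by auto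
      have "conv P x = conv (\<phi> m) x - smul c x"
        unfolding P_def
        by (simp only: conv_diff_left[OF \<phi>(1) finseqs_smul[OF finseqs_delta]] conv_smul_left conv_delta_left translation_0)
      moreover have "Q (smul (-1) x) = smul (-1) (M x - smul c x)"
        using op_smul[OF Qb x] by (simp add: Q_def)
      ultimately have "conv (coeffs f) x + Q (smul (-1) x) = conv (\<phi> m) x - M x"
        unfolding f[symmetric] by (simp only:) (simp add: pointwise)
      then have "N (conv (coeffs f) x + Q (smul (-1) x)) = N (M x - conv (\<phi> m) x)"
        using N_diff_commute[OF mem(2,1)] by simp
      then show "N (conv (coeffs f) x + Q (smul (-1) x)) \<le> op_norm E N (M - conv (\<phi> m)) * N x"
        using op_norm_approx_bound[OF Mb \<phi>(1) x] by simp
    qed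
    finally show ?thesis .
  qed
  then have "(\<lambda>m. laurent (\<phi> m) z - c) \<longlonglongrightarrow> 0"
    by (intro Lim_null_comparison[OF _ \<phi>(2)]) (auto intro: always_eventually)
  then have "(\<lambda>m. laurent (\<phi> m) z) \<longlonglongrightarrow> c" by (simp add: LIM_zero_iff)
  moreover have "(\<lambda>m. laurent (\<phi> m) z) \<longlonglongrightarrow> ext_symbol E N M z"
    by (rule tendsto_uniform_limitI[OF \<phi>(3) zZ])
  ultimately have "c = ext_symbol E N M z" by (rule LIMSEQ_unique)
  then show ?thesis using zZ by blast
qed

end

theorem theorem7:
  fixes E :: "'k::finite seq set" and N :: "'k seq \<Rightarrow> real"
  assumes "banach_seq_space E N"
    and "\<forall>i. bounded_op E N (translation (axis i 1))"
    and "\<forall>i. bounded_op E N (translation (- axis i 1))"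
  shows "(\<forall>M \<in> multipliers E N.
            closure (symbol M ` interior (Z_set E N)) \<subseteq> op_spectrum E N M) \<and>
         (\<forall>M \<in> closed_conv_algebra E N.
            ext_symbol E N M ` Z_set E N = op_spectrum E N M)"
proof -
  interpret banach_seq_space E N by fact
  interpret shift_invariant_space E N using assms by unfold_locales auto
  show ?thesis
  proof (intro conjI ballI)
    fix M assume M: "M \<in> multipliers E N"
    show "closure (symbol M ` interior (Z_set E N)) \<subseteq> op_spectrum E N M"
      by (rule closure_minimal)
         (auto simp: closed_op_spectrum[OF multiplier_bounded[OF M]] intro: symbol_interior_in_spectrum[OF M])
  next
    fix M assume M: "M \<in> closed_conv_algebra E N"
    show "ext_symbol E N M ` Z_set E N = op_spectrum E N M"
      using ext_symbol_in_spectrum[OF M] spectrum_in_ext_symbol_image[OF M] by blast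
  qed
qed

end
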